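(* Let $q$ be a prime power not divisible by $2$ or $3$, let $n\ge 1$, let $H=\mathrm{SL}_{2n}(\mathbb F_q)$, and let $P\subseteq H$ be the Siegel parabolic subgroup of matrices $\begin{bmatrix}A&B\\0&D\end{bmatrix}$ with $A,B,D\in\mathbb F_q^{n\times n}$ and $\det(AD)=1$. Let $\omega\colon P\to\mathbb C^\times$ be a character. Then the representation $\operatorname{Ind}_P^H\omega$ is multiplicity-free as an $H$-representation. Furthermore, the number of its irreducible components equals $$\begin{cases}1&\text{if }\omega^2\ne1,\\ 2&\text{if }\omega^2=1\text{ but }\omega\ne1,\\ n+1&\text{if }\omega=1.\end{cases}$$
   Context: $\operatorname{Ind}_P^H\omega$ is the space of functions $f\colon H\to\mathbb C$ with $f(pg)=\omega(p)f(g)$ for all $p\in P$, $g\in H$, with $H$ acting by right translation. Representations are complex. *)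

theory Defs
  imports
    "HOL-Number_Theory.Prime_Powers"
    "HOL-Algebra.Group"
    "HOL-Library.Function_Algebras"
    "Jordan_Normal_Form.Determinant"
begin

section \<open>Complex representations of a group\<close>

text \<open>
  The representation space \<open>V\<close> is a linear subspace of an ambient complex vector space whose
  carrier is a whole type; only the values \<open>\<rho> g v\<close> with \<open>g\<close> in the group and \<open>v \<in> V\<close> matter.
\<close>

definition complex_rep ::
  "('g, 'm) monoid_scheme \<Rightarrow> (complex \<Rightarrow> 'v \<Rightarrow> 'v::ab_group_add) \<Rightarrow> 'v set \<Rightarrow> ('g \<Rightarrow> 'v \<Rightarrow> 'v) \<Rightarrow> bool"
where
  "complex_rep G scl V \<rho> \<longleftrightarrow>
     group G \<and> vector_space scl \<and> module.subspace scl V \<and>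
     (\<forall>g\<in>carrier G. \<forall>v\<in>V. \<rho> g v \<in> V) \<and>
     (\<forall>g\<in>carrier G. \<forall>v\<in>V. \<forall>w\<in>V. \<rho> g (v + w) = \<rho> g v + \<rho> g w) \<and>
     (\<forall>g\<in>carrier G. \<forall>c. \<forall>v\<in>V. \<rho> g (scl c v) = scl c (\<rho> g v)) \<and>
     (\<forall>v\<in>V. \<rho> \<one>\<^bsub>G\<^esub> v = v) \<and>
     (\<forall>g\<in>carrier G. \<forall>h\<in>carrier G. \<forall>v\<in>V. \<rho> (g \<otimes>\<^bsub>G\<^esub> h) v = \<rho> g (\<rho> h v))"

definition subrep ::
  "('g, 'm) monoid_scheme \<Rightarrow> (complex \<Rightarrow> 'v \<Rightarrow> 'v::ab_group_add) \<Rightarrow> 'v set \<Rightarrow> ('g \<Rightarrow> 'v \<Rightarrow> 'v) \<Rightarrow> 'v set \<Rightarrow> bool"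
where
  "subrep G scl V \<rho> W \<longleftrightarrow>
     W \<subseteq> V \<and> module.subspace scl W \<and> (\<forall>g\<in>carrier G. \<forall>w\<in>W. \<rho> g w \<in> W)"

definition irreducible_rep ::
  "('g, 'm) monoid_scheme \<Rightarrow> (complex \<Rightarrow> 'v \<Rightarrow> 'v::ab_group_add) \<Rightarrow> 'v set \<Rightarrow> ('g \<Rightarrow> 'v \<Rightarrow> 'v) \<Rightarrow> bool"
where
  "irreducible_rep G scl V \<rho> \<longleftrightarrow>
     complex_rep G scl V \<rho> \<and> V \<noteq> {0} \<and> (\<forall>W. subrep G scl V \<rho> W \<longrightarrow> W = {0} \<or> W = V)"

definition isomorphic_subreps ::
  "('g, 'm) monoid_scheme \<Rightarrow> (complex \<Rightarrow> 'v \<Rightarrow> 'v::ab_group_add) \<Rightarrow> ('g \<Rightarrow> 'v \<Rightarrow> 'v) \<Rightarrow> 'v set \<Rightarrow> 'v set \<Rightarrow> bool"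
where
  "isomorphic_subreps G scl \<rho> U W \<longleftrightarrow>
     (\<exists>T. bij_betw T U W \<and>
          (\<forall>u\<in>U. \<forall>v\<in>U. T (u + v) = T u + T v) \<and>
          (\<forall>c. \<forall>u\<in>U. T (scl c u) = scl c (T u)) \<and>
          (\<forall>g\<in>carrier G. \<forall>u\<in>U. T (\<rho> g u) = \<rho> g (T u)))"

text \<open>
  Decompositions of \<open>V\<close> as an internal direct sum of finitely many irreducible
  subrepresentations. Summands are nonzero, hence pairwise distinct as subspaces (even when
  isomorphic), so a set of subspaces suffices to record them.
\<close>

definition irreducible_decomposition ::
  "('g, 'm) monoid_scheme \<Rightarrow> (complex \<Rightarrow> 'v \<Rightarrow> 'v::ab_group_add) \<Rightarrow> 'v set \<Rightarrow> ('g \<Rightarrow> 'v \<Rightarrow> 'v) \<Rightarrow> 'v set set \<Rightarrow> bool"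
where
  "irreducible_decomposition G scl V \<rho> D \<longleftrightarrow>
     finite D \<and>
     (\<forall>W\<in>D. subrep G scl V \<rho> W \<and> irreducible_rep G scl W \<rho>) \<and>
     (\<forall>v\<in>V. \<exists>!f. f \<in> (\<Pi>\<^sub>E W\<in>D. W) \<and> v = (\<Sum>W\<in>D. f W))"

text \<open>
  Existence of a decomposition is part of the definition, so that statements about all
  decompositions of a multiplicity-free representation are not vacuous.
\<close>

definition multiplicity_free ::
  "('g, 'm) monoid_scheme \<Rightarrow> (complex \<Rightarrow> 'v \<Rightarrow> 'v::ab_group_add) \<Rightarrow> 'v set \<Rightarrow> ('g \<Rightarrow> 'v \<Rightarrow> 'v) \<Rightarrow> bool"
where
  "multiplicity_free G scl V \<rho> \<longleftrightarrow>
     complex_rep G scl V \<rho> \<and>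
     (\<exists>D. irreducible_decomposition G scl V \<rho> D) \<and>
     (\<forall>D. irreducible_decomposition G scl V \<rho> D \<longrightarrow>
        (\<forall>U\<in>D. \<forall>W\<in>D. U \<noteq> W \<longrightarrow> \<not> isomorphic_subreps G scl \<rho> U W))"


section \<open>Characters and induction\<close>

definition complex_units :: "complex monoid" where
  "complex_units = \<lparr>carrier = UNIV - {0}, mult = (*), one = 1\<rparr>"

definition group_character :: "('g, 'm) monoid_scheme \<Rightarrow> 'g set \<Rightarrow> ('g \<Rightarrow> complex) \<Rightarrow> bool" where
  "group_character G P \<omega> \<longleftrightarrow> \<omega> \<in> hom (G\<lparr>carrier := P\<rparr>) complex_units"

definition fun_scale :: "complex \<Rightarrow> ('g \<Rightarrow> complex) \<Rightarrow> ('g \<Rightarrow> complex)" where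
  "fun_scale c f = (\<lambda>x. c * f x)"

text \<open>A function on \<open>carrier G\<close> is represented by its extension by zero to the whole type.\<close>

definition Ind_space :: "('g, 'm) monoid_scheme \<Rightarrow> 'g set \<Rightarrow> ('g \<Rightarrow> complex) \<Rightarrow> ('g \<Rightarrow> complex) set" where
  "Ind_space G P \<omega> =
     {f. (\<forall>p\<in>P. \<forall>g\<in>carrier G. f (p \<otimes>\<^bsub>G\<^esub> g) = \<omega> p * f g) \<and> (\<forall>g. g \<notin> carrier G \<longrightarrow> f g = 0)}"

definition right_translation ::
  "('g, 'm) monoid_scheme \<Rightarrow> 'g \<Rightarrow> ('g \<Rightarrow> complex) \<Rightarrow> ('g \<Rightarrow> complex)" where
  "right_translation G h f = (\<lambda>g. if g \<in> carrier G then f (g \<otimes>\<^bsub>G\<^esub> h) else 0)"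

lemma vector_space_fun_scale: "vector_space fun_scale"
  by unfold_locales (auto simp: fun_scale_def fun_eq_iff algebra_simps)

lemma complex_rep_Ind:
  assumes "group G" and "subgroup P G"
  shows "complex_rep G fun_scale (Ind_space G P \<omega>) (right_translation G)"
proof -
  interpret group G by fact
  interpret vs: vector_space "fun_scale :: complex \<Rightarrow> ('a \<Rightarrow> complex) \<Rightarrow> _"
    by (rule vector_space_fun_scale)
  have P: "p \<in> carrier G" if "p \<in> P" for p
    using subgroup.subset[OF assms(2)] that by auto
  show ?thesis
    unfolding complex_rep_def
    by (auto simp: vs.subspace_def Ind_space_def right_translation_def fun_scale_def fun_eq_iff
        algebra_simps m_assoc P assms(1) vector_space_fun_scale)
qed


section \<open>The special linear group and its Siegel parabolic subgroup\<close>

definition SL :: "nat \<Rightarrow> 'a::field mat monoid" where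
  "SL m = \<lparr>carrier = {A \<in> carrier_mat m m. det A = 1}, mult = (*), one = 1\<^sub>m m\<rparr>"

definition Siegel_parabolic :: "nat \<Rightarrow> 'a::field mat set" where
  "Siegel_parabolic n =
     {four_block_mat A B (0\<^sub>m n n) D | A B D.
        A \<in> carrier_mat n n \<and> B \<in> carrier_mat n n \<and> D \<in> carrier_mat n n \<and> det (A * D) = 1}"

lemma group_SL: "group (SL m :: 'a::field mat monoid)"
proof (rule groupI)
  fix A :: "'a mat" assume "A \<in> carrier (SL m)"
  then have A: "A \<in> carrier_mat m m" and d: "det A = 1" by (auto simp: SL_def)
  from det_non_zero_imp_unit[OF A] d obtain B where
    B: "B \<in> carrier_mat m m" "B * A = 1\<^sub>m m"
    by (auto simp: Units_def ring_mat_def)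
  from det_mult[OF B(1) A] B(2) d have "det B = 1" by simp
  with B show "\<exists>B\<in>carrier (SL m). B \<otimes>\<^bsub>SL m\<^esub> A = \<one>\<^bsub>SL m\<^esub>"
    by (auto simp: SL_def)
qed (auto simp: SL_def det_mult)

lemma Siegel_parabolic_subset: "Siegel_parabolic n \<subseteq> carrier (SL (2 * n))"
  by (auto simp: Siegel_parabolic_def SL_def det_mult mult_2 det_four_block_mat_lower_left_zero)

lemma subgroup_Siegel_parabolic:
  "subgroup (Siegel_parabolic n :: 'a::field mat set) (SL (2 * n))"
proof (rule group.subgroupI[OF group_SL Siegel_parabolic_subset])
  have "four_block_mat (1\<^sub>m n) (0\<^sub>m n n) (0\<^sub>m n n) (1\<^sub>m n) \<in> (Siegel_parabolic n :: 'a mat set)"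
    unfolding Siegel_parabolic_def
    by (intro CollectI exI[of _ "1\<^sub>m n"] exI[of _ "0\<^sub>m n n"]) (auto simp: det_mult)
  then show "Siegel_parabolic n \<noteq> ({} :: 'a mat set)" by blast
next
  fix g h :: "'a mat"
  assume "g \<in> Siegel_parabolic n" "h \<in> Siegel_parabolic n"
  then obtain A B D A' B' D' where
    c: "A \<in> carrier_mat n n" "B \<in> carrier_mat n n" "D \<in> carrier_mat n n"
       "A' \<in> carrier_mat n n" "B' \<in> carrier_mat n n" "D' \<in> carrier_mat n n"
    and d: "det (A * D) = 1" "det (A' * D') = 1"
    and g: "g = four_block_mat A B (0\<^sub>m n n) D" and h: "h = four_block_mat A' B' (0\<^sub>m n n) D'"
    unfolding Siegel_parabolic_def by blast
  have "g * h = four_block_mat (A * A') (A * B' + B * D') (0\<^sub>m n n) (D * D')"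
    unfolding g h using c
    by (subst mult_four_block_mat[where ?n1.0 = n and ?n2.0 = n and ?nr1.0 = n and ?nr2.0 = n
          and ?nc1.0 = n and ?nc2.0 = n]) auto
  moreover have "det (A * A' * (D * D')) = 1"
  proof -
    have "det (A * A' * (D * D')) = det (A * D) * det (A' * D')"
      using c by (simp add: det_mult[of _ n] ac_simps)
    with d show ?thesis by simp
  qed
  moreover have "A * A' \<in> carrier_mat n n" "A * B' + B * D' \<in> carrier_mat n n"
    "D * D' \<in> carrier_mat n n"
    using c by auto
  ultimately have "g * h \<in> Siegel_parabolic n"
    unfolding Siegel_parabolic_def by blast
  then show "g \<otimes>\<^bsub>SL (2 * n)\<^esub> h \<in> Siegel_parabolic n"
    by (simp add: SL_def)
next
  fix g :: "'a mat"
  assume gS: "g \<in> Siegel_parabolic n"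
  then obtain A B D where
    c: "A \<in> carrier_mat n n" "B \<in> carrier_mat n n" "D \<in> carrier_mat n n"
    and d: "det (A * D) = 1"
    and g: "g = four_block_mat A B (0\<^sub>m n n) D"
    unfolding Siegel_parabolic_def by blast
  from c d have dd: "det A * det D = 1" by (simp add: det_mult)
  then have "det A \<noteq> 0" "det D \<noteq> 0" by auto
  from det_non_zero_imp_unit[OF c(1) this(1)] det_non_zero_imp_unit[OF c(3) this(2)]
  obtain A' D' where
    c': "A' \<in> carrier_mat n n" "D' \<in> carrier_mat n n"
    and i: "A' * A = 1\<^sub>m n" "D' * D = 1\<^sub>m n"
    by (auto simp: Units_def ring_mat_def)
  define B' where "B' = - (A' * B * D')"
  have B': "B' \<in> carrier_mat n n" using c c' by (auto simp: B'_def)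
  define h where "h = four_block_mat A' B' (0\<^sub>m n n) D'"
  have "B' * D = - (A' * B * (D' * D))"
    unfolding B'_def using c c' by (simp add: assoc_mult_mat[of _ n n _ n _ n])
  then have "A' * B + B' * D = 0\<^sub>m n n"
    unfolding i using c c' by auto
  then have hg: "h * g = 1\<^sub>m (2 * n)"
    unfolding g h_def using c c' B' i
    by (subst mult_four_block_mat[where ?n1.0 = n and ?n2.0 = n and ?nr1.0 = n and ?nr2.0 = n
          and ?nc1.0 = n and ?nc2.0 = n]) (auto simp: mult_2)
  have "det A' * det A = 1" "det D' * det D = 1"
    using det_mult[OF c'(1) c(1)] det_mult[OF c'(2) c(3)] i by auto
  then have "(det A' * det D') * (det A * det D) = 1"
    by (metis mult.assoc mult.left_commute mult_1_right)
  then have "det (A' * D') = 1"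
    using dd c' by (simp add: det_mult[of _ n])
  then have hS: "h \<in> Siegel_parabolic n"
    unfolding Siegel_parabolic_def h_def using c' B' by blast
  have "inv\<^bsub>SL (2 * n)\<^esub> g = h"
    by (rule group.inv_equality[OF group_SL])
       (use hS gS hg Siegel_parabolic_subset in \<open>auto simp: SL_def\<close>)
  with hS show "inv\<^bsub>SL (2 * n)\<^esub> g \<in> Siegel_parabolic n" by simp
qed

end

theory Submission
  imports
    "HOL-Number_Theory.Residues"
    Defs
    "HOL-Computational_Algebra.Fundamental_Theorem_Algebra"
begin

text \<open>
  Write \<open>F\<close> for the field and \<open>H\<close> for \<open>SL\<^sub>2\<^sub>n(F)\<close>. Everything is read off from the Hecke
  algebra of \<open>(P, \<omega>)\<close>: the functions \<open>K\<close> on \<open>H\<close> with \<open>K (p g p') = \<omega> p * K g * \<omega> p'\<close>. Convolution with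
  such a \<open>K\<close> is an endomorphism of the induced representation, and since that representation is
  generated by the function \<open>\<delta>\<close> that equals \<open>\<omega>\<close> on \<open>P\<close> and vanishes off \<open>P\<close>, evaluation at \<open>\<delta>\<close>
  identifies the endomorphism ring with the Hecke algebra. By Maschke's theorem the representation is
  a direct sum of irreducibles. If the endomorphisms commute, then an isomorphism between two summands
  is impossible, because it would have to commute with the projections; moreover every endomorphism
  preserves each summand and is a scalar there by Schur's lemma. Hence the images of \<open>\<delta>\<close> in the
  summands form a basis of the Hecke algebra, and the number of summands is its dimension
  (\<open>multiplicity_free_if_hecke_commutative\<close>).

  The character only sees determinants. Conjugating a transvection by a diagonal matrix with an
  entry \<open>2\<close> squares it, so a multiplicative function on \<open>GL\<^sub>n(F)\<close> is trivial on transvections and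
  depends on the determinant alone (\<open>multiplicative_eq_det\<close>); conjugating the unipotent radical by
  \<open>diag(2, 1/2)\<close> multiplies \<open>B\<close> by \<open>4\<close>, so \<open>\<omega>\<close> is trivial there as \<open>3\<close> is invertible. Consequently
  \<open>\<omega> [A B; 0 D] = \<chi> (det A)\<close> for a character \<open>\<chi>\<close> of \<open>F\<close> (\<open>character_eq\<close>).

  The double cosets of \<open>P\<close> are found from the fact that matrix rings over a field have stable range
  one: if \<open>[A; C]\<close> is the first block column of an invertible matrix, then \<open>A + z C\<close> is invertible for
  some \<open>z\<close>. So each element of \<open>H\<close> lies in \<open>P u(c) P\<close> with \<open>u(c) = [1 0; c 1]\<close>
  (\<open>lower_unipotent_representative\<close>), and a kernel \<open>K\<close> is determined by the function \<open>c \<mapsto> K (u(c))\<close>.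
  That function does not change when \<open>c\<close> is replaced by \<open>X c Y\<close> with \<open>det X = det Y\<close>, and an
  identity in \<open>SL\<^sub>2\<close> of the ring of matrices gives \<open>K (u(s e)) = \<chi> (1 / det s) * K (u(e))\<close> if \<open>s - 1\<close>
  lives on the image of the idempotent \<open>e\<close> (\<open>hecke_shift\<close>). Together these show that \<open>K\<close> is determined
  by its values at \<open>u(e\<^sub>r)\<close> for the diagonal idempotents \<open>e\<^sub>r\<close> of rank \<open>r = 0, ..., n\<close>, that the value
  for \<open>0 < r < n\<close> is zero unless \<open>\<chi> = 1\<close>, and that the value for \<open>r = n\<close> is zero unless \<open>\<chi>\<^sup>2 = 1\<close>.
  The surviving values are realised: by \<open>\<delta>\<close>, by \<open>\<chi>\<close> of the determinant of the lower left block when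
  \<open>\<chi>\<^sup>2 = 1\<close>, and by the indicator functions of the double cosets when \<open>\<chi> = 1\<close>. This gives the
  dimensions \<open>1\<close>, \<open>2\<close> and \<open>n + 1\<close>.

  It remains to see that the Hecke algebra is commutative. If \<open>\<chi>\<^sup>2 \<noteq> 1\<close>, it consists of the multiples of
  its unit \<open>\<delta>\<close>. If \<open>\<chi>\<^sup>2 = 1\<close>, Gelfand's trick applies to the anti-automorphism
  \<open>[A B; C D] \<mapsto> [D\<^sup>T B\<^sup>T; C\<^sup>T A\<^sup>T]\<close>, which fixes every Hecke kernel.
\<close>

section \<open>Complete reducibility, Schur's lemma and commuting endomorphisms\<close>

text \<open>
  The ambient vector space may have infinite dimension; the finite set \<open>B\<close> is what makes \<open>V\<close>
  finite-dimensional.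
\<close>
locale finite_rep = vector_space scale
  for scale :: "complex \<Rightarrow> 'v::ab_group_add \<Rightarrow> 'v" (infixr "*s" 75) +
  fixes G :: "('g, 'm) monoid_scheme" (structure)
    and V :: "'v set" and \<rho> :: "'g \<Rightarrow> 'v \<Rightarrow> 'v" and B :: "'v set"
  assumes rep: "complex_rep G scale V \<rho>"
    and finite_group: "finite (carrier G)"
    and finite_B: "finite B" and V_le_span: "V \<subseteq> span B"
begin

sublocale group G using rep by (simp add: complex_rep_def)

abbreviation "sub \<equiv> subrep G scale V \<rho>"

definition intertwiner :: "'v set \<Rightarrow> 'v set \<Rightarrow> ('v \<Rightarrow> 'v) \<Rightarrow> bool" where
  "intertwiner U W T \<longleftrightarrow> T ` U \<subseteq> W \<and> (\<forall>u\<in>U. \<forall>v\<in>U. T (u + v) = T u + T v) \<and>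
     (\<forall>c. \<forall>u\<in>U. T (c *s u) = c *s T u) \<and> (\<forall>g\<in>carrier G. \<forall>u\<in>U. T (\<rho> g u) = \<rho> g (T u))"

lemma subspace_V: "subspace V"
  and act_closed: "g \<in> carrier G \<Longrightarrow> v \<in> V \<Longrightarrow> \<rho> g v \<in> V"
  and act_add: "g \<in> carrier G \<Longrightarrow> v \<in> V \<Longrightarrow> w \<in> V \<Longrightarrow> \<rho> g (v + w) = \<rho> g v + \<rho> g w"
  and act_scale: "g \<in> carrier G \<Longrightarrow> v \<in> V \<Longrightarrow> \<rho> g (c *s v) = c *s \<rho> g v"
  and act_one: "v \<in> V \<Longrightarrow> \<rho> \<one> v = v"
  and act_mult: "g \<in> carrier G \<Longrightarrow> h \<in> carrier G \<Longrightarrow> v \<in> V \<Longrightarrow> \<rho> (g \<otimes> h) v = \<rho> g (\<rho> h v)"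
  using rep unfolding complex_rep_def by auto

lemma act_zero: "g \<in> carrier G \<Longrightarrow> \<rho> g 0 = 0"
  using act_add[of g 0 0] subspace_0[OF subspace_V] by simp

lemma act_sum:
  assumes "g \<in> carrier G" "\<And>i. i \<in> I \<Longrightarrow> f i \<in> V"
  shows "\<rho> g (sum f I) = (\<Sum>i\<in>I. \<rho> g (f i))"
  using assms(2)
  by (induction I rule: infinite_finite_induct)
     (auto simp: act_zero act_add assms(1) subspace_sum[OF subspace_V])

lemma subrepD:
  assumes "sub W"
  shows "W \<subseteq> V" "subspace W" "g \<in> carrier G \<Longrightarrow> w \<in> W \<Longrightarrow> \<rho> g w \<in> W"
  using assms by (auto simp: subrep_def)

lemma subrep_V: "sub V"
  using subspace_V act_closed by (auto simp: subrep_def)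

lemma complex_rep_subrep: "sub W \<Longrightarrow> complex_rep G scale W \<rho>"
  using rep unfolding complex_rep_def subrep_def by (simp add: subset_iff) 

lemma irreducible_iff:
  assumes "sub W"
  shows "irreducible_rep G scale W \<rho> \<longleftrightarrow> W \<noteq> {0} \<and> (\<forall>U. sub U \<and> U \<subseteq> W \<longrightarrow> U = {0} \<or> U = W)"
proof -
  have "subrep G scale W \<rho> U \<longleftrightarrow> sub U \<and> U \<subseteq> W" for U
    using subrepD(1)[OF assms] unfolding subrep_def by auto
  then show ?thesis using complex_rep_subrep[OF assms] by (simp add: irreducible_rep_def)
qed

lemma intertwinerD:
  assumes "intertwiner U W T"
  shows "u \<in> U \<Longrightarrow> T u \<in> W" "u \<in> U \<Longrightarrow> v \<in> U \<Longrightarrow> T (u + v) = T u + T v"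
    "u \<in> U \<Longrightarrow> T (c *s u) = c *s T u" "g \<in> carrier G \<Longrightarrow> u \<in> U \<Longrightarrow> T (\<rho> g u) = \<rho> g (T u)"
  using assms unfolding intertwiner_def by auto

lemma intertwiner_zero:
  assumes "intertwiner U W T" "subspace U" shows "T 0 = 0"
  using intertwinerD(3)[OF assms(1) subspace_0[OF assms(2)], of 0] by simp

lemma intertwiner_sum:
  assumes "intertwiner U W T" "subspace U" "\<And>i. i \<in> I \<Longrightarrow> f i \<in> U"
  shows "T (sum f I) = (\<Sum>i\<in>I. T (f i))"
  using assms(3)
  by (induction I rule: infinite_finite_induct)
     (auto simp: intertwiner_zero[OF assms(1,2)] intertwinerD(2)[OF assms(1)] subspace_sum[OF assms(2)])

lemma subrep_kernel:
  assumes T: "intertwiner U W T" and U: "sub U" and W: "sub W"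
  shows "sub {u\<in>U. T u = 0}"
  unfolding subrep_def
  using subrepD[OF U] intertwiner_zero[OF T subrepD(2)[OF U]] intertwinerD[OF T] act_zero
  by (auto simp: subspace_def)

lemma intertwiner_restrict:
  "intertwiner U W T \<Longrightarrow> U' \<subseteq> U \<Longrightarrow> W \<subseteq> W' \<Longrightarrow> intertwiner U' W' T"
  unfolding intertwiner_def by (auto simp: subset_iff image_subset_iff)

lemma intertwiner_minus_scalar:
  assumes T: "intertwiner U U T" and U: "sub U"
  shows "intertwiner U U (\<lambda>u. T u - c *s u)"
proof -
  have neg: "\<rho> g (a - c *s b) = \<rho> g a - c *s \<rho> g b" if "g \<in> carrier G" "a \<in> U" "b \<in> U" for g a b
  proof -
    have "a \<in> V" "b \<in> V" using that subrepD(1)[OF U] by auto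
    moreover have "(-c) *s b \<in> V" by (meson \<open>b \<in> V\<close> subspace_V subspace_scale)
    ultimately have "\<rho> g (a + (-c) *s b) = \<rho> g a + (-c) *s \<rho> g b"
      using that by (simp add: act_add act_scale del: scale_minus_left)
    then show ?thesis by simp
  qed
  show ?thesis
    unfolding intertwiner_def
    using intertwinerD[OF T] subrepD[OF U]
    by (auto simp: neg subspace_diff subspace_scale scale_right_distrib scale_right_diff_distrib
        scale_left_commute)
qed

lemma dim_less:
  assumes "subspace S" "S \<subset> U" "U \<subseteq> V"
  shows "dim S < dim U"
proof -
  obtain C where C: "C \<subseteq> S" "independent C" "S \<subseteq> span C" "card C = dim S"
    using basis_exists by blast
  obtain A where A: "A \<subseteq> U" "independent A" "U \<subseteq> span A" "card A = dim U"
    using basis_exists by blast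
  have fA: "finite A"
    using independent_span_bound[OF finite_B A(2)] A(1) assms(3) V_le_span by auto
  have fC: "finite C"
    using independent_span_bound[OF finite_B C(2)] C(1) assms V_le_span by auto
  obtain u where u: "u \<in> U" "u \<notin> S" using assms(2) by auto
  have "span C \<subseteq> S" using C(1) assms(1) by (rule span_minimal)
  then have n: "u \<notin> span C" using u by auto
  then have "independent (insert u C)" using C(2) by (rule independent_insertI)
  moreover have "insert u C \<subseteq> span A" using u C(1) assms(2) A(3) by auto
  ultimately have "card (insert u C) \<le> card A"
    using independent_span_bound[OF fA] by blast
  moreover have "u \<notin> C" using n span_base by auto
  ultimately show ?thesis using fC A(4) C(4) by simp
qed

text \<open>
  Averaging the conjugates of a linear projection onto \<open>W\<close> over the group gives an equivariant
  projection; its kernel in \<open>U\<close> is the complement.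
\<close>
lemma maschke:
  assumes W: "sub W" and U: "sub U" and WU: "W \<subseteq> U"
  obtains W' where "sub W'" "W' \<subseteq> U" "W \<inter> W' = {0}" "\<And>u. u \<in> U \<Longrightarrow> \<exists>w\<in>W. \<exists>w'\<in>W'. u = w + w'"
proof -
  interpret vp: vector_space_pair scale scale ..
  have "Vector_Spaces.linear scale scale id" by (simp add: Vector_Spaces.linear_iff vector_space_axioms)
  from vp.linear_exists_left_inverse_on[OF this subrepD(2)[OF W]]
  obtain \<pi> where \<pi>: "range \<pi> \<subseteq> W" "Vector_Spaces.linear scale scale \<pi>" "\<And>w. w \<in> W \<Longrightarrow> \<pi> w = w" by auto
  have padd: "\<pi> (x + y) = \<pi> x + \<pi> y" and psc: "\<pi> (c *s x) = c *s \<pi> x" for x y c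
    using \<pi>(2) by (auto simp: Vector_Spaces.linear_iff)
  have \<pi>W: "\<pi> x \<in> W" for x using \<pi>(1) by auto
  note UV = subsetD[OF subrepD(1)[OF U]] and WV = subsetD[OF subrepD(1)[OF W]]
  define N where "N = complex_of_nat (card (carrier G))"
  have N: "N \<noteq> 0" using finite_group one_closed by (auto simp: N_def)
  \<comment> \<open>The average is \<open>p\<close>; the unnormalised sum \<open>q\<close> is kept apart because sums are easier to reindex.\<close>
  define q where "q u = (\<Sum>g\<in>carrier G. \<rho> g (\<pi> (\<rho> (inv g) u)))" for u
  define p where "p u = (1 / N) *s q u" for u
  have qW: "q u \<in> W" for u
    unfolding q_def by (intro subspace_sum[OF subrepD(2)[OF W]] subrepD(3)[OF W] \<pi>W)
  have pW: "p u \<in> W" for u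
    unfolding p_def by (intro subspace_scale[OF subrepD(2)[OF W]] qW)
  have pid: "p w = w" if "w \<in> W" for w
  proof -
    have "\<rho> g (\<pi> (\<rho> (inv g) w)) = w" if g: "g \<in> carrier G" for g
    proof -
      have "\<rho> (inv g) w \<in> W" using subrepD(3)[OF W] g \<open>w \<in> W\<close> by auto
      then have "\<rho> g (\<pi> (\<rho> (inv g) w)) = \<rho> (g \<otimes> inv g) w"
        using g act_mult[of g "inv g" w] WV[OF \<open>w \<in> W\<close>] by (simp add: \<pi>(3))
      then show ?thesis using g \<open>w \<in> W\<close> WV act_one by simp
    qed
    then have "q w = N *s w" unfolding q_def N_def
      by (simp add: sum_constant_scale)
    then show ?thesis using N by (simp add: p_def)
  qed
  have padd': "p (u + v) = p u + p v" if "u \<in> U" "v \<in> U" for u v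
  proof -
    have "q (u + v) = q u + q v"
      unfolding q_def sum.distrib[symmetric] using that UV WV \<pi>W
      by (intro sum.cong) (auto simp: act_add padd)
    then show ?thesis by (simp add: p_def scale_right_distrib)
  qed
  have psc': "p (c *s u) = c *s p u" if "u \<in> U" for c u
  proof -
    have "q (c *s u) = c *s q u"
      unfolding q_def scale_sum_right using that UV WV \<pi>W
      by (intro sum.cong) (auto simp: act_scale psc)
    then show ?thesis by (simp add: p_def scale_left_commute)
  qed
  have peq: "p (\<rho> h u) = \<rho> h (p u)" if h: "h \<in> carrier G" and u: "u \<in> U" for h u
  proof -
    have "q (\<rho> h u) = (\<Sum>g\<in>carrier G. \<rho> (h \<otimes> g) (\<pi> (\<rho> (inv (h \<otimes> g)) (\<rho> h u))))"
      unfolding q_def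
      by (rule sum.reindex_bij_betw[symmetric]) (use h in \<open>auto intro!: bij_betwI[where g = "\<lambda>x. inv h \<otimes> x"] simp: m_assoc[symmetric]\<close>)
    also have "\<dots> = (\<Sum>g\<in>carrier G. \<rho> h (\<rho> g (\<pi> (\<rho> (inv g) u))))"
    proof (rule sum.cong)
      fix g assume g: "g \<in> carrier G"
      have "\<rho> (inv (h \<otimes> g)) (\<rho> h u) = \<rho> (inv (h \<otimes> g) \<otimes> h) u"
        using g h u UV by (simp add: act_mult)
      also have "inv (h \<otimes> g) \<otimes> h = inv g"
        using g h by (simp add: inv_mult_group m_assoc)
      finally show "\<rho> (h \<otimes> g) (\<pi> (\<rho> (inv (h \<otimes> g)) (\<rho> h u))) = \<rho> h (\<rho> g (\<pi> (\<rho> (inv g) u)))"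
        using g h \<pi>W WV by (simp add: act_mult)
    qed auto
    also have "\<dots> = \<rho> h (q u)"
      unfolding q_def using h WV \<pi>W act_closed by (subst act_sum) auto
    finally show ?thesis using h WV[OF qW] by (simp add: p_def act_scale)
  qed
  have pI: "intertwiner U W p"
    unfolding intertwiner_def using pW padd' psc' peq by auto
  show ?thesis
  proof
    show "sub {u\<in>U. p u = 0}" using subrep_kernel[OF pI U W] .
    show "W \<inter> {u \<in> U. p u = 0} = {0}"
      using pid subspace_0[OF subrepD(2)[OF W]] subspace_0[OF subrepD(2)[OF U]] by force
    fix u assume u: "u \<in> U"
    have "p u \<in> U" using pW WU by auto
    then have d: "u - p u \<in> U" using u subspace_diff subrepD(2)[OF U] by blast
    have "p (u - p u) + p (p u) = p u"
      using padd'[OF d \<open>p u \<in> U\<close>] by simp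
    then have "p (u - p u) = 0" using pid pW by simp
    then show "\<exists>w\<in>W. \<exists>w'\<in>{u \<in> U. p u = 0}. u = w + w'"
      using d pW by (intro bexI[of _ "p u"] bexI[of _ "u - p u"]) auto
  qed auto
qed

text \<open>
  Uniqueness of the summands of a vector reduces to uniqueness for the zero vector. This form avoids
  the extensional function space in the definition of a decomposition.
\<close>
lemma decompositionI:
  assumes "finite D" and "\<And>W. W \<in> D \<Longrightarrow> sub W \<and> irreducible_rep G scale W \<rho>"
    and U: "U \<subseteq> V" "\<And>W. W \<in> D \<Longrightarrow> W \<subseteq> U"
    and span: "\<And>u. u \<in> U \<Longrightarrow> \<exists>f. (\<forall>W\<in>D. f W \<in> W) \<and> u = (\<Sum>W\<in>D. f W)"
    and indep: "\<And>f W. \<lbrakk>\<And>W. W \<in> D \<Longrightarrow> f W \<in> W; (\<Sum>W\<in>D. f W) = 0; W \<in> D\<rbrakk> \<Longrightarrow> f W = 0"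
  shows "irreducible_decomposition G scale U \<rho> D"
  unfolding irreducible_decomposition_def
proof (intro conjI ballI)
  show "finite D" by fact
next
  fix W assume "W \<in> D"
  with assms(2) U show "subrep G scale U \<rho> W" "irreducible_rep G scale W \<rho>"
    by (auto simp: subrep_def)
next
  fix u assume u: "u \<in> U"
  obtain f where f: "\<forall>W\<in>D. f W \<in> W" "u = (\<Sum>W\<in>D. f W)" using span[OF u] by blast
  show "\<exists>!f. f \<in> (\<Pi>\<^sub>E W\<in>D. W) \<and> u = (\<Sum>W\<in>D. f W)"
  proof (rule ex1I[of _ "restrict f D"])
    show "restrict f D \<in> (\<Pi>\<^sub>E W\<in>D. W) \<and> u = (\<Sum>W\<in>D. restrict f D W)"
      using f by auto
    fix h assume h: "h \<in> (\<Pi>\<^sub>E W\<in>D. W) \<and> u = (\<Sum>W\<in>D. h W)"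
    show "h = restrict f D"
    proof (rule PiE_ext)
      show "h \<in> (\<Pi>\<^sub>E W\<in>D. W)" "restrict f D \<in> (\<Pi>\<^sub>E W\<in>D. W)" using h f by auto
      fix W assume W: "W \<in> D"
      have "h W - f W = 0"
      proof (rule indep[where f = "\<lambda>W. h W - f W"])
        show "h W - f W \<in> W" if "W \<in> D" for W
          using that h f assms(2)[OF that] by (auto intro: subspace_diff subrepD(2))
        show "(\<Sum>W\<in>D. h W - f W) = 0" using h f by (simp add: sum_subtractf)
      qed fact
      then show "h W = restrict f D W" using W by simp
    qed
  qed
qed

lemma decomposition_independent:
  assumes D: "irreducible_decomposition G scale V \<rho> D" and U: "\<And>W. W \<in> D \<Longrightarrow> f W \<in> W"
    and s: "(\<Sum>W\<in>D. f W) = 0" and W: "W \<in> D"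
  shows "f W = 0"
proof -
  have z: "0 \<in> W" if "W \<in> D" for W
    using D that unfolding irreducible_decomposition_def by (meson subrepD(2) subspace_0)
  have "\<exists>!f. f \<in> (\<Pi>\<^sub>E W\<in>D. W) \<and> 0 = (\<Sum>W\<in>D. f W)"
    using D subspace_0[OF subspace_V] unfolding irreducible_decomposition_def by blast
  moreover have "restrict f D \<in> (\<Pi>\<^sub>E W\<in>D. W) \<and> 0 = (\<Sum>W\<in>D. restrict f D W)"
    using U s by auto
  moreover have "restrict (\<lambda>_. 0) D \<in> (\<Pi>\<^sub>E W\<in>D. W) \<and> 0 = (\<Sum>W\<in>D. restrict (\<lambda>_. 0) D W)"
    using z by auto
  ultimately have "restrict f D = restrict (\<lambda>_. 0) D" by blast
  then show ?thesis using W by (metis restrict_apply')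
qed

text \<open>
  Induction on the dimension: a reducible \<open>U\<close> splits as a proper subrepresentation and a complement,
  and the two decompositions are disjoint sets because their members meet in zero only.
\<close>
lemma ex_decomposition_of_sub:
  assumes "sub U"
  shows "\<exists>D. irreducible_decomposition G scale U \<rho> D"
proof -
  let ?good = "\<lambda>U D. finite D \<and> (\<forall>W\<in>D. sub W \<and> irreducible_rep G scale W \<rho> \<and> W \<subseteq> U) \<and>
     (\<forall>u\<in>U. \<exists>f. (\<forall>W\<in>D. f W \<in> W) \<and> u = (\<Sum>W\<in>D. f W)) \<and>
     (\<forall>f. (\<forall>W\<in>D. f W \<in> W) \<and> (\<Sum>W\<in>D. f W) = 0 \<longrightarrow> (\<forall>W\<in>D. f W = 0))"
  have "\<exists>D. ?good U D" using assms
  proof (induction "dim U" arbitrary: U rule: less_induct)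
    case less
    show ?case
    proof (cases "U = {0} \<or> irreducible_rep G scale U \<rho>")
      case True
      then show ?thesis
      proof
        assume "U = {0}" then show ?thesis by (intro exI[of _ "{}"]) auto
      next
        assume "irreducible_rep G scale U \<rho>" then show ?thesis using less.prems
          by (intro exI[of _ "{U}"]) auto
      qed
    next
      case False
      then obtain W where W: "sub W" "W \<subseteq> U" "W \<noteq> {0}" "W \<noteq> U"
        using irreducible_iff[OF less.prems] by auto
      obtain W' where W': "sub W'" "W' \<subseteq> U" "W \<inter> W' = {0}"
        "\<And>u. u \<in> U \<Longrightarrow> \<exists>w\<in>W. \<exists>w'\<in>W'. u = w + w'"
        using maschke[OF W(1) less.prems W(2)] by metis
      have "W' \<noteq> U" using W W'(3) by auto
      have UV: "U \<subseteq> V" using subrepD(1)[OF less.prems] .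
      have "dim W < dim U" using dim_less[OF subrepD(2)[OF W(1)] _ UV] W by auto
      from less.hyps[OF this W(1)] obtain D where D: "?good W D" ..
      note D1 = conjunct1[OF D] and D2 = conjunct1[OF conjunct2[OF D]]
        and D3 = conjunct1[OF conjunct2[OF conjunct2[OF D]]] and D4 = conjunct2[OF conjunct2[OF conjunct2[OF D]]]
      have "dim W' < dim U" using dim_less[OF subrepD(2)[OF W'(1)] _ UV] W' \<open>W' \<noteq> U\<close> by auto
      from less.hyps[OF this W'(1)] obtain D' where D': "?good W' D'" ..
      note D1' = conjunct1[OF D'] and D2' = conjunct1[OF conjunct2[OF D']]
        and D3' = conjunct1[OF conjunct2[OF conjunct2[OF D']]] and D4' = conjunct2[OF conjunct2[OF conjunct2[OF D']]]
      have disj: "D \<inter> D' = {}"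
      proof (rule ccontr)
        assume "D \<inter> D' \<noteq> {}"
        then obtain X where X: "X \<in> D" "X \<in> D'" by auto
        then have "X \<subseteq> W" "X \<subseteq> W'" using D2 D2' by auto
        then have "X \<subseteq> {0}" using W'(3) by blast
        moreover have "X \<noteq> {0}" using X D2 by (auto simp: irreducible_rep_def)
        moreover have "subspace X" using X D2 subrepD(2) by auto
        ultimately show False using subspace_0 by blast
      qed
      have "?good U (D \<union> D')"
      proof (intro conjI ballI allI impI)
        show "finite (D \<union> D')" using D1 D1' by auto
      next
        fix X assume "X \<in> D \<union> D'"
        then have "sub X \<and> irreducible_rep G scale X \<rho> \<and> (X \<subseteq> W \<or> X \<subseteq> W')"
          using D2 D2' by blast
        then show "sub X" "irreducible_rep G scale X \<rho>" "X \<subseteq> U" using W(2) W'(2) by auto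
      next
        fix u assume "u \<in> U"
        then obtain w w' where w: "w \<in> W" "w' \<in> W'" "u = w + w'" using W'(4) by blast
        obtain f where f: "\<forall>X\<in>D. f X \<in> X" "w = (\<Sum>X\<in>D. f X)" using D3 w(1) by blast
        obtain f' where f': "\<forall>X\<in>D'. f' X \<in> X" "w' = (\<Sum>X\<in>D'. f' X)" using D3' w(2) by blast
        let ?h = "\<lambda>X. if X \<in> D then f X else f' X"
        have "(\<Sum>X\<in>D \<union> D'. ?h X) = (\<Sum>X\<in>D. ?h X) + (\<Sum>X\<in>D'. ?h X)"
          using D1 D1' disj by (intro sum.union_disjoint) auto
        also have "(\<Sum>X\<in>D. ?h X) = w" unfolding f(2) by (rule sum.cong) auto
        also have "(\<Sum>X\<in>D'. ?h X) = w'" unfolding f'(2) using disj by (intro sum.cong) auto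
        finally have "u = (\<Sum>X\<in>D \<union> D'. ?h X)" using w by simp
        moreover have "\<forall>X\<in>D \<union> D'. ?h X \<in> X" using f f' by auto
        ultimately show "\<exists>f. (\<forall>X\<in>D \<union> D'. f X \<in> X) \<and> u = (\<Sum>X\<in>D \<union> D'. f X)"
          by (intro exI[of _ ?h] conjI)
      next
        fix f X assume f: "(\<forall>X\<in>D \<union> D'. f X \<in> X) \<and> (\<Sum>X\<in>D \<union> D'. f X) = 0" and X: "X \<in> D \<union> D'"
        let ?a = "\<Sum>X\<in>D. f X" and ?b = "\<Sum>X\<in>D'. f X"
        have ab: "?a + ?b = 0" using f D1 D1' disj by (subst sum.union_disjoint[symmetric]) auto
        have a: "?a \<in> W" using f D2 by (intro subspace_sum[OF subrepD(2)[OF W(1)]]) auto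
        have b: "?b \<in> W'" using f D2' by (intro subspace_sum[OF subrepD(2)[OF W'(1)]]) auto
        have "?a = - ?b" using ab by (simp add: eq_neg_iff_add_eq_0)
        then have "?a \<in> W'" using b subspace_neg[OF subrepD(2)[OF W'(1)]] by simp
        then have "?a = 0" using a W'(3) by blast
        then have "?b = 0" using ab by simp
        show "f X = 0"
        proof (cases "X \<in> D")
          case True
          have "(\<forall>X\<in>D. f X \<in> X) \<and> ?a = 0" using f \<open>?a = 0\<close> by auto
          then show ?thesis using D4 True by blast
        next
          case False
          have "(\<forall>X\<in>D'. f X \<in> X) \<and> ?b = 0" using f \<open>?b = 0\<close> by auto
          then show ?thesis using D4' False X by blast
        qed
      qed
      then show ?thesis ..
    qed
  qed
  then obtain D where D: "?good U D" ..
  have "irreducible_decomposition G scale U \<rho> D"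
  proof (rule decompositionI)
    show "finite D" "U \<subseteq> V" using D subrepD(1)[OF assms] by simp_all
    show "sub W \<and> irreducible_rep G scale W \<rho>" "W \<subseteq> U" if "W \<in> D" for W
      using conjunct1[OF conjunct2[OF D]] that by auto
    show "\<exists>f. (\<forall>W\<in>D. f W \<in> W) \<and> u = (\<Sum>W\<in>D. f W)" if "u \<in> U" for u
      using conjunct1[OF conjunct2[OF conjunct2[OF D]]] that ..
    show "f W = 0" if "\<And>W. W \<in> D \<Longrightarrow> f W \<in> W" "(\<Sum>W\<in>D. f W) = 0" "W \<in> D" for f W
      using conjunct2[OF conjunct2[OF conjunct2[OF D]]] that by simp
  qed
  then show ?thesis ..
qed

definition poly_apply :: "('v \<Rightarrow> 'v) \<Rightarrow> complex poly \<Rightarrow> 'v \<Rightarrow> 'v" where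
  "poly_apply T p w = (\<Sum>i\<le>degree p. coeff p i *s (T ^^ i) w)"

lemma poly_apply_le:
  "degree p \<le> N \<Longrightarrow> poly_apply T p w = (\<Sum>i\<le>N. coeff p i *s (T ^^ i) w)"
  unfolding poly_apply_def by (rule sum.mono_neutral_left) (auto simp: coeff_eq_0)

lemma intertwiner_funpow:
  "intertwiner W W T \<Longrightarrow> w \<in> W \<Longrightarrow> (T ^^ i) w \<in> W"
  by (induction i) (auto dest: intertwinerD)

lemma poly_apply_closed:
  "intertwiner W W T \<Longrightarrow> sub W \<Longrightarrow> w \<in> W \<Longrightarrow> poly_apply T p w \<in> W"
  unfolding poly_apply_def
  by (intro subspace_sum[OF subrepD(2)] subspace_scale[OF subrepD(2)] intertwiner_funpow)

text \<open>
  With this rule, splitting off one root of a polynomial that annihilates \<open>w\<close> either produces an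
  eigenvector or an annihilating polynomial of smaller degree.
\<close>
lemma poly_apply_linear_factor:
  assumes T: "intertwiner W W T" and W: "sub W" and w: "w \<in> W"
  shows "poly_apply T ([:-c, 1:] * p) w = T (poly_apply T p w) - c *s poly_apply T p w"
proof -
  let ?N = "degree p"
  have sW: "subspace W" using W by (rule subrepD(2))
  have e: "[:-c, 1:] * p = pCons 0 p + smult (-c) p" by simp
  have d: "degree ([:-c, 1:] * p) \<le> Suc ?N"
    using degree_mult_le[of "[:-c, 1:]" p] by simp
  have "T (poly_apply T p w) = (\<Sum>i\<le>?N. coeff p i *s (T ^^ Suc i) w)"
    unfolding poly_apply_def
    using intertwiner_funpow[OF T w] subspace_scale[OF sW]
    by (subst intertwiner_sum[OF T sW]) (auto simp: intertwinerD(3)[OF T])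
  also have "\<dots> = (\<Sum>i\<le>Suc ?N. coeff (pCons 0 p) i *s (T ^^ i) w)"
    by (subst sum.atMost_Suc_shift) (simp del: funpow.simps)
  finally have 1: "(\<Sum>i\<le>Suc ?N. coeff (pCons 0 p) i *s (T ^^ i) w) = T (poly_apply T p w)" by simp
  have "(\<Sum>i\<le>Suc ?N. coeff (smult (-c) p) i *s (T ^^ i) w) = (-c) *s (\<Sum>i\<le>Suc ?N. coeff p i *s (T ^^ i) w)"
    unfolding scale_sum_right by (rule sum.cong) auto
  also have "(\<Sum>i\<le>Suc ?N. coeff p i *s (T ^^ i) w) = poly_apply T p w"
    by (rule poly_apply_le[symmetric]) simp
  finally have 2: "(\<Sum>i\<le>Suc ?N. coeff (smult (-c) p) i *s (T ^^ i) w) = - (c *s poly_apply T p w)"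
    by simp
  have "poly_apply T ([:-c, 1:] * p) w = (\<Sum>i\<le>Suc ?N. coeff (pCons 0 p + smult (-c) p) i *s (T ^^ i) w)"
    using poly_apply_le[OF d, of T w] unfolding e .
  also have "\<dots> = (\<Sum>i\<le>Suc ?N. coeff (pCons 0 p) i *s (T ^^ i) w) + (\<Sum>i\<le>Suc ?N. coeff (smult (-c) p) i *s (T ^^ i) w)"
    unfolding sum.distrib[symmetric] coeff_add scale_left_distrib ..
  finally show ?thesis unfolding 1 2 by simp
qed

lemma eigenvector_if_annihilated:
  assumes T: "intertwiner W W T" and W: "sub W" and w: "w \<in> W" "w \<noteq> 0"
  shows "p \<noteq> 0 \<Longrightarrow> poly_apply T p w = 0 \<Longrightarrow> \<exists>c. \<exists>v\<in>W. v \<noteq> 0 \<and> T v = c *s v"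
proof (induction "degree p" arbitrary: p rule: less_induct)
  case less
  show ?case
  proof (cases "degree p = 0")
    case True
    then obtain a where "p = [:a:]" by (metis degree_eq_zeroE)
    then show ?thesis using less.prems w by (simp add: poly_apply_def)
  next
    case False
    then obtain c where "poly p c = 0"
      using fundamental_theorem_of_algebra[of p] constant_degree[of p] by auto
    then obtain r where r: "p = [:-c, 1:] * r" by (auto simp: poly_eq_0_iff_dvd dvd_def)
    then have "r \<noteq> 0" using less.prems by auto
    then have "degree p = Suc (degree r)" unfolding r by (subst degree_mult_eq) auto
    show ?thesis
    proof (cases "poly_apply T r w = 0")
      case True
      then show ?thesis using less.hyps[of r] \<open>r \<noteq> 0\<close> \<open>degree p = _\<close> by auto
    next
      case False
      have "T (poly_apply T r w) = c *s poly_apply T r w"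
        using poly_apply_linear_factor[OF T W w(1), of c r] less.prems(2) unfolding r by simp
      then show ?thesis using False poly_apply_closed[OF T W w(1)] by blast
    qed
  qed
qed

text \<open>
  The vectors \<open>w, T w, ..., T\<^sup>N w\<close> with \<open>N = card B\<close> are too many to be distinct and independent; both ways
  of failing give a linear relation, whose coefficients form the polynomial.
\<close>
lemma ex_annihilating_poly:
  assumes T: "intertwiner W W T" and W: "sub W" and w: "w \<in> W"
  shows "\<exists>p. p \<noteq> 0 \<and> poly_apply T p w = 0"
proof -
  let ?f = "\<lambda>i. (T ^^ i) w"
  define N where "N = card B"
  have le: "degree (\<Sum>i\<le>N. monom (a i) i) \<le> N" for a :: "nat \<Rightarrow> complex"
    by (rule degree_sum_le) (auto intro: order.trans[OF degree_monom_le])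
  have co: "coeff (\<Sum>i\<le>N. monom (a i) i) j = (if j \<le> N then a j else 0)" for a :: "nat \<Rightarrow> complex" and j
    by (simp add: coeff_sum coeff_monom)
  have *: "\<exists>p. p \<noteq> 0 \<and> poly_apply T p w = 0"
    if "(\<Sum>i\<le>N. a i *s ?f i) = 0" "k \<le> N" "a k \<noteq> 0" for a k
  proof (intro exI[of _ "\<Sum>i\<le>N. monom (a i) i"] conjI)
    show "(\<Sum>i\<le>N. monom (a i) i) \<noteq> 0" using co[of a k] that by (metis coeff_0)
    show "poly_apply T (\<Sum>i\<le>N. monom (a i) i) w = 0"
      unfolding poly_apply_le[OF le] co using that by simp
  qed
  show ?thesis
  proof (cases "inj_on ?f {..N}")
    case False
    then obtain i j where ij: "i \<le> N" "j \<le> N" "i \<noteq> j" "?f i = ?f j" by (auto simp: inj_on_def)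
    let ?a = "\<lambda>l. (if l = i then 1 else 0) - (if l = j then 1 else 0) :: complex"
    have "(\<Sum>l\<le>N. ?a l *s ?f l) = (\<Sum>l\<le>N. (if l = i then ?f l else 0)) - (\<Sum>l\<le>N. (if l = j then ?f l else 0))"
      unfolding sum_subtractf[symmetric] by (rule sum.cong) (auto simp: scale_left_diff_distrib)
    also have "\<dots> = 0" using ij by simp
    finally show ?thesis using *[of ?a i] ij by auto
  next
    case True
    have sub: "?f ` {..N} \<subseteq> span B"
      using intertwiner_funpow[OF T w] subrepD(1)[OF W] V_le_span by blast
    have "\<not> independent (?f ` {..N})"
    proof
      assume "independent (?f ` {..N})"
      then have "card (?f ` {..N}) \<le> card B" using independent_span_bound[OF finite_B _ sub] by blast
      then show False using card_image[OF True] by (simp add: N_def)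
    qed
    then obtain u k where u: "k \<le> N" "u (?f k) \<noteq> 0" "(\<Sum>v\<in>?f ` {..N}. u v *s v) = 0"
      by (auto simp: dependent_finite)
    then have "(\<Sum>i\<le>N. u (?f i) *s ?f i) = 0" by (simp add: sum.reindex[OF True])
    then show ?thesis using *[of "\<lambda>i. u (?f i)" k] u by auto
  qed
qed

text \<open>
  An eigenvalue \<open>c\<close> exists over the complex numbers, and the kernel of \<open>T - c\<close> is a nonzero
  subrepresentation, hence all of \<open>W\<close>.
\<close>
lemma schur:
  assumes W: "sub W" and irr: "irreducible_rep G scale W \<rho>" and T: "intertwiner W W T"
  obtains c where "\<And>w. w \<in> W \<Longrightarrow> T w = c *s w"
proof -
  have W0: "W \<noteq> {0}" using irr by (simp add: irreducible_rep_def)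
  then obtain w where w: "w \<in> W" "w \<noteq> 0" using subspace_0[OF subrepD(2)[OF W]] by blast
  obtain c v where v: "v \<in> W" "v \<noteq> 0" "T v = c *s v"
    using ex_annihilating_poly[OF T W w(1)] eigenvector_if_annihilated[OF T W w] by blast
  have "sub {u\<in>W. T u - c *s u = 0}"
    using subrep_kernel[OF intertwiner_minus_scalar[OF T W] W W] .
  moreover have "v \<in> {u\<in>W. T u - c *s u = 0}" using v by simp
  ultimately have "{u\<in>W. T u - c *s u = 0} = W"
    using irr v(2) unfolding irreducible_iff[OF W] by blast
  then show ?thesis using that by auto
qed

definition component :: "'v set set \<Rightarrow> 'v set \<Rightarrow> 'v \<Rightarrow> 'v" where
  "component D W v = (THE f. f \<in> (\<Pi>\<^sub>E W\<in>D. W) \<and> v = (\<Sum>W\<in>D. f W)) W"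

context
  fixes D assumes D: "irreducible_decomposition G scale V \<rho> D"
begin

lemma summand: "W \<in> D \<Longrightarrow> sub W" "W \<in> D \<Longrightarrow> irreducible_rep G scale W \<rho>" "finite D"
  using D by (auto simp: irreducible_decomposition_def)

lemma component_props:
  assumes "v \<in> V"
  shows "W \<in> D \<Longrightarrow> component D W v \<in> W" "(\<Sum>W\<in>D. component D W v) = v"
proof -
  have "\<exists>!f. f \<in> (\<Pi>\<^sub>E W\<in>D. W) \<and> v = (\<Sum>W\<in>D. f W)"
    using D assms unfolding irreducible_decomposition_def by blast
  from theI'[OF this] show "W \<in> D \<Longrightarrow> component D W v \<in> W" "(\<Sum>W\<in>D. component D W v) = v"
    unfolding component_def by auto
qed

lemma component_unique:
  assumes f: "\<And>W. W \<in> D \<Longrightarrow> f W \<in> W" and W: "W \<in> D"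
  shows "component D W (\<Sum>W\<in>D. f W) = f W"
proof -
  let ?v = "\<Sum>W\<in>D. f W"
  have v: "?v \<in> V"
    using f subrepD(1)[OF summand(1)] by (intro subspace_sum[OF subspace_V]) blast
  have "component D W ?v - f W = 0"
  proof (rule decomposition_independent[OF D, where f = "\<lambda>W. component D W ?v - f W"])
    show "component D W ?v - f W \<in> W" if "W \<in> D" for W
      using subspace_diff[OF subrepD(2)[OF summand(1)[OF that]] component_props(1)[OF v that] f[OF that]] .
    show "(\<Sum>W\<in>D. component D W ?v - f W) = 0"
      by (simp add: sum_subtractf component_props(2)[OF v])
  qed fact
  then show ?thesis by simp
qed

lemma component_summand:
  assumes "W \<in> D" "X \<in> D" "w \<in> W"
  shows "component D X w = (if X = W then w else 0)"
proof -
  let ?f = "\<lambda>X. if X = W then w else 0"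
  have "(\<Sum>X\<in>D. ?f X) = w" using assms summand(3) by simp
  moreover have "component D X (\<Sum>X\<in>D. ?f X) = ?f X"
    using assms summand(1) subrepD(2) subspace_0 by (intro component_unique) auto
  ultimately show ?thesis by simp
qed

lemma component_intertwiner:
  assumes W: "W \<in> D" shows "intertwiner V W (component D W)"
  unfolding intertwiner_def
proof (intro conjI ballI allI image_subsetI)
  fix v assume v: "v \<in> V"
  note cv = component_props[OF v]
  show "component D W v \<in> W" using cv(1)[OF W] .
  show "component D W (v + u) = component D W v + component D W u" if u: "u \<in> V" for u
  proof -
    note cu = component_props[OF u]
    have "component D W (\<Sum>W\<in>D. component D W v + component D W u) = component D W v + component D W u"
      using cv(1) cu(1) summand(1) subrepD(2) subspace_add W by (intro component_unique) auto
    then show ?thesis by (simp add: sum.distrib cv cu)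
  qed
  show "component D W (c *s v) = c *s component D W v" for c
  proof -
    have "component D W (\<Sum>W\<in>D. c *s component D W v) = c *s component D W v"
      using cv(1) summand(1) subrepD(2) subspace_scale W by (intro component_unique) auto
    then show ?thesis by (simp add: scale_sum_right[symmetric] cv)
  qed
  show "component D W (\<rho> g v) = \<rho> g (component D W v)" if g: "g \<in> carrier G" for g
  proof -
    have "component D W (\<Sum>W\<in>D. \<rho> g (component D W v)) = \<rho> g (component D W v)"
      using cv(1) summand(1) subrepD(3) g W by (intro component_unique) auto
    moreover have "\<rho> g (\<Sum>W\<in>D. component D W v) = (\<Sum>W\<in>D. \<rho> g (component D W v))"
      using cv(1) subrepD(1)[OF summand(1)] by (intro act_sum[OF g]) blast
    then have "(\<Sum>W\<in>D. \<rho> g (component D W v)) = \<rho> g v" by (simp only: cv(2))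
    ultimately show ?thesis by simp
  qed
qed

lemma summands_disjoint:
  assumes "U \<in> D" "W \<in> D" "U \<noteq> W" "x \<in> U" "x \<in> W" shows "x = 0"
  using component_summand[of U W x] component_summand[of W W x] assms by auto

lemma summand_nonzero: "W \<in> D \<Longrightarrow> \<exists>w\<in>W. w \<noteq> 0"
  using summand(2) subspace_0[OF subrepD(2)[OF summand(1)]] unfolding irreducible_rep_def by blast

context
  assumes comm: "\<And>S T v. intertwiner V V S \<Longrightarrow> intertwiner V V T \<Longrightarrow> v \<in> V \<Longrightarrow> S (T v) = T (S v)"
begin

text \<open>
  Extend an isomorphism \<open>\<tau>\<close> from \<open>U\<close> to \<open>W\<close> by zero on the other summands. Projecting to \<open>W\<close> after this
  endomorphism gives \<open>\<tau> u\<close> at a point \<open>u\<close> of \<open>U\<close>, projecting before it gives zero.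
\<close>
lemma summands_not_isomorphic:
  assumes UW: "U \<in> D" "W \<in> D" "U \<noteq> W"
  shows "\<not> isomorphic_subreps G scale \<rho> U W"
proof
  assume "isomorphic_subreps G scale \<rho> U W"
  then obtain \<tau> where "bij_betw \<tau> U W" and \<tau>: "intertwiner U W \<tau>"
    unfolding isomorphic_subreps_def intertwiner_def bij_betw_def by blast
  then have inj: "inj_on \<tau> U" by (simp add: bij_betw_def)
  note U = component_intertwiner[OF UW(1)] and W = component_intertwiner[OF UW(2)]
  have UV: "U \<subseteq> V" and WV: "W \<subseteq> V" using UW summand(1) subrepD(1) by auto
  have S: "intertwiner V V (\<lambda>v. \<tau> (component D U v))"
    using intertwinerD[OF U] intertwinerD[OF \<tau>] WV unfolding intertwiner_def by auto
  have Q: "intertwiner V V (component D W)" using intertwiner_restrict[OF W order.refl WV] .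
  obtain u where u: "u \<in> U" "u \<noteq> 0" using summand_nonzero UW by blast
  have sU: "subspace U" using UW summand(1) subrepD(2) by blast
  have "\<tau> (component D U (component D W u)) = component D W (\<tau> (component D U u))"
    using comm[OF S Q] u UV by blast
  also have "component D W u = 0" using component_summand[of U W u] UW u by auto
  also have "component D U u = u" using component_summand[of U U u] UW u by auto
  also have "component D U 0 = 0" using intertwiner_zero[OF U subspace_V] .
  also have "component D W (\<tau> u) = \<tau> u"
    using component_summand[of W W "\<tau> u"] UW intertwinerD(1)[OF \<tau> u(1)] by auto
  finally have "\<tau> 0 = \<tau> u" .
  then show False using inj u subspace_0[OF sU] by (auto simp: inj_on_def)
qed

text \<open>
  Think of \<open>E\<close> as the endomorphism ring, embedded by evaluation at a generator \<open>\<delta>\<close>. The projections to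
  the summands are independent, and they span because an endomorphism that commutes with them
  acts on each summand, by a scalar.
\<close>
lemma card_summands:
  assumes \<delta>: "\<delta> \<in> V"
    and E: "\<And>T. intertwiner V V T \<Longrightarrow> T \<delta> \<in> E"
    and lift: "\<And>K. K \<in> E \<Longrightarrow> \<exists>T. intertwiner V V T \<and> T \<delta> = K"
    and inj: "\<And>T v. intertwiner V V T \<Longrightarrow> T \<delta> = 0 \<Longrightarrow> v \<in> V \<Longrightarrow> T v = 0"
  shows "card D = dim E"
proof -
  let ?d = "\<lambda>W. component D W \<delta>"
  have pi: "intertwiner V V (component D W)" if "W \<in> D" for W
    using intertwiner_restrict[OF component_intertwiner[OF that] order.refl] that summand(1) subrepD(1) by blast
  have dW: "?d W \<in> W" if "W \<in> D" for W using component_props(1)[OF \<delta> that] .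
  have nz: "?d W \<noteq> 0" if "W \<in> D" for W
  proof
    assume 0: "?d W = 0"
    obtain w where w: "w \<in> W" "w \<noteq> 0" using summand_nonzero[OF \<open>W \<in> D\<close>] by blast
    then have "w \<in> V" using that summand(1) subrepD(1) by blast
    then have "component D W w = 0" using inj[OF pi[OF that] 0] by blast
    then show False using component_summand[of W W w] that w by simp
  qed
  have injd: "inj_on ?d D"
  proof (rule inj_onI, rule ccontr)
    fix U W assume *: "U \<in> D" "W \<in> D" "?d U = ?d W" "U \<noteq> W"
    then have "?d U \<in> U" "?d U \<in> W" using dW[of U] dW[of W] by auto
    then show False using summands_disjoint[of U W "?d U"] * nz by auto
  qed
  have sub: "?d ` D \<subseteq> E" using E pi by auto
  have ind: "independent (?d ` D)"
  proof (rule independent_if_scalars_zero)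
    show "finite (?d ` D)" using summand(3) by simp
    fix f x assume s: "(\<Sum>x\<in>?d ` D. f x *s x) = 0" and x: "x \<in> ?d ` D"
    then obtain W where W: "W \<in> D" "x = ?d W" by auto
    have "(\<Sum>W\<in>D. f (?d W) *s ?d W) = 0" using s by (simp add: sum.reindex[OF injd])
    then have "f (?d W) *s ?d W = 0"
      using dW summand(1) subrepD(2) subspace_scale W(1)
      by (intro decomposition_independent[OF D, where f = "\<lambda>W. f (?d W) *s ?d W"]) auto
    then show "f x = 0" using nz W by auto
  qed
  have "E \<subseteq> span (?d ` D)"
  proof
    fix K assume "K \<in> E"
    then obtain T where T: "intertwiner V V T" "T \<delta> = K" using lift by blast
    have "T (?d W) \<in> span (?d ` D)" if W: "W \<in> D" for W
    proof -
      have WV: "W \<subseteq> V" using W summand(1) subrepD(1) by blast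
      have "T w \<in> W" if w: "w \<in> W" for w
      proof -
        have "T w = T (component D W w)" using component_summand[of W W w] W w by simp
        also have "\<dots> = component D W (T w)" using comm[OF T(1) pi[OF W]] w WV by blast
        also have "\<dots> \<in> W" using component_props(1)[OF _ W] intertwinerD(1)[OF T(1)] w WV by blast
        finally show ?thesis .
      qed
      then have "intertwiner W W T" using T(1) WV unfolding intertwiner_def by (auto simp: subset_iff)
      then obtain c where "\<And>w. w \<in> W \<Longrightarrow> T w = c *s w"
        using schur[OF summand(1)[OF W] summand(2)[OF W]] by blast
      then have "T (?d W) = c *s ?d W" using dW[OF W] by blast
      then show ?thesis using W by (auto intro: span_scale span_base)
    qed
    then have "(\<Sum>W\<in>D. T (?d W)) \<in> span (?d ` D)" by (rule span_sum)
    also have "(\<Sum>W\<in>D. T (?d W)) = T (\<Sum>W\<in>D. ?d W)"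
      using dW subrepD(1)[OF summand(1)] by (intro intertwiner_sum[OF T(1) subspace_V, symmetric]) blast
    also have "\<dots> = K" using component_props(2)[OF \<delta>] T(2) by simp
    finally show "K \<in> span (?d ` D)" .
  qed
  from basis_card_eq_dim[OF sub this ind] show ?thesis by (simp add: card_image[OF injd])
qed

end

end

end

section \<open>The Hecke algebra of an induced character\<close>

lemma sum_fun_apply: "(\<Sum>i\<in>I. f i) x = (\<Sum>i\<in>I. f i x)" for f :: "'i \<Rightarrow> 'b \<Rightarrow> 'c::comm_monoid_add"
  by (induction I rule: infinite_finite_induct) auto

interpretation fs: vector_space fun_scale
  by (rule vector_space_fun_scale)

locale induced_rep = group G for G :: "('g, 'm) monoid_scheme" (structure) +
  fixes P :: "'g set" and \<omega> :: "'g \<Rightarrow> complex"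
  assumes fin: "finite (carrier G)"
    and subP: "subgroup P G"
    and char: "group_character G P \<omega>"
begin

lemma cancel: "x \<in> carrier G \<Longrightarrow> a \<in> carrier G \<Longrightarrow> inv x \<otimes> (x \<otimes> a) = a"
  "x \<in> carrier G \<Longrightarrow> a \<in> carrier G \<Longrightarrow> x \<otimes> (inv x \<otimes> a) = a"
  by (simp_all add: m_assoc[symmetric])

lemma P_carrier: "p \<in> P \<Longrightarrow> p \<in> carrier G" using subgroup.subset[OF subP] by auto

lemma char_mult: "p \<in> P \<Longrightarrow> r \<in> P \<Longrightarrow> \<omega> (p \<otimes> r) = \<omega> p * \<omega> r"
  and char_nonzero: "p \<in> P \<Longrightarrow> \<omega> p \<noteq> 0"
  using char by (auto simp: group_character_def hom_def complex_units_def)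

lemma P_closed: "p \<in> P \<Longrightarrow> r \<in> P \<Longrightarrow> p \<otimes> r \<in> P" "\<one> \<in> P" "p \<in> P \<Longrightarrow> inv p \<in> P"
  using subP by (auto simp: subgroup_def)

lemma char_one: "\<omega> \<one> = 1"
  using char_mult[OF P_closed(2,2)] char_nonzero[OF P_closed(2)] by simp

lemma char_inv: "p \<in> P \<Longrightarrow> \<omega> (inv p) * \<omega> p = 1"
  using char_mult[OF P_closed(3), of p p] char_one by (simp add: P_carrier)

abbreviation "Ind \<equiv> Ind_space G P \<omega>"
abbreviation "R \<equiv> right_translation G"

lemma IndD: "f \<in> Ind \<Longrightarrow> p \<in> P \<Longrightarrow> g \<in> carrier G \<Longrightarrow> f (p \<otimes> g) = \<omega> p * f g"
  "f \<in> Ind \<Longrightarrow> g \<notin> carrier G \<Longrightarrow> f g = 0"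
  by (auto simp: Ind_space_def)

definition point_masses :: "('g \<Rightarrow> complex) set" where
  "point_masses = (\<lambda>x y. if y = x then 1 else 0) ` carrier G"

lemma Ind_le_span: "Ind \<subseteq> fs.span point_masses"
proof
  fix f assume f: "f \<in> Ind"
  have "f = (\<Sum>x\<in>carrier G. fun_scale (f x) (\<lambda>y. if y = x then 1 else 0))"
  proof
    fix y
    have "(\<Sum>x\<in>carrier G. fun_scale (f x) (\<lambda>y. if y = x then 1 else 0)) y =
      (\<Sum>x\<in>carrier G. if y = x then f x else 0)"
      unfolding sum_fun_apply by (rule sum.cong) (auto simp: fun_scale_def)
    also have "\<dots> = f y" using fin IndD(2)[OF f, of y] by simp
    finally show "f y = (\<Sum>x\<in>carrier G. fun_scale (f x) (\<lambda>y. if y = x then 1 else 0)) y" ..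
  qed
  also have "\<dots> \<in> fs.span point_masses"
    by (intro fs.span_sum fs.span_scale fs.span_base) (auto simp: point_masses_def)
  finally show "f \<in> fs.span point_masses" .
qed

sublocale rep: finite_rep fun_scale G Ind R point_masses
proof
  show "complex_rep G fun_scale Ind R" using complex_rep_Ind[OF _ subP] is_group by blast
  show "finite point_masses" using fin by (simp add: point_masses_def)
qed (use fin Ind_le_span in auto)

text \<open>
  The Hecke algebra of \<open>(P, \<omega>)\<close>: the functions that transform by \<open>\<omega>\<close> under \<open>P\<close> on both sides. As a
  subspace of the induced representation it is the \<open>\<omega>\<close>-eigenspace of \<open>P\<close>.
\<close>
definition hecke :: "('g \<Rightarrow> complex) set" where
  "hecke = {K \<in> Ind. \<forall>p\<in>P. \<forall>g\<in>carrier G. K (g \<otimes> p) = \<omega> p * K g}"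

text \<open>
  The unit of the Hecke algebra, and a generator of the induced representation.
\<close>
definition \<delta> :: "'g \<Rightarrow> complex" where "\<delta> x = (if x \<in> P then \<omega> x else 0)"

text \<open>
  The factor \<open>1 / card P\<close> makes \<open>\<delta>\<close> a unit.
\<close>
definition conv :: "('g \<Rightarrow> complex) \<Rightarrow> ('g \<Rightarrow> complex) \<Rightarrow> 'g \<Rightarrow> complex" where
  "conv K f x = (if x \<in> carrier G then 1 / of_nat (card P) * (\<Sum>y\<in>carrier G. K (x \<otimes> inv y) * f y) else 0)"

lemma heckeD: "K \<in> hecke \<Longrightarrow> K \<in> Ind"
  "K \<in> hecke \<Longrightarrow> p \<in> P \<Longrightarrow> g \<in> carrier G \<Longrightarrow> K (g \<otimes> p) = \<omega> p * K g"
  by (auto simp: hecke_def)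

lemma mult_mem_P_iff:
  "p \<in> P \<Longrightarrow> g \<in> carrier G \<Longrightarrow> p \<otimes> g \<in> P \<longleftrightarrow> g \<in> P"
  "p \<in> P \<Longrightarrow> g \<in> carrier G \<Longrightarrow> g \<otimes> p \<in> P \<longleftrightarrow> g \<in> P"
proof -
  assume p: "p \<in> P" and g: "g \<in> carrier G"
  have "g = inv p \<otimes> (p \<otimes> g)" using p g by (simp add: P_carrier m_assoc[symmetric])
  then show "p \<otimes> g \<in> P \<longleftrightarrow> g \<in> P" using p P_closed by metis
  have "g = (g \<otimes> p) \<otimes> inv p" using p g by (simp add: P_carrier m_assoc)
  then show "g \<otimes> p \<in> P \<longleftrightarrow> g \<in> P" using p P_closed by metis
qed

lemma delta_hecke: "\<delta> \<in> hecke"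
  by (auto simp: hecke_def Ind_space_def \<delta>_def mult_mem_P_iff char_mult P_carrier)

lemma finite_P: "finite P" using fin subgroup.subset[OF subP] finite_subset by auto

lemma card_P: "complex_of_nat (card P) \<noteq> 0"
  using finite_P P_closed(2) by auto

lemma conv_intertwiner:
  assumes K: "K \<in> Ind"
  shows "rep.intertwiner Ind Ind (conv K)"
  unfolding rep.intertwiner_def
proof (intro conjI ballI allI image_subsetI)
  fix f assume f: "f \<in> Ind"
  show "conv K f \<in> Ind"
    unfolding Ind_space_def
  proof (intro CollectI conjI ballI allI impI)
    fix p g assume p: "p \<in> P" and g: "g \<in> carrier G"
    have "(\<Sum>y\<in>carrier G. K (p \<otimes> g \<otimes> inv y) * f y) = (\<Sum>y\<in>carrier G. \<omega> p * (K (g \<otimes> inv y) * f y))"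
      using p g by (intro sum.cong) (auto simp: m_assoc IndD(1)[OF K] P_carrier)
    then show "conv K f (p \<otimes> g) = \<omega> p * conv K f g"
      using p g by (simp add: conv_def P_carrier sum_distrib_left)
  qed (simp add: conv_def)
  show "conv K (f + f') = conv K f + conv K f'" for f'
    by (auto simp: conv_def fun_eq_iff algebra_simps sum.distrib add_divide_distrib)
  show "conv K (fun_scale c f) = fun_scale c (conv K f)" for c
    by (auto simp: conv_def fun_eq_iff fun_scale_def algebra_simps sum_distrib_left)
  show "conv K (R h f) = R h (conv K f)" if h: "h \<in> carrier G" for h
  proof
    fix x
    have "(\<Sum>y\<in>carrier G. K (x \<otimes> inv y) * R h f y) = (\<Sum>z\<in>carrier G. K (x \<otimes> h \<otimes> inv z) * f z)"
      if x: "x \<in> carrier G"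
    proof -
      have "(\<Sum>z\<in>carrier G. K (x \<otimes> h \<otimes> inv z) * f z) =
          (\<Sum>y\<in>carrier G. K (x \<otimes> h \<otimes> inv (y \<otimes> h)) * f (y \<otimes> h))"
        by (rule sum.reindex_bij_betw[symmetric, of "\<lambda>y. y \<otimes> h"])
           (use h in \<open>auto intro!: bij_betwI[where g = "\<lambda>x. x \<otimes> inv h"] simp: m_assoc\<close>)
      also have "\<dots> = (\<Sum>y\<in>carrier G. K (x \<otimes> inv y) * R h f y)"
      proof (rule sum.cong)
        fix y assume y: "y \<in> carrier G"
        have "x \<otimes> h \<otimes> inv (y \<otimes> h) = x \<otimes> inv y"
          using x y h by (simp add: inv_mult_group m_assoc cancel)
        then show "K (x \<otimes> h \<otimes> inv (y \<otimes> h)) * f (y \<otimes> h) = K (x \<otimes> inv y) * R h f y"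
          using x y h by (simp add: right_translation_def)
      qed simp
      finally show ?thesis ..
    qed
    then show "conv K (R h f) x = R h (conv K f) x"
      using h by (auto simp: conv_def right_translation_def)
  qed
qed

lemma conv_delta:
  assumes K: "K \<in> hecke" shows "conv K \<delta> = K"
proof
  fix x
  show "conv K \<delta> x = K x"
  proof (cases "x \<in> carrier G")
    case True
    have "(\<Sum>y\<in>carrier G. K (x \<otimes> inv y) * \<delta> y) = (\<Sum>y\<in>P. K (x \<otimes> inv y) * \<delta> y)"
      using fin P_carrier by (intro sum.mono_neutral_right) (auto simp: \<delta>_def)
    also have "\<dots> = (\<Sum>y\<in>P. K x)"
    proof (rule sum.cong)
      fix y assume y: "y \<in> P"
      have "K (x \<otimes> inv y) * \<delta> y = (\<omega> (inv y) * \<omega> y) * K x"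
        using y True by (simp add: heckeD(2)[OF K] P_closed \<delta>_def)
      then show "K (x \<otimes> inv y) * \<delta> y = K x" using char_inv[OF y] by simp
    qed simp
    finally show ?thesis using True card_P by (simp add: conv_def)
  next
    case False
    then show ?thesis using IndD(2)[OF heckeD(1)[OF K]] by (simp add: conv_def)
  qed
qed

text \<open>
  Every \<open>f\<close> is the combination of the translates of \<open>\<delta>\<close> with the values of \<open>f\<close> as coefficients, so an
  endomorphism is determined by its value at \<open>\<delta>\<close>.
\<close>
lemma intertwiner_eq_conv:
  assumes T: "rep.intertwiner Ind Ind T" and f: "f \<in> Ind"
  shows "T f = conv (T \<delta>) f"
proof -
  let ?c = "1 / complex_of_nat (card P)"
  have \<delta>: "\<delta> \<in> Ind" using delta_hecke by (rule heckeD)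
  have T\<delta>: "T \<delta> \<in> Ind" using rep.intertwinerD(1)[OF T \<delta>] .
  have sum_eq: "(\<Sum>y\<in>carrier G. fun_scale (?c * f y) (R (inv y) K)) = conv K f" for K
    by (rule ext) (auto simp: sum_fun_apply conv_def fun_scale_def right_translation_def
        sum_distrib_left intro!: sum.cong)
  have "f = conv \<delta> f"
  proof
    fix x
    show "f x = conv \<delta> f x"
    proof (cases "x \<in> carrier G")
      case True
      have "(\<Sum>y\<in>carrier G. \<delta> (x \<otimes> inv y) * f y) = (\<Sum>z\<in>carrier G. \<delta> z * f (inv z \<otimes> x))"
        by (rule sum.reindex_bij_witness[where i = "\<lambda>z. inv z \<otimes> x" and j = "\<lambda>y. x \<otimes> inv y"])
           (use True in \<open>auto simp: inv_mult_group m_assoc cancel\<close>)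
      also have "\<dots> = (\<Sum>z\<in>P. \<delta> z * f (inv z \<otimes> x))"
        using fin P_carrier by (intro sum.mono_neutral_right) (auto simp: \<delta>_def)
      also have "\<dots> = (\<Sum>z\<in>P. f x)"
      proof (rule sum.cong)
        fix z assume z: "z \<in> P"
        have "\<delta> z * f (inv z \<otimes> x) = (\<omega> (inv z) * \<omega> z) * f x"
          using z True by (simp add: IndD(1)[OF f] P_closed \<delta>_def)
        then show "\<delta> z * f (inv z \<otimes> x) = f x" using char_inv[OF z] by simp
      qed simp
      finally show ?thesis using True card_P by (simp add: conv_def)
    next
      case False then show ?thesis using IndD(2)[OF f] by (simp add: conv_def)
    qed
  qed
  also have "\<dots> = (\<Sum>y\<in>carrier G. fun_scale (?c * f y) (R (inv y) \<delta>))" by (rule sum_eq[symmetric])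
  finally have "T f = T (\<Sum>y\<in>carrier G. fun_scale (?c * f y) (R (inv y) \<delta>))" by (rule arg_cong)
  also have "\<dots> = (\<Sum>y\<in>carrier G. T (fun_scale (?c * f y) (R (inv y) \<delta>)))"
    using \<delta> by (intro rep.intertwiner_sum[OF T rep.subspace_V] fs.subspace_scale[OF rep.subspace_V] rep.act_closed) auto
  also have "\<dots> = (\<Sum>y\<in>carrier G. fun_scale (?c * f y) (R (inv y) (T \<delta>)))"
    using \<delta> by (intro sum.cong) (auto simp: rep.intertwinerD(3)[OF T rep.act_closed] rep.intertwinerD(4)[OF T])
  also have "\<dots> = conv (T \<delta>) f" by (rule sum_eq)
  finally show ?thesis .
qed

lemma intertwiner_hecke:
  assumes T: "rep.intertwiner Ind Ind T"
  shows "T \<delta> \<in> hecke"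
proof -
  have \<delta>: "\<delta> \<in> Ind" using delta_hecke by (rule heckeD)
  have "T \<delta> (g \<otimes> p) = \<omega> p * T \<delta> g" if p: "p \<in> P" and g: "g \<in> carrier G" for p g
  proof -
    have "R p \<delta> = fun_scale (\<omega> p) \<delta>"
      using p heckeD(2)[OF delta_hecke] IndD(2)[OF \<delta>]
      by (auto simp: right_translation_def fun_scale_def fun_eq_iff)
    then have "R p (T \<delta>) = fun_scale (\<omega> p) (T \<delta>)"
      using rep.intertwinerD(3,4)[OF T] P_carrier[OF p] \<delta> by metis
    then show ?thesis using g by (simp add: right_translation_def fun_scale_def fun_eq_iff split: if_splits)
  qed
  then show ?thesis using rep.intertwinerD(1)[OF T \<delta>] by (simp add: hecke_def)
qed

lemma intertwiner_comp:
  "rep.intertwiner Ind Ind S \<Longrightarrow> rep.intertwiner Ind Ind T \<Longrightarrow> rep.intertwiner Ind Ind (\<lambda>v. S (T v))"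
  unfolding rep.intertwiner_def by (auto simp: image_subset_iff)

lemma conv_hecke: "K \<in> hecke \<Longrightarrow> L \<in> hecke \<Longrightarrow> conv K L \<in> hecke"
  using intertwiner_hecke[OF intertwiner_comp[OF conv_intertwiner conv_intertwiner, of K L]]
  by (simp add: heckeD conv_delta)

text \<open>
  Composition of endomorphisms corresponds to convolution of their values at \<open>\<delta>\<close>, so a commutative
  Hecke algebra means commuting endomorphisms.
\<close>
theorem multiplicity_free_if_hecke_commutative:
  assumes comm: "\<And>K L. K \<in> hecke \<Longrightarrow> L \<in> hecke \<Longrightarrow> conv K L = conv L K"
  shows "multiplicity_free G fun_scale Ind R"
    and "irreducible_decomposition G fun_scale Ind R D \<Longrightarrow> card D = fs.dim hecke"
proof -
  have \<delta>: "\<delta> \<in> Ind" using delta_hecke by (rule heckeD)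
  have c: "S (T v) = T (S v)"
    if S: "rep.intertwiner Ind Ind S" and T: "rep.intertwiner Ind Ind T" and v: "v \<in> Ind" for S T v
  proof -
    have "S (T \<delta>) = T (S \<delta>)"
      using intertwiner_eq_conv[OF S heckeD(1)[OF intertwiner_hecke[OF T]]]
        intertwiner_eq_conv[OF T heckeD(1)[OF intertwiner_hecke[OF S]]]
        comm[OF intertwiner_hecke[OF S] intertwiner_hecke[OF T]] by simp
    then show ?thesis
      using intertwiner_eq_conv[OF intertwiner_comp[OF S T] v] intertwiner_eq_conv[OF intertwiner_comp[OF T S] v]
      by simp
  qed
  show "multiplicity_free G fun_scale Ind R"
    unfolding multiplicity_free_def
    using rep.rep rep.ex_decomposition_of_sub[OF rep.subrep_V] rep.summands_not_isomorphic c by auto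
  assume D: "irreducible_decomposition G fun_scale Ind R D"
  show "card D = fs.dim hecke"
  proof (rule rep.card_summands[OF D])
    show "S (T v) = T (S v)"
      if "rep.intertwiner Ind Ind S" "rep.intertwiner Ind Ind T" "v \<in> Ind" for S T v
      using c[OF that] .
    show "\<delta> \<in> Ind" by (rule \<delta>)
    show "T \<delta> \<in> hecke" if "rep.intertwiner Ind Ind T" for T using intertwiner_hecke[OF that] .
    show "\<exists>T. rep.intertwiner Ind Ind T \<and> T \<delta> = K" if "K \<in> hecke" for K
      using conv_intertwiner[OF heckeD(1)[OF that]] conv_delta[OF that] by blast
    show "T v = 0" if "rep.intertwiner Ind Ind T" "T \<delta> = 0" "v \<in> Ind" for T v
      using intertwiner_eq_conv[OF that(1,3)] that(2) by (auto simp: conv_def fun_eq_iff)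
  qed
qed

text \<open>
  Gelfand's trick: substituting \<open>\<sigma>\<close> in a convolution exchanges the two factors, but all functions
  involved are invariant under \<open>\<sigma>\<close>.
\<close>
lemma conv_commute_if_anti_invariant:
  assumes \<sigma>: "bij_betw \<sigma> (carrier G) (carrier G)"
    and anti: "\<And>x y. x \<in> carrier G \<Longrightarrow> y \<in> carrier G \<Longrightarrow> \<sigma> (x \<otimes> y) = \<sigma> y \<otimes> \<sigma> x"
    and invariant: "\<And>K x. K \<in> hecke \<Longrightarrow> x \<in> carrier G \<Longrightarrow> K (\<sigma> x) = K x"
    and K: "K \<in> hecke" and L: "L \<in> hecke"
  shows "conv K L = conv L K"
proof
  fix x
  have \<sigma>c: "\<sigma> x \<in> carrier G" if "x \<in> carrier G" for x using \<sigma> that by (auto simp: bij_betw_def)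
  have "\<sigma> \<one> \<otimes> \<sigma> \<one> = \<sigma> \<one>" using anti[of \<one> \<one>] by simp
  then have \<sigma>1: "\<sigma> \<one> = \<one>" using \<sigma>c[of \<one>] by simp
  have \<sigma>inv: "\<sigma> (inv z) = inv (\<sigma> z)" if "z \<in> carrier G" for z
    using anti[of z "inv z"] that \<sigma>1 \<sigma>c[of z] \<sigma>c[of "inv z"] by (simp add: inv_equality)
  show "conv K L x = conv L K x"
  proof (cases "x \<in> carrier G")
    case x: True
    have "(\<Sum>y\<in>carrier G. K (\<sigma> x \<otimes> inv y) * L y) = (\<Sum>z\<in>carrier G. K (\<sigma> x \<otimes> inv (\<sigma> z)) * L (\<sigma> z))"
      by (rule sum.reindex_bij_betw[OF \<sigma>, symmetric])
    also have "\<dots> = (\<Sum>z\<in>carrier G. K (inv z \<otimes> x) * L z)"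
    proof (rule sum.cong)
      fix z assume z: "z \<in> carrier G"
      have "\<sigma> x \<otimes> inv (\<sigma> z) = \<sigma> (inv z \<otimes> x)" using anti[of "inv z" x] x z \<sigma>inv by simp
      then show "K (\<sigma> x \<otimes> inv (\<sigma> z)) * L (\<sigma> z) = K (inv z \<otimes> x) * L z"
        using x z by (simp add: invariant[OF K] invariant[OF L])
    qed simp
    also have "\<dots> = (\<Sum>u\<in>carrier G. L (x \<otimes> inv u) * K u)"
      by (rule sum.reindex_bij_witness[where i = "\<lambda>u. x \<otimes> inv u" and j = "\<lambda>z. inv z \<otimes> x"])
         (use x in \<open>auto simp: inv_mult_group m_assoc cancel\<close>)
    finally have "conv K L (\<sigma> x) = conv L K x" using x \<sigma>c by (simp add: conv_def)
    then show ?thesis using invariant[OF conv_hecke[OF K L] x] by simp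
  qed (simp add: conv_def)
qed

lemma conv_commute_if_multiples_of_delta:
  assumes "\<And>K. K \<in> hecke \<Longrightarrow> \<exists>c. K = fun_scale c \<delta>"
    and K: "K \<in> hecke" and L: "L \<in> hecke"
  shows "conv K L = conv L K"
proof -
  obtain a b where ab: "K = fun_scale a \<delta>" "L = fun_scale b \<delta>" using assms by meson
  have "conv M (fun_scale c \<delta>) = fun_scale c M" if "M \<in> hecke" for M c
    using rep.intertwinerD(3)[OF conv_intertwiner[OF heckeD(1)[OF that]] heckeD(1)[OF delta_hecke]]
      conv_delta[OF that] by simp
  then have "conv K (fun_scale b \<delta>) = fun_scale b K" "conv L (fun_scale a \<delta>) = fun_scale a L"
    using K L by auto
  then have "conv K L = fun_scale b (fun_scale a \<delta>)" "conv L K = fun_scale a (fun_scale b \<delta>)"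
    using ab by auto
  then show ?thesis by (simp add: fs.scale_left_commute)
qed

lemma subspace_hecke: "fs.subspace hecke"
  unfolding hecke_def fs.subspace_def using rep.subspace_V
  by (auto simp: fs.subspace_def fun_scale_def algebra_simps)

text \<open>
  Evaluation at the points \<open>x i\<close> is a system of coordinates on the Hecke algebra with dual basis \<open>F\<close>.
\<close>
lemma dim_hecke:
  assumes I: "finite I"
    and x: "\<And>K. K \<in> hecke \<Longrightarrow> (\<And>i. i \<in> I \<Longrightarrow> K (x i) = 0) \<Longrightarrow> K = 0"
    and F: "\<And>i. i \<in> I \<Longrightarrow> F i \<in> hecke"
    and dual: "\<And>i j. i \<in> I \<Longrightarrow> j \<in> I \<Longrightarrow> F i (x j) = (if i = j then 1 else 0)"
  shows "fs.dim hecke = card I"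
proof -
  note sub = subspace_hecke
  have inj: "inj_on F I" using dual by (metis inj_onI zero_neq_one)
  have ev: "(\<Sum>i\<in>I. fun_scale (c i) (F i)) (x j) = c j" if "j \<in> I" for c j
  proof -
    have "(\<Sum>i\<in>I. fun_scale (c i) (F i)) (x j) = (\<Sum>i\<in>I. if i = j then c i else 0)"
      unfolding sum_fun_apply using dual that by (intro sum.cong) (auto simp: fun_scale_def)
    then show ?thesis using I that by simp
  qed
  have "fs.independent (F ` I)"
  proof (rule fs.independent_if_scalars_zero)
    fix f y assume "(\<Sum>y\<in>F ` I. fun_scale (f y) y) = 0" and y: "y \<in> F ` I"
    then have "(\<Sum>i\<in>I. fun_scale (f (F i)) (F i)) = 0" by (simp add: sum.reindex[OF inj])
    then show "f y = 0" using ev[of _ "\<lambda>i. f (F i)"] y by auto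
  qed (use I in auto)
  moreover have "hecke \<subseteq> fs.span (F ` I)"
  proof
    fix K assume K: "K \<in> hecke"
    let ?L = "\<Sum>i\<in>I. fun_scale (K (x i)) (F i)"
    have L: "?L \<in> hecke" using F by (intro fs.subspace_sum[OF sub] fs.subspace_scale[OF sub])
    have "K - ?L = 0"
    proof (rule x)
      show "K - ?L \<in> hecke" using K L by (rule fs.subspace_diff[OF sub])
      show "(K - ?L) (x j) = 0" if "j \<in> I" for j using ev[OF that, of "\<lambda>i. K (x i)"] by simp
    qed
    moreover have "?L \<in> fs.span (F ` I)" by (intro fs.span_sum fs.span_scale fs.span_base) auto
    ultimately show "K \<in> fs.span (F ` I)" by simp
  qed
  moreover have "F ` I \<subseteq> hecke" using F by auto
  ultimately show ?thesis using fs.basis_card_eq_dim card_image[OF inj] by metis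
qed

end

section \<open>Gaussian elimination and the stable range of matrix rings\<close>

lemma mult_carrier_square [simp]:
  "A \<in> carrier_mat n n \<Longrightarrow> B \<in> carrier_mat n n \<Longrightarrow> A * B \<in> carrier_mat n n"
  by (rule mult_carrier_mat)

lemma addrow_mat_index:
  assumes "C \<in> carrier_mat n m" "l < n" "i < n" "j < m"
  shows "(addrow_mat n a k l * C) $$ (i, j) = (if k = i then a * C $$ (l, j) + C $$ (i, j) else C $$ (i, j))"
  using assms addrow_mat[OF assms(1,2), of a k] by (metis carrier_matD index_mat_addrow(1))

lemma multrow_mat_index:
  assumes "C \<in> carrier_mat n m" "i < n" "j < m"
  shows "(multrow_mat n k a * C) $$ (i, j) = (if k = i then a * C $$ (i, j) else C $$ (i, j))"
  using assms multrow_mat[OF assms(1), of k a] by (metis carrier_matD index_mat_multrow(1))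

text \<open>
  Products of transvections and invertible diagonal matrices. This is all of \<open>GL\<^sub>n\<close> (\<open>elementary_iff\<close>);
  the generation statement is what allows multiplicative functions to be computed by induction.
\<close>
inductive_set elementary :: "nat \<Rightarrow> 'a::field mat set" for n where
  one: "1\<^sub>m n \<in> elementary n"
| addrow: "X \<in> elementary n \<Longrightarrow> k < n \<Longrightarrow> l < n \<Longrightarrow> k \<noteq> l \<Longrightarrow> addrow_mat n a k l * X \<in> elementary n"
| multrow: "X \<in> elementary n \<Longrightarrow> k < n \<Longrightarrow> a \<noteq> 0 \<Longrightarrow> multrow_mat n k a * X \<in> elementary n"

lemma elementary_carrier: "X \<in> elementary n \<Longrightarrow> X \<in> carrier_mat n n"
  by (induction rule: elementary.induct) auto

lemma elementary_mult: "X \<in> elementary n \<Longrightarrow> Y \<in> elementary n \<Longrightarrow> X * Y \<in> elementary n"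
proof (induction rule: elementary.induct)
  case one
  then show ?case using elementary_carrier by (metis left_mult_one_mat)
next
  case (addrow X k l a)
  then show ?case
    by (subst assoc_mult_mat[of _ n n _ n _ n]) (auto intro: elementary.addrow elementary_carrier)
next
  case (multrow X k a)
  then show ?case
    by (subst assoc_mult_mat[of _ n n _ n _ n]) (auto intro: elementary.multrow elementary_carrier)
qed

lemma elementary_generators:
  "k < n \<Longrightarrow> l < n \<Longrightarrow> k \<noteq> l \<Longrightarrow> addrow_mat n a k l \<in> elementary n"
  "k < n \<Longrightarrow> a \<noteq> 0 \<Longrightarrow> multrow_mat n k a \<in> elementary n"
  using elementary.addrow[OF elementary.one, of k n l a] elementary.multrow[OF elementary.one, of k n a] by auto

lemma elementary_transpose: "X \<in> elementary n \<Longrightarrow> X\<^sup>T \<in> elementary n"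
proof (induction rule: elementary.induct)
  case one
  then show ?case by (simp add: elementary.one)
next
  case (addrow X k l a)
  have "(addrow_mat n a k l)\<^sup>T = addrow_mat n a l k" by (rule eq_matI) auto
  then have "(addrow_mat n a k l * X)\<^sup>T = X\<^sup>T * addrow_mat n a l k"
    using addrow elementary_carrier by (subst transpose_mult[of _ n n _ n]) auto
  then show ?case using addrow by (auto intro: elementary_mult elementary_generators)
next
  case (multrow X k a)
  have "(multrow_mat n k a)\<^sup>T = multrow_mat n k a" by (rule eq_matI) auto
  then have "(multrow_mat n k a * X)\<^sup>T = X\<^sup>T * multrow_mat n k a"
    using multrow elementary_carrier by (subst transpose_mult[of _ n n _ n]) auto
  then show ?case using multrow by (auto intro: elementary_mult elementary_generators)
qed

lemma elementary_inverse:
  "X \<in> elementary n \<Longrightarrow> \<exists>Y\<in>elementary n. Y * X = 1\<^sub>m n"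
proof (induction rule: elementary.induct)
  case one
  then show ?case using elementary.one by (intro bexI[of _ "1\<^sub>m n"]) auto
next
  case (addrow X k l a)
  then obtain Y where Y: "Y \<in> elementary n" "Y * X = 1\<^sub>m n" by auto
  note c = elementary_carrier[OF Y(1)] elementary_carrier[OF addrow(1)]
  have "(Y * addrow_mat n (-a) k l) * (addrow_mat n a k l * X) =
      Y * ((addrow_mat n (-a) k l * addrow_mat n (-(-a)) k l) * X)"
    using c addrow_mat_carrier[of n _ k l] by (simp add: assoc_mult_mat[of _ n n _ n _ n])
  also have "addrow_mat n (-a) k l * addrow_mat n (-(-a)) k l = 1\<^sub>m n"
    using addrow by (intro addrow_mat_inv) auto
  finally show ?case using Y c addrow
    by (intro bexI[of _ "Y * addrow_mat n (-a) k l"]) (auto intro: elementary_mult elementary_generators)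
next
  case (multrow X k a)
  then obtain Y where Y: "Y \<in> elementary n" "Y * X = 1\<^sub>m n" by auto
  note c = elementary_carrier[OF Y(1)] elementary_carrier[OF multrow(1)]
  have "(Y * multrow_mat n k (inverse a)) * (multrow_mat n k a * X) =
      Y * ((multrow_mat n k (inverse a) * multrow_mat n k (inverse (inverse a))) * X)"
    using c by (simp add: assoc_mult_mat[of _ n n _ n _ n])
  also have "multrow_mat n k (inverse a) * multrow_mat n k (inverse (inverse a)) = 1\<^sub>m n"
    using multrow by (intro multrow_mat_inv) auto
  finally show ?case using Y c multrow
    by (intro bexI[of _ "Y * multrow_mat n k (inverse a)"]) (auto intro!: elementary_mult[OF Y(1)] elementary_generators(2))
qed

definition rank_idem :: "nat \<Rightarrow> nat \<Rightarrow> 'a::field mat" where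
  "rank_idem n r = mat n n (\<lambda>(i,j). if i = j \<and> i < r then 1 else 0)"

lemma rank_idem_simps [simp]:
  "rank_idem n r \<in> carrier_mat n n" "dim_row (rank_idem n r) = n" "dim_col (rank_idem n r) = n"
  "i < n \<Longrightarrow> j < n \<Longrightarrow> rank_idem n r $$ (i,j) = (if i = j \<and> i < r then 1 else 0)"
  "(rank_idem n r)\<^sup>T = rank_idem n r" "rank_idem n n = 1\<^sub>m n" "rank_idem n 0 = 0\<^sub>m n n"
  by (auto simp: rank_idem_def intro!: eq_matI)

lemma det_rank_idem:
  assumes "r < n" shows "det (rank_idem n r) = 0"
proof -
  have "det (rank_idem n r) = prod_list (diag_mat (rank_idem n r))"
    by (rule det_upper_triangular[of _ n]) auto
  moreover have "rank_idem n r $$ (r, r) \<in> set (diag_mat (rank_idem n r))"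
    unfolding diag_mat_def using assms by auto
  then have "0 \<in> set (diag_mat (rank_idem n r))" using assms by simp
  ultimately show ?thesis by (metis prod_list_zero_iff)
qed

definition elementary_equiv :: "nat \<Rightarrow> 'a::field mat \<Rightarrow> 'a mat \<Rightarrow> bool" where
  "elementary_equiv n C C' \<longleftrightarrow> C \<in> carrier_mat n n \<and> (\<exists>X\<in>elementary n. \<exists>Y\<in>elementary n. C' = X * C * Y)"

lemma elementary_equiv_carrier: "elementary_equiv n C C' \<Longrightarrow> C' \<in> carrier_mat n n"
  by (auto simp: elementary_equiv_def dest!: elementary_carrier)

lemma elementary_equiv_trans:
  assumes "elementary_equiv n C C'" "elementary_equiv n C' C''"
  shows "elementary_equiv n C C''"
proof -
  obtain X Y X' Y' where XY: "X \<in> elementary n" "Y \<in> elementary n" "C' = X * C * Y" "C \<in> carrier_mat n n"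
    "X' \<in> elementary n" "Y' \<in> elementary n" "C'' = X' * C' * Y'"
    using assms by (auto simp: elementary_equiv_def)
  have "C'' = (X' * X) * C * (Y * Y')"
    using XY elementary_carrier[OF XY(1)] elementary_carrier[OF XY(2)] elementary_carrier[OF XY(5)]
      elementary_carrier[OF XY(6)] by (simp add: assoc_mult_mat[of _ n n _ n _ n])
  then show ?thesis
    unfolding elementary_equiv_def using XY(4) elementary_mult[OF XY(5,1)] elementary_mult[OF XY(2,6)] by blast
qed

lemma elementary_equiv_row:
  "C \<in> carrier_mat n n \<Longrightarrow> X \<in> elementary n \<Longrightarrow> elementary_equiv n C (X * C)"
  unfolding elementary_equiv_def using elementary.one elementary_carrier[of X n]
  by (metis mult_carrier_mat right_mult_one_mat)

lemma elementary_equiv_transpose: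
  assumes "elementary_equiv n C C'" shows "elementary_equiv n C\<^sup>T C'\<^sup>T"
proof -
  obtain X Y where XY: "X \<in> elementary n" "Y \<in> elementary n" "C' = X * C * Y" "C \<in> carrier_mat n n"
    using assms by (auto simp: elementary_equiv_def)
  have "C'\<^sup>T = Y\<^sup>T * C\<^sup>T * X\<^sup>T"
    using XY elementary_carrier[OF XY(1)] elementary_carrier[OF XY(2)]
    by (simp add: transpose_mult[of _ n n _ n] assoc_mult_mat[of _ n n _ n _ n])
  then show ?thesis using XY elementary_transpose by (auto simp: elementary_equiv_def)
qed

text \<open>
  The state of Gaussian elimination after \<open>k\<close> pivots. The condition is symmetric under transposition, so
  that column operations reduce to row operations.
\<close>
definition cleared :: "nat \<Rightarrow> nat \<Rightarrow> 'a::field mat \<Rightarrow> bool" where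
  "cleared n k C \<longleftrightarrow> (\<forall>i<n. \<forall>j<n. i < k \<or> j < k \<longrightarrow> C $$ (i,j) = (if i = j then 1 else 0))"

lemma cleared_transpose: "C \<in> carrier_mat n n \<Longrightarrow> cleared n k C \<Longrightarrow> cleared n k C\<^sup>T"
  unfolding cleared_def by auto

text \<open>
  Row \<open>k\<close> is recorded as unchanged so that, applied to the transposed matrix, the lemma does not undo
  what it achieved for the columns.
\<close>
lemma clear_column:
  assumes "C \<in> carrier_mat n n" "cleared n k C" "k < n" "C $$ (k,k) = 1" "m \<le> n"
  shows "\<exists>C'. elementary_equiv n C C' \<and> cleared n k C' \<and> (\<forall>j<n. C' $$ (k,j) = C $$ (k,j)) \<and>
    (\<forall>i<m. i \<noteq> k \<longrightarrow> C' $$ (i,k) = 0)"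
  using assms(5)
proof (induction m)
  case 0
  have "elementary_equiv n C C"
    using elementary_equiv_row[OF assms(1) elementary.one] assms(1) by simp
  then show ?case using assms by auto
next
  case (Suc m)
  then obtain C' where C': "elementary_equiv n C C'" "cleared n k C'" "\<forall>j<n. C' $$ (k,j) = C $$ (k,j)"
    "\<forall>i<m. i \<noteq> k \<longrightarrow> C' $$ (i,k) = 0" by auto
  note c = elementary_equiv_carrier[OF C'(1)]
  show ?case
  proof (cases "m = k")
    case True
    then show ?thesis using C' by (metis less_Suc_eq)
  next
    case False
    let ?a = "- (C' $$ (m,k))"
    let ?D = "addrow_mat n ?a m k * C'"
    have D: "?D $$ (i,j) = (if m = i then ?a * C' $$ (k,j) + C' $$ (i,j) else C' $$ (i,j))"
      if "i < n" "j < n" for i j using addrow_mat_index[OF c assms(3) that] .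
    have "elementary_equiv n C ?D"
      using elementary_equiv_trans[OF C'(1) elementary_equiv_row[OF c elementary_generators(1)]]
        False Suc.prems assms(3) by auto
    moreover have "cleared n k ?D"
      unfolding cleared_def
    proof (intro allI impI)
      fix i j assume ij: "i < n" "j < n" "i < k \<or> j < k"
      have "?a * C' $$ (k,j) = 0" if "m = i"
      proof (cases "j < k")
        case True
        then have "C' $$ (k,j) = 0" using C'(2) assms(3) ij unfolding cleared_def by auto
        then show ?thesis by simp
      next
        case False
        then have "C' $$ (m,k) = 0" using C'(2) assms(3) ij that unfolding cleared_def by auto
        then show ?thesis by simp
      qed
      then show "?D $$ (i,j) = (if i = j then 1 else 0)"
        using D[OF ij(1,2)] C'(2) ij unfolding cleared_def by auto
    qed
    moreover have "\<forall>j<n. ?D $$ (k,j) = C $$ (k,j)" using D C'(3) False assms(3) by auto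
    moreover have "\<forall>i<Suc m. i \<noteq> k \<longrightarrow> ?D $$ (i,k) = 0"
    proof (intro allI impI)
      fix i assume i: "i < Suc m" "i \<noteq> k"
      have "C' $$ (k,k) = 1" using C'(3) assms(3,4) by auto
      then show "?D $$ (i,k) = 0"
        using D[of i k] C'(4) i Suc.prems assms(3) by (cases "i = m") auto
    qed
    ultimately show ?thesis by blast
  qed
qed

lemma move_to_pivot_row:
  assumes C: "C \<in> carrier_mat n n" "cleared n k C" and ij: "k \<le> i" "i < n" "k \<le> j" "j < n" "C $$ (i,j) \<noteq> 0"
  shows "\<exists>C'. elementary_equiv n C C' \<and> cleared n k C' \<and> C' $$ (k,j) \<noteq> 0"
proof (cases "C $$ (k,j) = 0")
  case False
  moreover have "elementary_equiv n C C"
    using elementary_equiv_row[OF assms(1) elementary.one] assms(1) by simp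
  ultimately show ?thesis using C by blast
next
  case True
  then have "i \<noteq> k" using ij by auto
  let ?D = "addrow_mat n 1 k i * C"
  have D: "?D $$ (x,y) = (if k = x then 1 * C $$ (i,y) + C $$ (x,y) else C $$ (x,y))"
    if "x < n" "y < n" for x y using addrow_mat_index[OF C(1) ij(2) that] .
  have "elementary_equiv n C ?D"
    using \<open>i \<noteq> k\<close> ij by (intro elementary_equiv_row elementary_generators C) auto
  moreover have "cleared n k ?D"
    using C(2) ij D unfolding cleared_def by auto
  moreover have "?D $$ (k,j) \<noteq> 0" using D[of k j] True ij by auto
  ultimately show ?thesis by blast
qed

lemma clear_pivot:
  assumes C: "C \<in> carrier_mat n n" "cleared n k C" and ij: "k \<le> i" "i < n" "k \<le> j" "j < n" "C $$ (i,j) \<noteq> 0"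
  shows "\<exists>C'. elementary_equiv n C C' \<and> cleared n (Suc k) C'"
proof -
  have k: "k < n" using ij by auto
  obtain C1 where C1: "elementary_equiv n C C1" "cleared n k C1" "C1 $$ (k,j) \<noteq> 0"
    using move_to_pivot_row[OF assms] by blast
  note c1 = elementary_equiv_carrier[OF C1(1)]
  \<comment> \<open>A nonzero entry is now in row \<open>k\<close>; the same move on the transposed matrix brings it to the diagonal.\<close>
  have "cleared n k C1\<^sup>T" "C1\<^sup>T $$ (j,k) \<noteq> 0" using c1 C1 k ij cleared_transpose by auto
  then obtain C2 where C2: "elementary_equiv n C1\<^sup>T C2" "cleared n k C2" "C2 $$ (k,k) \<noteq> 0"
    using move_to_pivot_row[of "C1\<^sup>T" n k j k] c1 k ij by auto
  note c2 = elementary_equiv_carrier[OF C2(1)]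
  let ?a = "inverse (C2 $$ (k,k))"
  let ?C3 = "multrow_mat n k ?a * C2"
  have e3: "elementary_equiv n C2 ?C3" 
    using C2 k by (intro elementary_equiv_row elementary_generators c2) auto
  have i3: "?C3 $$ (x,y) = (if k = x then ?a * C2 $$ (x,y) else C2 $$ (x,y))" if "x < n" "y < n" for x y
    using multrow_mat_index[OF c2 that] .
  have cl3: "cleared n k ?C3" using C2(2) i3 k unfolding cleared_def by auto
  have one3: "?C3 $$ (k,k) = 1" using i3[of k k] k C2(3) by simp
  have "\<exists>C4. elementary_equiv n ?C3 C4 \<and> cleared n k C4 \<and> (\<forall>j<n. C4 $$ (k,j) = ?C3 $$ (k,j)) \<and>
      (\<forall>i<n. i \<noteq> k \<longrightarrow> C4 $$ (i,k) = 0)"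
    by (rule clear_column[OF mult_carrier_mat[OF multrow_mat_carrier c2] cl3 k one3 order.refl])
  then obtain C4 where C4: "elementary_equiv n ?C3 C4" "cleared n k C4"
    "\<forall>j<n. C4 $$ (k,j) = ?C3 $$ (k,j)" "\<forall>i<n. i \<noteq> k \<longrightarrow> C4 $$ (i,k) = 0"
    by (elim exE conjE)
  have C4kk: "C4 $$ (k,k) = 1" using C4(3) k one3 by simp
  note c4 = elementary_equiv_carrier[OF C4(1)]
  have "cleared n k C4\<^sup>T" "C4\<^sup>T $$ (k,k) = 1" using c4 C4(2) C4kk k cleared_transpose by auto
  then obtain C5 where C5: "elementary_equiv n C4\<^sup>T C5" "cleared n k C5"
    "\<forall>j<n. C5 $$ (k,j) = C4\<^sup>T $$ (k,j)" "\<forall>i<n. i \<noteq> k \<longrightarrow> C5 $$ (i,k) = 0"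
    using clear_column[of "C4\<^sup>T" n k n] c4 k by auto
  have "cleared n (Suc k) C5"
    unfolding cleared_def
  proof (intro allI impI)
    fix i j assume *: "i < n" "j < n" "i < Suc k \<or> j < Suc k"
    consider "i < k \<or> j < k" | "i = k" | "i \<noteq> k" "j = k" using *(3) by linarith
    then show "C5 $$ (i,j) = (if i = j then 1 else 0)"
    proof cases
      case 1 then show ?thesis using C5(2) * unfolding cleared_def by auto
    next
      case 2 then show ?thesis using C5(3) C4(4) C4kk c4 * by auto
    next
      case 3 then show ?thesis using C5(4) * by auto
    qed
  qed
  moreover have "elementary_equiv n C C5"
  proof -
    have "elementary_equiv n C1\<^sup>T C4"
      using elementary_equiv_trans[OF elementary_equiv_trans[OF C2(1) e3] C4(1)] .
    from elementary_equiv_transpose[OF this] have "elementary_equiv n C1 C4\<^sup>T" by simp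
    then show ?thesis using elementary_equiv_trans[OF elementary_equiv_trans[OF C1(1)] C5(1)] by blast
  qed
  ultimately show ?thesis by blast
qed

lemma equiv_rank_idem_if_cleared:
  "C \<in> carrier_mat n n \<Longrightarrow> cleared n k C \<Longrightarrow> k \<le> n \<Longrightarrow> \<exists>r\<le>n. elementary_equiv n C (rank_idem n r)"
proof (induction "n - k" arbitrary: k C rule: less_induct)
  case less
  show ?case
  proof (cases "\<exists>i j. k \<le> i \<and> i < n \<and> k \<le> j \<and> j < n \<and> C $$ (i,j) \<noteq> 0")
    case True
    then obtain i j where ij: "k \<le> i" "i < n" "k \<le> j" "j < n" "C $$ (i,j) \<noteq> 0" by blast
    then have "n - Suc k < n - k" "Suc k \<le> n" by auto
    obtain C' where C': "elementary_equiv n C C'" "cleared n (Suc k) C'"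
      using clear_pivot[OF less.prems(1,2) ij] by blast
    have "\<exists>r\<le>n. elementary_equiv n C' (rank_idem n r)"
      by (rule less.hyps[OF \<open>n - Suc k < n - k\<close> elementary_equiv_carrier[OF C'(1)] C'(2) \<open>Suc k \<le> n\<close>])
    then obtain r where r: "r \<le> n" "elementary_equiv n C' (rank_idem n r)" by (elim exE conjE)
    show ?thesis by (intro exI[of _ r] conjI r(1) elementary_equiv_trans[OF C'(1) r(2)])
  next
    case False
    have "C $$ (i,j) = rank_idem n k $$ (i,j)" if "i < n" "j < n" for i j
      using False that less.prems(2) by (cases "i < k \<or> j < k") (auto simp: cleared_def)
    then have "C = rank_idem n k" using less.prems(1) by (intro eq_matI) auto
    moreover have "elementary_equiv n C C"
      using elementary_equiv_row[OF less.prems(1) elementary.one] less.prems(1) by simp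
    ultimately have "elementary_equiv n C (rank_idem n k)" by simp
    then show ?thesis by (intro exI[of _ k] conjI less.prems(3))
  qed
qed

lemma rank_normal_form:
  assumes C: "C \<in> carrier_mat n n"
  obtains X Y r where "X \<in> elementary n" "Y \<in> elementary n" "r \<le> n" "C = X * rank_idem n r * Y"
proof -
  have "cleared n 0 C" by (simp add: cleared_def)
  then obtain r where r: "r \<le> n" and "elementary_equiv n C (rank_idem n r)"
    using equiv_rank_idem_if_cleared[OF C _ le0] by metis
  then obtain X Y where XY: "X \<in> elementary n" "Y \<in> elementary n" "rank_idem n r = X * C * Y"
    by (auto simp only: elementary_equiv_def)
  obtain X' where X': "X' \<in> elementary n" "X' * X = 1\<^sub>m n" using elementary_inverse[OF XY(1)] by blast
  obtain Z where Z: "Z \<in> elementary n" "Z * Y\<^sup>T = 1\<^sub>m n"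
    using elementary_inverse[OF elementary_transpose[OF XY(2)]] by blast
  note c = elementary_carrier[OF XY(1)] elementary_carrier[OF XY(2)] elementary_carrier[OF X'(1)] elementary_carrier[OF Z(1)]
  have "Y * Z\<^sup>T = (Z * Y\<^sup>T)\<^sup>T" using c by (simp add: transpose_mult[of _ n n _ n])
  then have YZ: "Y * Z\<^sup>T = 1\<^sub>m n" using Z by simp
  have "X' * rank_idem n r * Z\<^sup>T = (X' * X) * C * (Y * Z\<^sup>T)"
    using c C XY(3) by (simp add: assoc_mult_mat[of _ n n _ n _ n])
  then have "C = X' * rank_idem n r * Z\<^sup>T" using X' YZ C by simp
  with X'(1) elementary_transpose[OF Z(1)] r show ?thesis by (rule that)
qed

lemma det_elementary:
  assumes X: "X \<in> elementary n" shows "det X \<noteq> 0"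
proof -
  obtain Y where Y: "Y \<in> elementary n" "Y * X = 1\<^sub>m n" using elementary_inverse[OF X] ..
  then have "det Y * det X = 1"
    using det_mult[OF elementary_carrier[OF Y(1)] elementary_carrier[OF X]] by simp
  then show ?thesis by auto
qed

lemma elementary_iff: "X \<in> elementary n \<longleftrightarrow> X \<in> carrier_mat n n \<and> det X \<noteq> 0"
proof
  assume X: "X \<in> carrier_mat n n \<and> det X \<noteq> 0"
  then have "X \<in> carrier_mat n n" ..
  then obtain Y Z r where Y: "Y \<in> elementary n" "Z \<in> elementary n" "r \<le> n" "X = Y * rank_idem n r * Z"
    by (rule rank_normal_form)
  note c = elementary_carrier[OF Y(1)] elementary_carrier[OF Y(2)]
  have "det X = det Y * det (rank_idem n r) * det Z"
    unfolding Y(4) using c by (simp add: det_mult[of _ n])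
  then have "\<not> r < n" using X det_rank_idem by fastforce
  then have "r = n" using Y(3) by simp
  then have "X = Y * Z" using Y(4) c by simp
  then show "X \<in> elementary n" using elementary_mult[OF Y(1,2)] by simp
qed (use elementary_carrier det_elementary in auto)

lemma inverse_mat:
  fixes X :: "'a::field mat"
  assumes "X \<in> carrier_mat n n" "det X \<noteq> 0"
  obtains X' where "X' \<in> carrier_mat n n" "X' * X = 1\<^sub>m n" "X * X' = 1\<^sub>m n" "det X' = 1 / det X"
proof -
  obtain X' where X': "X' \<in> carrier_mat n n" "X' * X = 1\<^sub>m n" "X * X' = 1\<^sub>m n"
    using det_non_zero_imp_unit[OF assms] by (auto simp: Units_def ring_mat_def)
  have "det X' * det X = 1" using det_mult[OF X'(1) assms(1)] X'(2) by simp
  then show ?thesis using that X' assms(2) by (simp add: field_simps)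
qed

text \<open>
  Conjugation by \<open>diag(1, ..., 2, ..., 1)\<close> turns a transvection \<open>T\<close> into \<open>T\<^sup>2\<close>, so \<open>\<phi> T = (\<phi> T)\<^sup>2\<close>. Diagonal
  generators with the same entry in different places are conjugate under row swaps.
\<close>
lemma multiplicative_eq_det:
  fixes \<phi> :: "'a::field mat \<Rightarrow> 'b::field"
  assumes two: "(2::'a) \<noteq> 0" and n: "0 < n"
    and mult: "\<And>X Y. \<lbrakk>X \<in> carrier_mat n n; Y \<in> carrier_mat n n; det X \<noteq> 0; det Y \<noteq> 0\<rbrakk> \<Longrightarrow> \<phi> (X * Y) = \<phi> X * \<phi> Y"
    and nz: "\<And>X. \<lbrakk>X \<in> carrier_mat n n; det X \<noteq> 0\<rbrakk> \<Longrightarrow> \<phi> X \<noteq> 0"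
    and X: "X \<in> carrier_mat n n" "det X \<noteq> 0"
  shows "\<phi> X = \<phi> (multrow_mat n 0 (det X))"
proof -
  have one: "\<phi> (1\<^sub>m n) = 1"
    using mult[of "1\<^sub>m n" "1\<^sub>m n"] nz[of "1\<^sub>m n"] by simp
  have m1: "multrow_mat n 0 1 = (1\<^sub>m n :: 'a mat)" by (rule eq_matI) auto
  have add: "\<phi> (addrow_mat n a k l) = 1" if kl: "k < n" "l < n" "k \<noteq> l" for a k l
  proof -
    let ?T = "addrow_mat n a k l" and ?M = "multrow_mat n k (2::'a)"
    have d: "det ?T \<noteq> 0" "det ?M \<noteq> 0" using kl two by (auto simp: det_addrow_mat det_multrow_mat)
    have TT: "?T * ?T = addrow_mat n (2 * a) k l"
      by (rule eq_matI) (use kl in \<open>auto simp: addrow_mat_index[of _ n n] simp del: index_mult_mat(1)\<close>)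
    have "?M * ?T = addrow_mat n (2 * a) k l * ?M"
      by (rule eq_matI) (use kl in \<open>auto simp: addrow_mat_index[of _ n n] multrow_mat_index[of _ n n] simp del: index_mult_mat(1)\<close>)
    then have "\<phi> (?M * ?T) = \<phi> (?T * ?T * ?M)" by (simp add: TT)
    moreover have "det (?T * ?T) \<noteq> 0" using d by (simp add: det_mult[of _ n])
    ultimately have "\<phi> ?M * \<phi> ?T = \<phi> ?T * \<phi> ?T * \<phi> ?M" using d by (simp add: mult)
    then show ?thesis using nz[of ?M] nz[of ?T] d by simp
  qed
  have mrow: "\<phi> (multrow_mat n k a) = \<phi> (multrow_mat n 0 a)" if k: "k < n" and a: "a \<noteq> 0" for k a
  proof (cases "k = 0")
    case False
    let ?S = "swaprows_mat n 0 k :: 'a mat"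
    have "?S * multrow_mat n 0 a = swaprows 0 k (multrow_mat n 0 a)"
      using k n by (intro swaprows_mat[symmetric, of _ n n]) auto
    also have "\<dots> = multrow k a ?S" by (rule eq_matI) (use k n False in auto)
    also have "\<dots> = multrow_mat n k a * ?S" by (rule multrow_mat) auto
    finally have "\<phi> (?S * multrow_mat n 0 a) = \<phi> (multrow_mat n k a * ?S)" by simp
    moreover have dS: "det ?S \<noteq> 0" using k n False by (simp add: det_swaprows_mat)
    ultimately have "\<phi> ?S * \<phi> (multrow_mat n 0 a) = \<phi> (multrow_mat n k a) * \<phi> ?S"
      using k n a by (simp add: mult det_multrow_mat)
    then show ?thesis using nz[of ?S] dS by simp
  qed simp
  have "X \<in> elementary n" using X by (simp add: elementary_iff)
  then show ?thesis
  proof (induction rule: elementary.induct)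
    case one
    then show ?case by (simp add: m1)
  next
    case (addrow X k l a)
    note c = elementary_carrier[OF addrow(1)] det_elementary[OF addrow(1)]
    have d: "det (addrow_mat n a k l) = 1" using addrow by (simp add: det_addrow_mat)
    have "det (addrow_mat n a k l * X) = det X" using c d by (simp add: det_mult[of _ n])
    moreover have "\<phi> (addrow_mat n a k l * X) = \<phi> X" using c d addrow by (simp add: mult add)
    ultimately show ?case using addrow by simp
  next
    case (multrow X k a)
    note c = elementary_carrier[OF multrow(1)] det_elementary[OF multrow(1)]
    have d: "det (multrow_mat n k a) = a" using multrow by (simp add: det_multrow_mat)
    have "det (multrow_mat n k a * X) = a * det X" using c d by (simp add: det_mult[of _ n])
    moreover have "\<phi> (multrow_mat n k a * X) = \<phi> (multrow_mat n 0 a) * \<phi> X"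
      using c d multrow by (simp add: mult mrow[OF multrow(2,3), symmetric])
    moreover have "multrow_mat n 0 (a * det X) = multrow_mat n 0 a * multrow_mat n 0 (det X)"
      by (rule eq_matI) (auto simp: multrow_mat_index[of _ n n] simp del: index_mult_mat(1))
    moreover have "\<phi> (multrow_mat n 0 a * multrow_mat n 0 (det X)) = \<phi> (multrow_mat n 0 a) * \<phi> (multrow_mat n 0 (det X))"
      using n c multrow by (intro mult) (auto simp: det_multrow_mat)
    ultimately show ?case using multrow by simp
  qed
qed

text \<open>
  Up to invertible factors \<open>a\<close> is an idempotent \<open>e\<close>. With \<open>f = 1 - e\<close>, multiplying \<open>u e + v b = 1\<close> by \<open>f\<close> from the
  left shows that \<open>e + f v b = 1 - f u e\<close>, which is unipotent because \<open>e f = 0\<close>.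
\<close>
lemma stable_range:
  fixes a b u v :: "'a::field mat"
  assumes c: "a \<in> carrier_mat n n" "b \<in> carrier_mat n n" "u \<in> carrier_mat n n" "v \<in> carrier_mat n n"
    and uv: "u * a + v * b = 1\<^sub>m n"
  obtains z where "z \<in> carrier_mat n n" "det (a + z * b) \<noteq> 0"
proof -
  \<comment> \<open>The primed matrices below are \<open>u\<close>, \<open>v\<close>, \<open>b\<close> transported to the case where \<open>a\<close> is the idempotent.\<close>
  obtain X Y r where XY: "X \<in> elementary n" "Y \<in> elementary n" "r \<le> n" "a = X * rank_idem n r * Y"
    by (rule rank_normal_form[OF c(1)])
  note cX = elementary_carrier[OF XY(1)] and cY = elementary_carrier[OF XY(2)]
  obtain Y' where Y': "Y' \<in> carrier_mat n n" "Y' * Y = 1\<^sub>m n" "Y * Y' = 1\<^sub>m n"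
    using inverse_mat[OF cY det_elementary[OF XY(2)]] by blast
  let ?e = "rank_idem n r :: 'a mat"
  define f :: "'a mat" where "f = mat n n (\<lambda>(i,j). if i = j \<and> \<not> i < r then 1 else 0)"
  define u' where "u' = Y * u * X"
  define v' where "v' = Y * v"
  define b' where "b' = b * Y'"
  have ce: "?e \<in> carrier_mat n n" and cf: "f \<in> carrier_mat n n" and cu: "u' \<in> carrier_mat n n"
    and cv: "v' \<in> carrier_mat n n" and cb: "b' \<in> carrier_mat n n"
    using c cX cY Y' by (auto simp: f_def u'_def v'_def b'_def)
  note assoc = assoc_mult_mat[of _ n n _ n _ n]
  note distr = mult_add_distrib_mat[of _ n n _ n _] add_mult_distrib_mat[of _ n n _ _ n]
  have ef: "?e + f = 1\<^sub>m n" by (rule eq_matI) (auto simp: f_def)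
  have ef0: "?e * f = 0\<^sub>m n n"
    by (rule eq_matI) (auto simp: f_def rank_idem_def scalar_prod_def intro!: sum.neutral)
  have "?e * f + f * f = f" using ce cf ef by (metis add_mult_distrib_mat left_mult_one_mat)
  then have ff: "f * f = f" using ef0 cf by simp
  have uv': "u' * ?e + v' * b' = 1\<^sub>m n"
  proof -
    have "u' * ?e + v' * b' = Y * (u * X * ?e * (Y * Y')) + Y * (v * b) * Y'"
      unfolding u'_def v'_def b'_def Y'(3) using c cX cY Y'(1) ce by (simp add: assoc)
    also have "\<dots> = Y * (u * a + v * b) * Y'"
      unfolding XY(4) using c cX cY Y'(1) ce by (simp add: assoc distr)
    finally show ?thesis using uv Y'(3) cY by simp
  qed
  have "f = (u' * ?e + v' * b') * f" using uv' cf by simp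
  also have "\<dots> = u' * (?e * f) + v' * b' * f" using ce cf cu cv cb by (simp add: assoc distr)
  also have "\<dots> = v' * b' * f" unfolding ef0 using cf cu cv cb by simp
  finally have vbf: "v' * b' * f = f" ..
  have "f = f * (u' * ?e + v' * b')" using uv' cf by simp
  also have "\<dots> = f * u' * ?e + f * v' * b'" using ce cf cu cv cb by (simp add: assoc distr)
  finally have fuv: "f * u' * ?e + f * v' * b' = f" ..
  define M where "M = ?e + f * v' * b'"
  have cM: "M \<in> carrier_mat n n" using ce cf cv cb by (auto simp: M_def)
  have "M * f = ?e * f + f * (v' * b' * f)" unfolding M_def using ce cf cv cb by (simp add: assoc distr)
  then have Mf: "M * f = f" unfolding vbf ef0 ff using cf by simp
  have "M * (1\<^sub>m n + f * u' * ?e) = M + (M * f) * u' * ?e"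
    using cM cf cu ce by (simp add: assoc distr)
  also have "\<dots> = M + f * u' * ?e" by (simp only: Mf)
  also have "\<dots> = ?e + (f * u' * ?e + f * v' * b')"
    unfolding M_def using ce cf cu cv cb
    by (subst comm_add_mat[of "f * u' * ?e" n n]) (auto simp: assoc_add_mat[of _ n n])
  also have "\<dots> = 1\<^sub>m n" unfolding fuv ef ..
  finally have "det M * det (1\<^sub>m n + f * u' * ?e) = 1"
    using det_mult[OF cM, of "1\<^sub>m n + f * u' * ?e"] cf cu ce by (metis add_carrier_mat det_one mult_carrier_mat)
  then have dM: "det M \<noteq> 0" by auto
  have "a + (X * f * v') * b = X * M * Y"
  proof -
    have "X * M * Y = X * ?e * Y + X * f * v' * b * (Y' * Y)"
      unfolding M_def b'_def using c cX cY Y'(1) ce cf cv by (simp add: assoc distr)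
    then show ?thesis unfolding Y'(2) XY(4) using c cX cY ce cf cv by (simp add: assoc)
  qed
  then have "det (a + (X * f * v') * b) = det X * det M * det Y"
    using cX cM cY by (simp add: det_mult[of _ n])
  then have "det (a + (X * f * v') * b) \<noteq> 0" using dM det_elementary XY by auto
  moreover have "X * f * v' \<in> carrier_mat n n" using cX cf cv by simp
  ultimately show ?thesis using that by blast
qed

text \<open>
  If \<open>r < s\<close>, the upper left \<open>s\<close> by \<open>s\<close> corner of the equation factors the identity through the singular
  matrix \<open>rank_idem s r\<close>.
\<close>
lemma rank_idem_le_if_factor:
  fixes X Y :: "'a::field mat"
  assumes c: "X \<in> carrier_mat n n" "Y \<in> carrier_mat n n" and r: "r \<le> n" "s \<le> n"
    and e: "X * rank_idem n r * Y = rank_idem n s"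
  shows "s \<le> r"
proof (rule ccontr)
  assume "\<not> s \<le> r"
  then have rs: "r < s" by simp
  let ?X = "mat s s (\<lambda>(i,j). X $$ (i,j))" and ?Y = "mat s s (\<lambda>(i,j). Y $$ (i,j))"
  have XD: "(A * rank_idem m r) $$ (i,j) = (if j < r then A $$ (i,j) else 0)"
    if "A \<in> carrier_mat m m" "i < m" "j < m" for m i j and A :: "'a mat"
  proof -
    have "(A * rank_idem m r) $$ (i,j) = (\<Sum>k = 0..<m. A $$ (i,k) * rank_idem m r $$ (k,j))"
      using that by (simp add: scalar_prod_def)
    also have "\<dots> = (\<Sum>k = 0..<m. if k = j then (if j < r then A $$ (i,j) else 0) else 0)"
      using that by (intro sum.cong) auto
    finally show ?thesis using that by simp
  qed
  have "(?X * rank_idem s r) * ?Y = 1\<^sub>m s"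
  proof (rule eq_matI)
    fix i j assume ij: "i < dim_row (1\<^sub>m s :: 'a mat)" "j < dim_col (1\<^sub>m s :: 'a mat)"
    then have ij: "i < s" "j < s" by auto
    have "((?X * rank_idem s r) * ?Y) $$ (i,j) = (\<Sum>k = 0..<s. (?X * rank_idem s r) $$ (i,k) * ?Y $$ (k,j))"
      using ij by (simp add: scalar_prod_def)
    also have "\<dots> = (\<Sum>k = 0..<s. if k < r then X $$ (i,k) * Y $$ (k,j) else 0)"
      using ij by (intro sum.cong) (auto simp: XD simp del: index_mult_mat(1))
    also have "\<dots> = (\<Sum>k = 0..<n. if k < r then X $$ (i,k) * Y $$ (k,j) else 0)"
      using rs r by (intro sum.mono_neutral_left) auto
    also have "\<dots> = (\<Sum>k = 0..<n. (X * rank_idem n r) $$ (i,k) * Y $$ (k,j))"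
      using ij r by (intro sum.cong) (auto simp: XD[OF c(1)] simp del: index_mult_mat(1))
    also have "\<dots> = (X * rank_idem n r * Y) $$ (i,j)"
      using ij r c by (simp add: scalar_prod_def)
    finally show "((?X * rank_idem s r) * ?Y) $$ (i,j) = 1\<^sub>m s $$ (i,j)" unfolding e using ij r by simp
  qed auto
  then have "det ((?X * rank_idem s r) * ?Y) = 1" by simp
  then have "det ?X * det (rank_idem s r :: 'a mat) * det ?Y = 1" by (simp add: det_mult[of _ s])
  then show False using det_rank_idem[OF rs, where 'a = 'a] by simp
qed

section \<open>Block matrices and the double cosets of the Siegel parabolic\<close>

lemma finite_carrier_mat: "finite (carrier_mat m k :: 'a::finite mat set)"
proof -
  have "A \<in> (\<lambda>f. mat m k f) ` (Pi\<^sub>E ({0..<m} \<times> {0..<k}) (\<lambda>_. UNIV))" if "A \<in> carrier_mat m k" for A :: "'a mat"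
  proof (rule image_eqI)
    show "A = mat m k (restrict (($$) A) ({0..<m} \<times> {0..<k}))"
      using that by (intro eq_matI) auto
  qed auto
  then have "(carrier_mat m k :: 'a mat set) \<subseteq> (\<lambda>f. mat m k f) ` (Pi\<^sub>E ({0..<m} \<times> {0..<k}) (\<lambda>_. UNIV))" by blast
  moreover have "finite (Pi\<^sub>E ({0..<m} \<times> {0..<k}) (\<lambda>_. UNIV :: 'a set))"
    by (intro finite_PiE) auto
  ultimately show ?thesis by (meson finite_imageI finite_subset)
qed

lemma mult_square_blocks:
  assumes "A \<in> carrier_mat n n" "B \<in> carrier_mat n n" "C \<in> carrier_mat n n" "D \<in> carrier_mat n n"
    "A' \<in> carrier_mat n n" "B' \<in> carrier_mat n n" "C' \<in> carrier_mat n n" "D' \<in> carrier_mat n n"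
  shows "four_block_mat A B C D * four_block_mat A' B' C' D' =
    four_block_mat (A * A' + B * C') (A * B' + B * D') (C * A' + D * C') (C * B' + D * D')"
  by (rule mult_four_block_mat[OF assms])

lemma square_blocks_cases:
  assumes "g \<in> carrier_mat (2 * n) (2 * n)"
  obtains A B C D where "A \<in> carrier_mat n n" "B \<in> carrier_mat n n" "C \<in> carrier_mat n n"
    "D \<in> carrier_mat n n" "g = four_block_mat A B C D"
proof -
  obtain A B C D where s: "split_block g n n = (A, B, C, D)" by (metis prod_cases4)
  have d: "dim_row g = n + n" "dim_col g = n + n" using assms by auto
  from split_block[OF s d] show ?thesis by (rule that)
qed

lemma square_blocks_inj:
  assumes c: "A \<in> carrier_mat n n" "B \<in> carrier_mat n n" "C \<in> carrier_mat n n" "D \<in> carrier_mat n n"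
    "A' \<in> carrier_mat n n" "B' \<in> carrier_mat n n" "C' \<in> carrier_mat n n" "D' \<in> carrier_mat n n"
    and e: "four_block_mat A B C D = four_block_mat A' B' C' D'"
  shows "A = A'" "B = B'" "C = C'" "D = D'"
proof -
  have s: "split_block (four_block_mat A B C D) n n = (A, B, C, D)"
    if "A \<in> carrier_mat n n" "B \<in> carrier_mat n n" "C \<in> carrier_mat n n" "D \<in> carrier_mat n n" for A B C D :: "'a mat"
    unfolding split_block_def Let_def using that by (auto intro!: eq_matI)
  show "A = A'" "B = B'" "C = C'" "D = D'"
    using s[OF c(1-4)] s[OF c(5-8)] unfolding e by auto
qed

lemma SL_simps [simp]:
  "g \<in> carrier (SL m) \<longleftrightarrow> g \<in> carrier_mat m m \<and> det g = 1"
  "x \<otimes>\<^bsub>SL m\<^esub> y = x * y" "\<one>\<^bsub>SL m\<^esub> = 1\<^sub>m m"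
  by (auto simp: SL_def)

definition upper_unipotent :: "nat \<Rightarrow> 'a::field mat \<Rightarrow> 'a mat" where
  "upper_unipotent n B = four_block_mat (1\<^sub>m n) B (0\<^sub>m n n) (1\<^sub>m n)"

definition lower_unipotent :: "nat \<Rightarrow> 'a::field mat \<Rightarrow> 'a mat" where
  "lower_unipotent n C = four_block_mat (1\<^sub>m n) (0\<^sub>m n n) C (1\<^sub>m n)"

definition levi :: "nat \<Rightarrow> 'a::field mat \<Rightarrow> 'a mat \<Rightarrow> 'a mat" where
  "levi n A D = four_block_mat A (0\<^sub>m n n) (0\<^sub>m n n) D"

lemma Siegel_parabolicI:
  "\<lbrakk>A \<in> carrier_mat n n; B \<in> carrier_mat n n; D \<in> carrier_mat n n; det A * det D = 1\<rbrakk> \<Longrightarrow>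
    four_block_mat A B (0\<^sub>m n n) D \<in> Siegel_parabolic n"
  unfolding Siegel_parabolic_def using det_mult[of A n D] by auto

lemma Siegel_parabolicE:
  assumes "p \<in> Siegel_parabolic n"
  obtains A B D where "A \<in> carrier_mat n n" "B \<in> carrier_mat n n" "D \<in> carrier_mat n n"
    "det A * det D = 1" "p = four_block_mat A B (0\<^sub>m n n) D"
proof -
  obtain A B D where *: "A \<in> carrier_mat n n" "B \<in> carrier_mat n n" "D \<in> carrier_mat n n"
    "det (A * D) = 1" "p = four_block_mat A B (0\<^sub>m n n) D"
    using assms unfolding Siegel_parabolic_def by auto
  then have "det A * det D = 1" by (simp add: det_mult[of _ n])
  with * show ?thesis using that by metis
qed

lemma levi_mem: "\<lbrakk>A \<in> carrier_mat n n; D \<in> carrier_mat n n; det A * det D = 1\<rbrakk> \<Longrightarrow> levi n A D \<in> Siegel_parabolic n"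
  unfolding levi_def by (rule Siegel_parabolicI) auto

lemma upper_unipotent_mem: "B \<in> carrier_mat n n \<Longrightarrow> upper_unipotent n B \<in> Siegel_parabolic n"
  unfolding upper_unipotent_def by (rule Siegel_parabolicI) auto

lemma lower_unipotent_mem: "C \<in> carrier_mat n n \<Longrightarrow> lower_unipotent n C \<in> carrier (SL (2 * n))"
  unfolding lower_unipotent_def
  by (auto simp: mult_2 det_four_block_mat_upper_right_zero[of _ n _ n])

lemma levi_mult:
  "\<lbrakk>A \<in> carrier_mat n n; D \<in> carrier_mat n n; A' \<in> carrier_mat n n; D' \<in> carrier_mat n n\<rbrakk> \<Longrightarrow>
    levi n A D * levi n A' D' = levi n (A * A') (D * D')"
  unfolding levi_def by (simp add: mult_square_blocks[of _ n])

lemma upper_unipotent_mult: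
  "\<lbrakk>B \<in> carrier_mat n n; B' \<in> carrier_mat n n\<rbrakk> \<Longrightarrow>
    upper_unipotent n B * upper_unipotent n B' = upper_unipotent n (B' + B)"
  unfolding upper_unipotent_def by (simp add: mult_square_blocks[of _ n])

text \<open>
  In \<open>P u(C) P\<close> the block \<open>C\<close> may be multiplied from both sides independently. With \<open>X'\<close> and \<open>Y'\<close> inverse to
  \<open>X\<close> and \<open>Y\<close>, both outer factors lie in \<open>SL\<^sub>2\<^sub>n\<close> exactly when \<open>det X = det Y\<close>.
\<close>
lemma levi_lower_unipotent_levi:
  assumes "X \<in> carrier_mat n n" "X' \<in> carrier_mat n n" "X * X' = 1\<^sub>m n"
    "Y \<in> carrier_mat n n" "Y' \<in> carrier_mat n n" "Y' * Y = 1\<^sub>m n" "C \<in> carrier_mat n n"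
  shows "levi n Y' X * lower_unipotent n C * levi n Y X' = lower_unipotent n (X * C * Y)"
  unfolding levi_def lower_unipotent_def using assms by (simp add: mult_square_blocks[of _ n])

text \<open>
  For \<open>e = 1\<close> this is an identity in \<open>SL\<^sub>2\<close> that compares \<open>[1 0; s 1]\<close> with \<open>[1 0; 1 1]\<close>: both are products of
  upper triangular matrices and the Weyl element. In general \<open>z = s\<^sup>-\<^sup>1 - 1\<close>, and \<open>e\<close> acts as the identity on
  what \<open>z\<close> moves; for an idempotent \<open>e\<close> the identity is applied on the image of \<open>e\<close> only.
\<close>
lemma lower_unipotent_shift:
  assumes c: "s \<in> carrier_mat n n" "z \<in> carrier_mat n n" "e \<in> carrier_mat n n"
    and ze: "z * e = z" "e * z = z" and s: "s * (1\<^sub>m n + z) = 1\<^sub>m n"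
  shows "four_block_mat (1\<^sub>m n + z) (- z) (0\<^sub>m n n) s * lower_unipotent n e * upper_unipotent n z =
    lower_unipotent n (s * e)"
proof -
  have "s * e * z + s = s * (z + 1\<^sub>m n)"
    using c ze by (simp add: mult_add_distrib_mat[of _ n n] assoc_mult_mat[of _ n n _ n _ n])
  also have "z + 1\<^sub>m n = 1\<^sub>m n + z" using c by (simp add: comm_add_mat[of _ n n])
  finally have "s * e * z + s = 1\<^sub>m n" using s by simp
  then have 1: "s * (e * z) + s = 1\<^sub>m n" using c by (simp add: assoc_mult_mat[of _ n n _ n _ n])
  have 2: "1\<^sub>m n + z + - z = 1\<^sub>m n" "z + - z = 0\<^sub>m n n" by (rule eq_matI; use c in simp)+
  have 3: "- z * e = - z" using c ze by simp
  show ?thesis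
    unfolding upper_unipotent_def lower_unipotent_def using c
    by (simp add: mult_square_blocks[of _ n] 1 2 3)
qed

text \<open>
  Stable range makes the upper left block invertible after multiplication by some \<open>[1 z; 0 1]\<close>. A
  matrix whose upper left block \<open>A\<close> is invertible is \<open>[1 0; C A\<^sup>-\<^sup>1 1]\<close> times a block upper triangular one.
\<close>
lemma lower_unipotent_representative:
  fixes g :: "'a::field mat"
  assumes g: "g \<in> carrier (SL (2 * n))"
  obtains p c p' where "p \<in> Siegel_parabolic n" "p' \<in> Siegel_parabolic n" "c \<in> carrier_mat n n"
    "g = p * lower_unipotent n c * p'"
proof -
  have g': "g \<in> carrier_mat (2 * n) (2 * n)" "det g = 1" using g by auto
  obtain A B C D where c: "A \<in> carrier_mat n n" "B \<in> carrier_mat n n" "C \<in> carrier_mat n n"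
    "D \<in> carrier_mat n n" and gb: "g = four_block_mat A B C D" using g'(1) by (rule square_blocks_cases)
  obtain h where h: "h \<in> carrier_mat (2 * n) (2 * n)" "h * g = 1\<^sub>m (2 * n)"
    using inverse_mat[OF g'(1)] g'(2) by auto
  obtain U V W X where d: "U \<in> carrier_mat n n" "V \<in> carrier_mat n n" "W \<in> carrier_mat n n"
    "X \<in> carrier_mat n n" and hb: "h = four_block_mat U V W X" using h(1) by (rule square_blocks_cases)
  have "four_block_mat (U * A + V * C) (U * B + V * D) (W * A + X * C) (W * B + X * D) =
      four_block_mat (1\<^sub>m n) (0\<^sub>m n n) (0\<^sub>m n n) (1\<^sub>m n)"
    using h(2) c d unfolding hb gb by (simp add: mult_square_blocks[of _ n] mult_2)
  from square_blocks_inj(1)[where n = n, OF _ _ _ _ _ _ _ _ this] have "U * A + V * C = 1\<^sub>m n" using c d by simp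
  then obtain z where z: "z \<in> carrier_mat n n" "det (A + z * C) \<noteq> 0"
    by (rule stable_range[OF c(1,3) d(1,2)])
  define A1 where "A1 = A + z * C"
  define B1 where "B1 = B + z * D"
  have c1: "A1 \<in> carrier_mat n n" "B1 \<in> carrier_mat n n" using c z by (auto simp: A1_def B1_def)
  obtain A' where A': "A' \<in> carrier_mat n n" "A' * A1 = 1\<^sub>m n"
    using inverse_mat[OF c1(1)] z(2) unfolding A1_def by auto
  define k where "k = C * A'"
  have k: "k \<in> carrier_mat n n" using c A' by (simp add: k_def)
  define q where "q = four_block_mat A1 B1 (0\<^sub>m n n) (D - k * B1)"
  have zz: "- z + z = 0\<^sub>m n n" by (rule eq_matI) (use z in auto)
  have kA: "k * A1 = C" unfolding k_def using c c1 A' by (simp add: assoc_mult_mat[of _ n n _ n _ n])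
  have kB: "k * B1 + (D - k * B1) = D" by (rule eq_matI) (use c c1 k in auto)
  have Dk: "D - k * B1 \<in> carrier_mat n n" using k c1 by (metis c(4) minus_carrier_mat mult_carrier_square)
  have lq: "lower_unipotent n k * q = four_block_mat A1 B1 C D"
    unfolding q_def lower_unipotent_def using c c1 k Dk by (simp add: mult_square_blocks[of _ n] kA kB)
  have ug: "upper_unipotent n z * g = four_block_mat A1 B1 C D"
    unfolding gb upper_unipotent_def A1_def B1_def using c z by (simp add: mult_square_blocks[of _ n])
  have "upper_unipotent n (- z) * (upper_unipotent n z * g) = (upper_unipotent n (- z) * upper_unipotent n z) * g"
    using z g' c Siegel_parabolic_subset[of n] upper_unipotent_mem[of z n] upper_unipotent_mem[of "- z" n]
    by (intro assoc_mult_mat[symmetric, of _ "2*n" "2*n" _ "2*n" _ "2*n"]) auto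
  also have "upper_unipotent n (- z) * upper_unipotent n z = upper_unipotent n (0\<^sub>m n n)"
    using z by (simp add: upper_unipotent_mult) (simp add: comm_add_mat[of z n n] zz)
  also have "upper_unipotent n (0\<^sub>m n n) = 1\<^sub>m (2 * n)" by (simp add: upper_unipotent_def mult_2)
  finally have g1: "g = upper_unipotent n (- z) * (lower_unipotent n k * q)"
    using g'(1) unfolding lq ug by simp
  have q: "q \<in> carrier_mat (2 * n) (2 * n)" unfolding q_def using c1 Dk by (simp add: mult_2)
  have u: "upper_unipotent n (- z) \<in> carrier (SL (2 * n))"
    using upper_unipotent_mem[of "- z" n] z Siegel_parabolic_subset[of n] by auto
  note l = lower_unipotent_mem[OF k]
  have "det g = det q" unfolding g1 using u l q by (simp add: det_mult[of _ "2 * n"])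
  moreover have "det q = det A1 * det (D - k * B1)"
    unfolding q_def by (rule det_four_block_mat_lower_left_zero[OF c1 refl Dk])
  ultimately have "q \<in> Siegel_parabolic n"
    unfolding q_def using g'(2) c1 Dk by (intro Siegel_parabolicI) auto
  moreover have "g = upper_unipotent n (- z) * lower_unipotent n k * q"
    using g1 u l q by (simp add: assoc_mult_mat[of _ "2 * n" "2 * n" _ "2 * n" _ "2 * n"])
  moreover have "upper_unipotent n (- z) \<in> Siegel_parabolic n" using z by (intro upper_unipotent_mem) auto
  ultimately show ?thesis using that k by metis
qed

text \<open>
  Plain transposition exchanges \<open>P\<close> with the opposite parabolic; conjugation by the block swap brings it
  back to \<open>P\<close>.
\<close>
definition block_transpose :: "nat \<Rightarrow> 'a::field mat \<Rightarrow> 'a mat" where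
  "block_transpose n g =
     (let W = four_block_mat (0\<^sub>m n n) (1\<^sub>m n) (1\<^sub>m n) (0\<^sub>m n n) in W * g\<^sup>T * W)"

lemma block_transpose_blocks:
  assumes "A \<in> carrier_mat n n" "B \<in> carrier_mat n n" "C \<in> carrier_mat n n" "D \<in> carrier_mat n n"
  shows "block_transpose n (four_block_mat A B C D) = four_block_mat D\<^sup>T B\<^sup>T C\<^sup>T A\<^sup>T"
  using assms unfolding block_transpose_def Let_def transpose_four_block_mat[OF assms]
  by (simp add: mult_square_blocks[of _ n])

lemma block_transpose_anti:
  fixes g h :: "'a::field mat"
  assumes "g \<in> carrier_mat (2 * n) (2 * n)" "h \<in> carrier_mat (2 * n) (2 * n)"
  shows "block_transpose n (g * h) = block_transpose n h * block_transpose n g"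
    and "det (block_transpose n g) = det g"
    and "block_transpose n (block_transpose n g) = g"
    and "block_transpose n g \<in> carrier_mat (2 * n) (2 * n)"
proof -
  define W :: "'a mat" where "W = four_block_mat (0\<^sub>m n n) (1\<^sub>m n) (1\<^sub>m n) (0\<^sub>m n n)"
  have W: "W \<in> carrier_mat (2 * n) (2 * n)" by (simp add: W_def mult_2)
  have WW: "W * W = 1\<^sub>m (2 * n)" unfolding W_def by (simp add: mult_square_blocks[of _ n] mult_2)
  have b: "block_transpose n x = W * x\<^sup>T * W" for x by (simp add: block_transpose_def W_def Let_def)
  note assoc = assoc_mult_mat[of _ "2 * n" "2 * n" _ "2 * n" _ "2 * n"]
  have "block_transpose n h * block_transpose n g = W * h\<^sup>T * (W * W) * g\<^sup>T * W"
    unfolding b using W assms by (simp add: assoc)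
  also have "\<dots> = W * (h\<^sup>T * g\<^sup>T) * W" unfolding WW using W assms by (simp add: assoc)
  finally show "block_transpose n (g * h) = block_transpose n h * block_transpose n g"
    unfolding b using assms by (simp add: transpose_mult[of _ "2 * n" "2 * n" _ "2 * n"])
  have "det W * det W = 1" using det_mult[OF W W] WW by simp
  then show "det (block_transpose n g) = det g"
    unfolding b using W assms by (simp add: det_mult[of _ "2 * n"] det_transpose[of _ "2 * n"])
  show "block_transpose n g \<in> carrier_mat (2 * n) (2 * n)" unfolding b using W assms by simp
  obtain A B C D where "A \<in> carrier_mat n n" "B \<in> carrier_mat n n" "C \<in> carrier_mat n n"
    "D \<in> carrier_mat n n" and "g = four_block_mat A B C D" using assms(1) by (rule square_blocks_cases)
  then show "block_transpose n (block_transpose n g) = g" by (simp add: block_transpose_blocks)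
qed

section \<open>Hecke kernels for the Siegel parabolic\<close>

locale siegel_character =
  fixes n :: nat and \<omega> :: "'a::{field,finite} mat \<Rightarrow> complex"
  assumes n: "0 < n" and two: "(2::'a) \<noteq> 0" and three: "(3::'a) \<noteq> 0"
    and character: "group_character (SL (2 * n)) (Siegel_parabolic n) \<omega>"
begin

abbreviation "P \<equiv> Siegel_parabolic n :: 'a mat set"

sublocale induced_rep "SL (2 * n) :: 'a mat monoid" P \<omega>
proof (intro induced_rep.intro induced_rep_axioms.intro group_SL subgroup_Siegel_parabolic character)
  show "finite (carrier (SL (2 * n) :: 'a mat monoid))"
    by (rule finite_subset[OF _ finite_carrier_mat[of "2 * n" "2 * n"]]) auto
qed

lemma character_mult: "p \<in> P \<Longrightarrow> r \<in> P \<Longrightarrow> \<omega> (p * r) = \<omega> p * \<omega> r"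
  using char_mult by simp

text \<open>
  Conjugation by \<open>diag(2, 1/2)\<close> multiplies the block by \<open>4\<close>, so \<open>\<omega>\<close> agrees on the blocks \<open>B'\<close> and \<open>4 B'\<close> and
  is trivial on \<open>3 B'\<close>; take \<open>B' = B / 3\<close>.
\<close>
lemma character_upper_unipotent:
  assumes B: "B \<in> carrier_mat n n" shows "\<omega> (upper_unipotent n B) = 1"
proof -
  define B' where "B' = (1 / 3) \<cdot>\<^sub>m B"
  have B': "B' \<in> carrier_mat n n" using B by (simp add: B'_def)
  let ?m = "levi n (2 \<cdot>\<^sub>m 1\<^sub>m n) ((1 / 2) \<cdot>\<^sub>m 1\<^sub>m n)"
  have m: "?m \<in> P"
    by (rule levi_mem) (use two in \<open>auto simp: power_one_over\<close>)
  have four: "4 \<cdot>\<^sub>m B' = B + B'"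
    by (rule eq_matI) (use B three in \<open>auto simp: B'_def field_simps\<close>)
  have "?m * upper_unipotent n B' = upper_unipotent n (4 \<cdot>\<^sub>m B') * ?m"
  proof -
    have "2 \<cdot>\<^sub>m 1\<^sub>m n * B' = (4 \<cdot>\<^sub>m B') * ((1 / 2) \<cdot>\<^sub>m 1\<^sub>m n)"
      using B' two by (simp add: mult_smult_assoc_mat[of _ n n _ n] mult_smult_distrib[of _ n n _ n])
        (rule eq_matI; simp)
    then show ?thesis
      unfolding levi_def upper_unipotent_def using B' by (simp add: mult_square_blocks[of _ n])
  qed
  moreover have "upper_unipotent n B' * upper_unipotent n B = upper_unipotent n (4 \<cdot>\<^sub>m B')"
    unfolding four by (rule upper_unipotent_mult[OF B' B])
  ultimately have "\<omega> (?m * upper_unipotent n B') = \<omega> (upper_unipotent n B' * upper_unipotent n B * ?m)" by simp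
  moreover have "upper_unipotent n B' * upper_unipotent n B \<in> P"
    using P_closed(1)[OF upper_unipotent_mem[OF B'] upper_unipotent_mem[OF B]] by simp
  ultimately have "\<omega> ?m * \<omega> (upper_unipotent n B') = \<omega> (upper_unipotent n B') * \<omega> (upper_unipotent n B) * \<omega> ?m"
    using m B B' by (simp add: character_mult upper_unipotent_mem)
  then show ?thesis
    using char_nonzero[OF m] char_nonzero[OF upper_unipotent_mem[OF B']] by simp
qed

text \<open>
  The character of the multiplicative group through which \<open>\<omega>\<close> factors. The value zero at zero keeps it
  multiplicative and makes \<open>\<chi> (det C)\<close> meaningful for singular blocks \<open>C\<close>.
\<close>
definition \<chi> :: "'a \<Rightarrow> complex" where
  "\<chi> t = (if t = 0 then 0 else \<omega> (levi n (multrow_mat n 0 t) (multrow_mat n 0 (1 / t))))"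

lemma multrow_one: "multrow_mat n 0 (1::'a) = 1\<^sub>m n" by (rule eq_matI) auto

lemma multrow_mult: "multrow_mat n 0 s * multrow_mat n 0 t = multrow_mat n 0 (s * t :: 'a)"
  by (rule eq_matI) (auto simp: multrow_mat_index[of _ n n] simp del: index_mult_mat(1))

lemma det_multrow0: "det (multrow_mat n 0 (t::'a)) = t" using n by (rule det_multrow_mat)

lemma \<chi>_one: "\<chi> 1 = 1"
  using char_one by (simp add: \<chi>_def multrow_one) (simp add: levi_def mult_2)

lemma \<chi>_mult: "\<chi> (s * t) = \<chi> s * \<chi> t"
proof (cases "s = 0 \<or> t = 0")
  case False
  then have "\<omega> (levi n (multrow_mat n 0 s) (multrow_mat n 0 (1 / s)) * levi n (multrow_mat n 0 t) (multrow_mat n 0 (1 / t))) = \<chi> s * \<chi> t"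
    by (subst character_mult) (auto simp: \<chi>_def det_multrow0 intro!: levi_mem)
  then show ?thesis using False by (simp add: levi_mult multrow_mult) (simp add: \<chi>_def)
qed (auto simp: \<chi>_def)

lemma \<chi>_inverse: "t \<noteq> 0 \<Longrightarrow> \<chi> (1 / t) * \<chi> t = 1" "t \<noteq> 0 \<Longrightarrow> \<chi> t * \<chi> (1 / t) = 1"
  using \<chi>_mult[of "1 / t" t] \<chi>_mult[of t "1 / t"] \<chi>_one by auto

text \<open>
  Two multiplicative functions on \<open>GL\<^sub>n\<close> arise from \<open>\<omega>\<close> by placing a matrix in one diagonal block and
  correcting the determinant in the other; both depend on the determinant only.
\<close>
lemma character_levi:
  assumes A: "A \<in> carrier_mat n n" and D: "D \<in> carrier_mat n n" and d: "det A * det D = 1"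
  shows "\<omega> (levi n A D) = \<chi> (det A)"
proof -
  have dA: "det A \<noteq> 0" and dD: "det D \<noteq> 0" using d by auto
  let ?\<phi> = "\<lambda>X. \<omega> (levi n X (multrow_mat n 0 (1 / det X)))"
  have m1: "levi n X (multrow_mat n 0 (1 / det X)) \<in> P" if "X \<in> carrier_mat n n" "det X \<noteq> 0" for X
    using that by (intro levi_mem) (auto simp: det_multrow0)
  have "?\<phi> A = ?\<phi> (multrow_mat n 0 (det A))"
  proof (rule multiplicative_eq_det[OF two n, where \<phi> = ?\<phi>])
    fix X Y :: "'a mat"
    assume X: "X \<in> carrier_mat n n" "Y \<in> carrier_mat n n" "det X \<noteq> 0" "det Y \<noteq> 0"
    have "levi n (X * Y) (multrow_mat n 0 (1 / det (X * Y))) =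
        levi n X (multrow_mat n 0 (1 / det X)) * levi n Y (multrow_mat n 0 (1 / det Y))"
      using X by (simp add: levi_mult multrow_mult det_mult[of _ n])
    then show "?\<phi> (X * Y) = ?\<phi> X * ?\<phi> Y" using X by (simp add: character_mult m1)
  qed (use m1 char_nonzero A dA in auto)
  then have 1: "?\<phi> A = \<chi> (det A)" using dA by (simp add: det_multrow0 \<chi>_def)
  let ?\<psi> = "\<lambda>X. \<omega> (levi n (multrow_mat n 0 (1 / det X)) X)"
  have m2: "levi n (multrow_mat n 0 (1 / det X)) X \<in> P" if "X \<in> carrier_mat n n" "det X \<noteq> 0" for X
    using that by (intro levi_mem) (auto simp: det_multrow0)
  define D1 where "D1 = multrow_mat n 0 (det A) * D"
  have D1: "D1 \<in> carrier_mat n n" "det D1 = 1" using D d by (auto simp: D1_def det_mult[of _ n] det_multrow0)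
  have "?\<psi> D1 = ?\<psi> (multrow_mat n 0 (det D1))"
  proof (rule multiplicative_eq_det[OF two n, where \<phi> = ?\<psi>])
    fix X Y :: "'a mat"
    assume X: "X \<in> carrier_mat n n" "Y \<in> carrier_mat n n" "det X \<noteq> 0" "det Y \<noteq> 0"
    have "levi n (multrow_mat n 0 (1 / det (X * Y))) (X * Y) =
        levi n (multrow_mat n 0 (1 / det X)) X * levi n (multrow_mat n 0 (1 / det Y)) Y"
      using X by (simp add: levi_mult multrow_mult det_mult[of _ n])
    then show "?\<psi> (X * Y) = ?\<psi> X * ?\<psi> Y" using X by (simp add: character_mult m2)
  qed (use m2 char_nonzero D1 in auto)
  also have "\<dots> = 1" using char_one D1 by (simp add: multrow_one) (simp add: levi_def mult_2)
  finally have 2: "\<omega> (levi n (1\<^sub>m n) D1) = 1" using D1 by (simp add: multrow_one)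
  have "multrow_mat n 0 (1 / det A) * D1 = D"
    unfolding D1_def using D dA
    by (subst assoc_mult_mat[symmetric, of _ n n _ n _ n]) (auto simp: multrow_mult multrow_one)
  then have "levi n A D = levi n A (multrow_mat n 0 (1 / det A)) * levi n (1\<^sub>m n) D1"
    using A D1 by (simp add: levi_mult)
  then show ?thesis using 1 2 m1[OF A dA] D1 levi_mem[of "1\<^sub>m n" n D1] by (simp add: character_mult)
qed

lemma character_eq:
  assumes A: "A \<in> carrier_mat n n" and B: "B \<in> carrier_mat n n" and D: "D \<in> carrier_mat n n"
    and d: "det A * det D = 1"
  shows "\<omega> (four_block_mat A B (0\<^sub>m n n) D) = \<chi> (det A)"
proof -
  have dD: "det D \<noteq> 0" using d by auto
  obtain D' where D': "D' \<in> carrier_mat n n" "D' * D = 1\<^sub>m n" using inverse_mat[OF D dD] by auto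
  have "B * D' * D = B" using B D D' by (simp add: assoc_mult_mat[of _ n n _ n _ n])
  then have "four_block_mat A B (0\<^sub>m n n) D = upper_unipotent n (B * D') * levi n A D"
    unfolding upper_unipotent_def levi_def using A B D D' by (simp add: mult_square_blocks[of _ n])
  then show ?thesis
    using A B D D' d by (simp add: character_mult levi_mem upper_unipotent_mem character_upper_unipotent character_levi)
qed

text \<open>
  With \<open>k = 1\<close> and \<open>k = 2\<close> this translates the case distinction on \<open>\<omega>\<close> into one on \<open>\<chi>\<close>.
\<close>
lemma trivial_iff: "(\<forall>p\<in>P. \<omega> p ^ k = 1) \<longleftrightarrow> (\<forall>t. t \<noteq> 0 \<longrightarrow> \<chi> t ^ k = 1)"
proof
  assume "\<forall>p\<in>P. \<omega> p ^ k = 1"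
  then show "\<forall>t. t \<noteq> 0 \<longrightarrow> \<chi> t ^ k = 1" by (auto simp: \<chi>_def det_multrow0 intro!: levi_mem)
next
  assume *: "\<forall>t. t \<noteq> 0 \<longrightarrow> \<chi> t ^ k = 1"
  show "\<forall>p\<in>P. \<omega> p ^ k = 1"
  proof
    fix p assume "p \<in> P"
    then show "\<omega> p ^ k = 1"
    proof (rule Siegel_parabolicE)
      fix A B D assume "A \<in> carrier_mat n n" "B \<in> carrier_mat n n" "D \<in> carrier_mat n n"
        "det A * det D = 1" "p = four_block_mat A B (0\<^sub>m n n) D"
      moreover from this have "det A \<noteq> 0" by auto
      ultimately show "\<omega> p ^ k = 1" using * by (simp add: character_eq)
    qed
  qed
qed

abbreviation (input) "low \<equiv> lower_unipotent n :: 'a mat \<Rightarrow> 'a mat"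

lemma hecke_left: "K \<in> hecke \<Longrightarrow> p \<in> P \<Longrightarrow> g \<in> carrier (SL (2 * n)) \<Longrightarrow> K (p * g) = \<omega> p * K g"
  using IndD(1)[OF heckeD(1)] by simp

lemma hecke_right: "K \<in> hecke \<Longrightarrow> p \<in> P \<Longrightarrow> g \<in> carrier (SL (2 * n)) \<Longrightarrow> K (g * p) = \<omega> p * K g"
  using heckeD(2) by simp

lemma hecke_both:
  assumes "K \<in> hecke" "p \<in> P" "r \<in> P" "g \<in> carrier (SL (2 * n))"
  shows "K (p * g * r) = \<omega> p * \<omega> r * K g"
proof -
  have "p * g \<in> carrier (SL (2 * n))" using m_closed[OF P_carrier[OF assms(2)] assms(4)] by simp
  then show ?thesis using assms hecke_right[OF assms(1,3)] hecke_left[OF assms(1,2)] by simp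
qed

lemma hecke_equivalent:
  assumes K: "K \<in> hecke" and X: "X \<in> carrier_mat n n" "Y \<in> carrier_mat n n" "det X = det Y" "det X \<noteq> 0"
    and C: "C \<in> carrier_mat n n"
  shows "K (low (X * C * Y)) = K (low C)"
proof -
  obtain X' where X': "X' \<in> carrier_mat n n" "X * X' = 1\<^sub>m n" "det X' = 1 / det X"
    using inverse_mat[OF X(1,4)] by auto
  obtain Y' where Y': "Y' \<in> carrier_mat n n" "Y' * Y = 1\<^sub>m n" "det Y' = 1 / det Y"
    using inverse_mat[OF X(2)] X(3,4) by auto
  have "K (levi n Y' X * low C * levi n Y X') = \<omega> (levi n Y' X) * \<omega> (levi n Y X') * K (low C)"
    using X X' Y' by (intro hecke_both[OF K] levi_mem lower_unipotent_mem C) auto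
  also have "levi n Y' X * low C * levi n Y X' = low (X * C * Y)"
    by (rule levi_lower_unipotent_levi[OF X(1) X'(1,2) X(2) Y'(1,2) C])
  finally show ?thesis using X X' Y' \<chi>_inverse[of "det Y"] by (simp add: character_levi)
qed

lemma hecke_shift:
  assumes K: "K \<in> hecke" and c: "s \<in> carrier_mat n n" "z \<in> carrier_mat n n" "e \<in> carrier_mat n n"
    and ze: "z * e = z" "e * z = z" and s: "s * (1\<^sub>m n + z) = 1\<^sub>m n"
  shows "K (low (s * e)) = \<chi> (1 / det s) * K (low e)"
proof -
  have c': "1\<^sub>m n + z \<in> carrier_mat n n" using c by simp
  have d: "det s * det (1\<^sub>m n + z) = 1" using det_mult[OF c(1) c'] s by simp
  then have d': "det (1\<^sub>m n + z) * det s = 1" "det (1\<^sub>m n + z) = 1 / det s"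
    by (auto simp: mult.commute eq_divide_eq)
  have p: "four_block_mat (1\<^sub>m n + z) (- z) (0\<^sub>m n n) s \<in> P"
    using c c' d' by (intro Siegel_parabolicI) auto
  have "K (four_block_mat (1\<^sub>m n + z) (- z) (0\<^sub>m n n) s * low e * upper_unipotent n z) =
      \<chi> (det (1\<^sub>m n + z)) * 1 * K (low e)"
    using hecke_both[OF K p upper_unipotent_mem[OF c(2)] lower_unipotent_mem[OF c(3)]]
      character_eq[OF c' _ c(1) d'(1), of "- z"] character_upper_unipotent[OF c(2)] c by simp
  then show ?thesis unfolding lower_unipotent_shift[OF c ze s] d'(2) by simp
qed

text \<open>
  The case \<open>e = 1\<close> of the shift: all \<open>u(s)\<close> with invertible \<open>s\<close> lie in one double coset.
\<close>
lemma hecke_invertible: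
  assumes K: "K \<in> hecke" and s: "s \<in> carrier_mat n n" "det s \<noteq> 0"
  shows "K (low s) = \<chi> (1 / det s) * K (low (1\<^sub>m n))"
proof -
  obtain v where v: "v \<in> carrier_mat n n" "s * v = 1\<^sub>m n" using inverse_mat[OF s] by auto
  define z where "z = v - 1\<^sub>m n"
  have z: "z \<in> carrier_mat n n" "1\<^sub>m n + z = v" unfolding z_def using v by (auto intro!: eq_matI)
  have "K (low (s * 1\<^sub>m n)) = \<chi> (1 / det s) * K (low (1\<^sub>m n))"
    by (rule hecke_shift[OF K s(1) z(1)]) (use z v in auto)
  then show ?thesis using s by simp
qed

text \<open>
  Below full rank the idempotent absorbs a scaling of the last coordinate, which is used to equalise
  the determinants of the two outer factors.
\<close>
lemma singular_normal_form:
  assumes c: "c \<in> carrier_mat n n" "det c = (0::'a)"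
  obtains X Y r where "r < n" "X \<in> carrier_mat n n" "Y \<in> carrier_mat n n" "det X = det Y" "det X \<noteq> 0"
    "c = X * rank_idem n r * Y"
proof -
  obtain X Y r where XY: "X \<in> elementary n" "Y \<in> elementary n" "r \<le> n" "c = X * rank_idem n r * Y"
    using c(1) by (rule rank_normal_form)
  note cX = elementary_carrier[OF XY(1)] and cY = elementary_carrier[OF XY(2)]
  have dX: "det X \<noteq> 0" "det Y \<noteq> 0" using XY det_elementary by auto
  have "r \<noteq> n"
  proof
    assume "r = n"
    then have "det c = det X * det Y" using XY(4) cX cY by (simp add: det_mult[of _ n])
    then show False using c(2) dX by simp
  qed
  then have r: "r < n" using XY(3) by simp
  let ?M = "multrow_mat n (n - 1) (det Y / det X)"
  have M: "?M \<in> carrier_mat n n" by simp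
  have "?M * rank_idem n r = rank_idem n r"
    by (rule eq_matI) (use r in \<open>auto simp: multrow_mat_index[of _ n n] simp del: index_mult_mat(1)\<close>)
  then have "c = (X * ?M) * rank_idem n r * Y"
    using XY(4) cX cY by (simp add: assoc_mult_mat[of _ n n _ n _ n])
  moreover have "det (X * ?M) = det Y" using cX dX n by (simp add: det_mult[of _ n] det_multrow_mat)
  ultimately show ?thesis using that[OF r _ cY _ _ , of "X * ?M"] cX M dX(2) mult_carrier_square[OF cX M] by metis
qed

lemma hecke_eq_zero:
  assumes K: "K \<in> hecke" and 0: "\<And>r. r \<le> n \<Longrightarrow> K (low (rank_idem n r)) = 0"
  shows "K = 0"
proof
  fix g
  show "K g = 0 g"
  proof (cases "g \<in> carrier (SL (2 * n))")
    case False
    then show ?thesis using IndD(2)[OF heckeD(1)[OF K]] by simp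
  next
    case True
    then obtain p c p' where p: "p \<in> P" "p' \<in> P" "c \<in> carrier_mat n n" "g = p * low c * p'"
      by (rule lower_unipotent_representative)
    have "K (low c) = 0"
    proof (cases "det c = 0")
      case False
      then show ?thesis using hecke_invertible[OF K p(3)] 0[of n] by simp
    next
      case True
      then obtain X Y r where *: "r < n" "X \<in> carrier_mat n n" "Y \<in> carrier_mat n n" "det X = det Y" "det X \<noteq> 0"
        "c = X * rank_idem n r * Y" by (rule singular_normal_form[OF p(3)])
      then show ?thesis using hecke_equivalent[OF K *(2-5), of "rank_idem n r"] 0[of r] by simp
    qed
    then show ?thesis using hecke_both[OF K p(1,2) lower_unipotent_mem[OF p(3)]] p(4) by simp
  qed
qed

text \<open>
  For \<open>M = diag(t, 1, ..., 1)\<close> the value at \<open>u(M\<^sup>2)\<close> equals that at \<open>u(1)\<close> by equivalence, and differs from it by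
  the factor \<open>\<chi> (1 / t\<^sup>2)\<close> by the shift.
\<close>
lemma hecke_vanish_full_rank:
  assumes K: "K \<in> hecke" and t: "t \<noteq> 0" "(\<chi> t)\<^sup>2 \<noteq> 1"
  shows "K (low (1\<^sub>m n)) = 0"
proof -
  let ?M = "multrow_mat n 0 t"
  have "K (low (?M * 1\<^sub>m n * ?M)) = K (low (1\<^sub>m n))"
    using t by (intro hecke_equivalent[OF K]) (auto simp: det_multrow0)
  moreover have "K (low (?M * ?M)) = \<chi> (1 / (t * t)) * K (low (1\<^sub>m n))"
    using hecke_invertible[OF K, of "?M * ?M"] t by (simp add: det_mult[of _ n] det_multrow0)
  ultimately have "K (low (1\<^sub>m n)) = \<chi> (1 / (t * t)) * K (low (1\<^sub>m n))" by simp
  moreover have "\<chi> (1 / (t * t)) \<noteq> 1"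
  proof
    assume "\<chi> (1 / (t * t)) = 1"
    then have "\<chi> (t * t) = 1" using \<chi>_inverse(1)[of "t * t"] t by simp
    then show False using t by (simp add: \<chi>_mult power2_eq_square)
  qed
  ultimately show ?thesis by simp
qed

text \<open>
  Scaling the first coordinate of \<open>e\<^sub>r\<close> by \<open>t\<close> costs the factor \<open>\<chi> (1 / t)\<close> by the shift, which requires
  \<open>0 < r\<close>. It costs nothing by equivalence, as the last coordinate can be scaled by \<open>1 / t\<close> to restore the
  determinant, which requires \<open>r < n\<close>.
\<close>
lemma hecke_vanish_middle_rank:
  assumes K: "K \<in> hecke" and r: "0 < r" "r < n" and t: "t \<noteq> 0" "\<chi> t \<noteq> 1"
  shows "K (low (rank_idem n r)) = 0"
proof -
  let ?e = "rank_idem n r :: 'a mat"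
  let ?s = "multrow_mat n 0 t" and ?N = "multrow_mat n (n - 1) (1 / t)"
  define z where "z = mat n n (\<lambda>(i,j). if i = 0 \<and> j = 0 then 1 / t - 1 else 0)"
  have z: "z \<in> carrier_mat n n" by (simp add: z_def)
  have zz: "1\<^sub>m n + z = multrow_mat n 0 (1 / t)" by (rule eq_matI) (auto simp: z_def)
  have zi: "z = multrow_mat n 0 (1 / t) - 1\<^sub>m n" by (rule eq_matI) (auto simp: z_def)
  have "multrow_mat n 0 (1 / t) * ?e = z + ?e"
    by (rule eq_matI) (use r in \<open>auto simp: multrow_mat_index[of _ n n] z_def simp del: index_mult_mat(1)\<close>)
  then have "z * ?e = (z + ?e) - ?e"
    unfolding zi using minus_mult_distrib_mat[of "multrow_mat n 0 (1 / t)" n n "1\<^sub>m n" ?e n] by simp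
  also have "\<dots> = z" by (rule eq_matI) (use z in auto)
  finally have ze: "z * ?e = z" .
  have "?e * z = (z * ?e)\<^sup>T"
  proof -
    have "z\<^sup>T = z" by (rule eq_matI) (auto simp: z_def)
    then show ?thesis using z by (simp add: transpose_mult[of _ n n _ n])
  qed
  also have "\<dots> = z" unfolding ze by (rule eq_matI) (auto simp: z_def)
  finally have ez: "?e * z = z" .
  have "K (low (?s * ?e)) = \<chi> (1 / det ?s) * K (low ?e)"
    by (rule hecke_shift[OF K _ z _ ze ez]) (use t in \<open>auto simp: zz multrow_mult multrow_one\<close>)
  moreover have "K (low ((?s * ?N) * ?e * 1\<^sub>m n)) = K (low ?e)"
    using t n r by (intro hecke_equivalent[OF K]) (auto simp: det_mult[of _ n] det_multrow_mat)
  moreover have "(?s * ?N) * ?e * 1\<^sub>m n = ?s * ?e"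
  proof -
    have "?N * ?e = ?e"
      by (rule eq_matI) (use r in \<open>auto simp: multrow_mat_index[of _ n n] simp del: index_mult_mat(1)\<close>)
    then show ?thesis by (simp add: assoc_mult_mat[of _ n n _ n _ n])
  qed
  ultimately have "K (low ?e) = \<chi> (1 / t) * K (low ?e)" by (simp add: det_multrow0)
  moreover have "\<chi> (1 / t) \<noteq> 1" using \<chi>_inverse(1)[OF t(1)] t(2) by auto
  ultimately show ?thesis by simp
qed

text \<open>
  On \<open>P\<close> the reflection replaces \<open>\<chi> (det A)\<close> by \<open>\<chi> (det D) = \<chi> (1 / det A)\<close>, which is the same for quadratic \<open>\<chi>\<close>.
  It sends \<open>u(c)\<close> to \<open>u(c\<^sup>T)\<close>, and \<open>c\<close> and \<open>c\<^sup>T\<close> have the same normal form.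
\<close>
lemma hecke_block_transpose:
  assumes sq: "\<And>t. t \<noteq> 0 \<Longrightarrow> (\<chi> t)\<^sup>2 = 1"
    and K: "K \<in> hecke" and g: "g \<in> carrier (SL (2 * n))"
  shows "K (block_transpose n g) = K g"
proof -
  have P: "block_transpose n p \<in> P" "\<omega> (block_transpose n p) = \<omega> p" if p: "p \<in> P" for p
  proof -
    obtain A B D where *: "A \<in> carrier_mat n n" "B \<in> carrier_mat n n" "D \<in> carrier_mat n n"
      "det A * det D = 1" "p = four_block_mat A B (0\<^sub>m n n) D" using p by (rule Siegel_parabolicE)
    then have e: "block_transpose n p = four_block_mat D\<^sup>T B\<^sup>T (0\<^sub>m n n) A\<^sup>T"
      by (simp add: block_transpose_blocks)
    have d: "det D\<^sup>T * det A\<^sup>T = 1" using * by (simp add: det_transpose[of _ n] mult.commute)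
    show "block_transpose n p \<in> P" unfolding e using * d by (intro Siegel_parabolicI) auto
    have "\<omega> (block_transpose n p) = \<chi> (det D)"
      unfolding e using * d by (subst character_eq) (auto simp: det_transpose[of _ n])
    also have "\<dots> = \<chi> (det A)"
    proof -
      have "det A \<noteq> 0" using *(4) by auto
      then have "\<chi> (det A) * \<chi> (det A) = 1" using sq by (simp add: power2_eq_square)
      moreover have "\<chi> (det A) * \<chi> (det D) = 1" using *(4) \<chi>_mult[of "det A" "det D"] \<chi>_one by simp
      ultimately show ?thesis by (metis mult_cancel_left mult_zero_left zero_neq_one)
    qed
    finally show "\<omega> (block_transpose n p) = \<omega> p" using * by (simp add: character_eq)
  qed
  obtain p c p' where p: "p \<in> P" "p' \<in> P" "c \<in> carrier_mat n n" "g = p * low c * p'"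
    using g by (rule lower_unipotent_representative)
  have cc: "x \<in> carrier_mat (2 * n) (2 * n)" if "x \<in> P" for x using P_carrier[OF that] by simp
  note l = lower_unipotent_mem[OF p(3)]
  have pl: "p * low c \<in> carrier_mat (2 * n) (2 * n)" using cc[OF p(1)] l by simp
  have "block_transpose n g = block_transpose n p' * (block_transpose n (low c) * block_transpose n p)"
    unfolding p(4) using block_transpose_anti(1)[OF pl cc[OF p(2)]] block_transpose_anti(1)[OF cc[OF p(1)], of "low c"] l by simp
  also have "block_transpose n (low c) = low c\<^sup>T"
    unfolding lower_unipotent_def using p(3) by (subst block_transpose_blocks) auto
  finally have bg: "block_transpose n g = block_transpose n p' * low c\<^sup>T * block_transpose n p"
    using cc[OF P(1)[OF p(1)]] cc[OF P(1)[OF p(2)]] lower_unipotent_mem[of "c\<^sup>T" n] p(3)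
    by (simp add: assoc_mult_mat[of _ "2*n" "2*n" _ "2*n" _ "2*n"])
  have "K (low c\<^sup>T) = K (low c)"
  proof (cases "det c = 0")
    case False
    then show ?thesis using hecke_invertible[OF K p(3)] hecke_invertible[OF K, of "c\<^sup>T"] p(3)
      by (simp add: det_transpose[of _ n])
  next
    case True
    then obtain X Y r where *: "r < n" "X \<in> carrier_mat n n" "Y \<in> carrier_mat n n" "det X = det Y" "det X \<noteq> 0"
      "c = X * rank_idem n r * Y" by (rule singular_normal_form[OF p(3)])
    have "c\<^sup>T = Y\<^sup>T * rank_idem n r * X\<^sup>T"
      unfolding *(6) using * by (simp add: transpose_mult[of _ n n _ n] assoc_mult_mat[of _ n n _ n _ n])
    moreover have "K (low (Y\<^sup>T * rank_idem n r * X\<^sup>T)) = K (low (rank_idem n r))"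
      using * by (intro hecke_equivalent[OF K]) (auto simp: det_transpose[of _ n])
    moreover have "K (low c) = K (low (rank_idem n r))"
      unfolding *(6) using * by (intro hecke_equivalent[OF K]) auto
    ultimately show ?thesis by simp
  qed
  then show ?thesis
    unfolding bg using hecke_both[OF K P(1)[OF p(2)] P(1)[OF p(1)] lower_unipotent_mem[of "c\<^sup>T" n]]
      hecke_both[OF K p(1,2) l] P(2) p by simp
qed

lemma lower_unipotent_zero: "low (0\<^sub>m n n) = 1\<^sub>m (2 * n)"
  by (simp add: lower_unipotent_def mult_2)

lemma delta_zero: "\<delta> (low (0\<^sub>m n n)) = 1"
  using P_closed(2) char_one by (simp add: \<delta>_def lower_unipotent_zero)

lemma lower_unipotent_notin_P:
  assumes "C \<in> carrier_mat n n" "C \<noteq> 0\<^sub>m n n" shows "low C \<notin> P"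
proof
  assume "low C \<in> P"
  then obtain A B D where *: "A \<in> carrier_mat n n" "B \<in> carrier_mat n n" "D \<in> carrier_mat n n"
      "low C = four_block_mat A B (0\<^sub>m n n) D" by (rule Siegel_parabolicE)
  from square_blocks_inj(3)[where n = n, OF _ _ assms(1) _ *(1,2) _ *(3) *(4)[unfolded lower_unipotent_def]]
  show False using assms by simp
qed

lemma one_neq_zero_mat: "1\<^sub>m n \<noteq> (0\<^sub>m n n :: 'a mat)"
  using n det_one[of n] det_zero[of n] by (metis zero_neq_one)

lemma conv_commute:
  assumes K: "K \<in> hecke" "L \<in> hecke" shows "conv K L = conv L K"
proof (cases "\<forall>t. t \<noteq> 0 \<longrightarrow> (\<chi> t)\<^sup>2 = 1")
  case True
  show ?thesis
  proof (rule conv_commute_if_anti_invariant[where \<sigma> = "block_transpose n"])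
    show "bij_betw (block_transpose n) (carrier (SL (2 * n))) (carrier (SL (2 * n)) :: 'a mat set)"
      by (rule bij_betwI[where g = "block_transpose n"]) (auto simp: block_transpose_anti)
  qed (use K True hecke_block_transpose in \<open>auto simp: block_transpose_anti(1)\<close>)
next
  case False
  then obtain t where t: "t \<noteq> 0" "(\<chi> t)\<^sup>2 \<noteq> 1" by auto
  then have t1: "\<chi> t \<noteq> 1" by auto
  show ?thesis
  proof (rule conv_commute_if_multiples_of_delta[OF _ K])
    fix K assume K: "K \<in> hecke"
    let ?c = "K (low (0\<^sub>m n n))"
    let ?L = "K - fun_scale ?c \<delta>"
    have L: "?L \<in> hecke"
      using K delta_hecke fs.subspace_diff fs.subspace_scale subspace_hecke by blast
    have "?L = 0"
    proof (rule hecke_eq_zero[OF L])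
      fix r assume "r \<le> n"
      then consider "r = 0" | "r = n" | "0 < r" "r < n" by linarith
      then show "?L (low (rank_idem n r)) = 0"
      proof cases
        case 1 then show ?thesis by (simp add: fun_scale_def delta_zero)
      next
        case 2 then show ?thesis using hecke_vanish_full_rank[OF L t] by (simp del: minus_apply)
      next
        case 3 then show ?thesis using hecke_vanish_middle_rank[OF L _ _ t(1) t1] by blast
      qed
    qed
    then show "\<exists>c. K = fun_scale c \<delta>" by (metis eq_iff_diff_eq_0)
  qed
qed

lemma dim_hecke_nonquadratic:
  assumes t: "t \<noteq> 0" "(\<chi> t)\<^sup>2 \<noteq> 1" shows "fs.dim hecke = 1"
proof -
  have t1: "\<chi> t \<noteq> 1" using t by auto
  have "fs.dim hecke = card {0::nat}"
  proof (rule dim_hecke[where x = "\<lambda>r. low (rank_idem n r)" and F = "\<lambda>_. \<delta>"])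
    fix K assume K: "K \<in> hecke" and 0: "\<And>i. i \<in> {0} \<Longrightarrow> K (low (rank_idem n i)) = 0"
    show "K = 0"
    proof (rule hecke_eq_zero[OF K])
      fix r assume "r \<le> n"
      then consider "r = 0" | "r = n" | "0 < r" "r < n" by linarith
      then show "K (low (rank_idem n r)) = 0"
        using 0[of 0] hecke_vanish_full_rank[OF K t] hecke_vanish_middle_rank[OF K _ _ t(1) t1] by cases auto
    qed
  qed (use delta_hecke delta_zero in auto)
  then show ?thesis by simp
qed

text \<open>
  The entries \<open>g $$ (i + n, j)\<close> form the lower left block. For quadratic \<open>\<chi>\<close> other than \<open>1\<close> this kernel and
  \<open>\<delta>\<close> span the Hecke algebra.
\<close>
definition det_kernel :: "'a mat \<Rightarrow> complex" where
  "det_kernel g = (if g \<in> carrier (SL (2 * n)) then \<chi> (det (mat n n (\<lambda>(i,j). g $$ (i + n, j)))) else 0)"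

lemma det_kernel_blocks:
  assumes "A \<in> carrier_mat n n" "B \<in> carrier_mat n n" "C \<in> carrier_mat n n" "D \<in> carrier_mat n n"
    "four_block_mat A B C D \<in> carrier (SL (2 * n))"
  shows "det_kernel (four_block_mat A B C D) = \<chi> (det C)"
proof -
  have "mat n n (\<lambda>(i,j). four_block_mat A B C D $$ (i + n, j)) = C" by (rule eq_matI) (use assms in auto)
  then show ?thesis using assms(5) by (simp add: det_kernel_def)
qed

text \<open>
  Multiplication by an element of \<open>P\<close> multiplies the lower left block by \<open>D\<close> from the left or by \<open>A\<close> from the
  right, and \<open>\<chi> (det D) = \<chi> (det A)\<close> for quadratic \<open>\<chi>\<close>.
\<close>
lemma det_kernel_hecke:
  assumes sq: "\<And>t. t \<noteq> 0 \<Longrightarrow> (\<chi> t)\<^sup>2 = 1"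
  shows "det_kernel \<in> hecke"
proof -
  have *: "det_kernel (p * g) = \<omega> p * det_kernel g \<and> det_kernel (g * p) = \<omega> p * det_kernel g"
    if p: "p \<in> P" and g: "g \<in> carrier (SL (2 * n))" for p g
  proof -
    obtain A B D where a: "A \<in> carrier_mat n n" "B \<in> carrier_mat n n" "D \<in> carrier_mat n n"
      "det A * det D = 1" and pb: "p = four_block_mat A B (0\<^sub>m n n) D" using p by (rule Siegel_parabolicE)
    have "g \<in> carrier_mat (2 * n) (2 * n)" using g by simp
    then obtain A' B' C' D' where b: "A' \<in> carrier_mat n n" "B' \<in> carrier_mat n n" "C' \<in> carrier_mat n n"
      "D' \<in> carrier_mat n n" and gb: "g = four_block_mat A' B' C' D'" by (rule square_blocks_cases)
    have pg: "p * g \<in> carrier (SL (2 * n))" "g * p \<in> carrier (SL (2 * n))"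
      using m_closed[OF P_carrier[OF p] g] m_closed[OF g P_carrier[OF p]] by auto
    have dA: "det A \<noteq> 0" using a(4) by auto
    then have "\<chi> (det A) * \<chi> (det A) = 1" using sq by (simp add: power2_eq_square)
    moreover have "\<chi> (det A) * \<chi> (det D) = 1" using a(4) \<chi>_mult[of "det A" "det D"] \<chi>_one by simp
    ultimately have AD: "\<chi> (det D) = \<chi> (det A)" by (metis mult_cancel_left mult_zero_left zero_neq_one)
    have w: "\<omega> p = \<chi> (det A)" unfolding pb using a by (intro character_eq)
    have k: "det_kernel g = \<chi> (det C')" using g b unfolding gb by (intro det_kernel_blocks)
    have pgb: "p * g = four_block_mat (A * A' + B * C') (A * B' + B * D') (D * C') (D * D')"
      unfolding pb gb using a b by (simp add: mult_square_blocks[of _ n])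
    have gpb: "g * p = four_block_mat (A' * A) (A' * B + B' * D) (C' * A) (C' * B + D' * D)"
      unfolding pb gb using a b by (simp add: mult_square_blocks[of _ n])
    have "det_kernel (p * g) = \<chi> (det (D * C'))"
      using pg(1) a b unfolding pgb by (intro det_kernel_blocks) auto
    moreover have "det_kernel (g * p) = \<chi> (det (C' * A))"
      using pg(2) a b unfolding gpb by (intro det_kernel_blocks) auto
    ultimately show ?thesis using a b w k AD by (simp add: det_mult[of _ n] \<chi>_mult)
  qed
  then show ?thesis unfolding hecke_def Ind_space_def by (auto simp: det_kernel_def)
qed

lemma det_kernel_lower_unipotent:
  "C \<in> carrier_mat n n \<Longrightarrow> det_kernel (low C) = \<chi> (det C)"
  using lower_unipotent_mem[of C n] unfolding lower_unipotent_def by (intro det_kernel_blocks) auto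

lemma dim_hecke_quadratic:
  assumes sq: "\<And>t. t \<noteq> 0 \<Longrightarrow> (\<chi> t)\<^sup>2 = 1" and t: "t \<noteq> 0" "\<chi> t \<noteq> 1" shows "fs.dim hecke = 2"
proof -
  have "fs.dim hecke = card {0, n}"
  proof (rule dim_hecke[where x = "\<lambda>r. low (rank_idem n r)" and F = "\<lambda>r. if r = 0 then \<delta> else det_kernel"])
    fix K assume K: "K \<in> hecke" and 0: "\<And>i. i \<in> {0, n} \<Longrightarrow> K (low (rank_idem n i)) = 0"
    show "K = 0"
    proof (rule hecke_eq_zero[OF K])
      fix r assume "r \<le> n"
      then consider "r = 0 \<or> r = n" | "0 < r" "r < n" by linarith
      then show "K (low (rank_idem n r)) = 0"
        using 0 hecke_vanish_middle_rank[OF K _ _ t] by cases auto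
    qed
  next
    fix i j assume ij: "i \<in> {0, n}" "j \<in> {0, n}"
    have "\<delta> (low (1\<^sub>m n)) = 0"
      using lower_unipotent_notin_P[of "1\<^sub>m n"] one_neq_zero_mat by (simp add: \<delta>_def)
    moreover have "det_kernel (low (0\<^sub>m n n)) = 0"
      using n by (simp add: det_kernel_lower_unipotent \<chi>_def)
    moreover have "det_kernel (low (1\<^sub>m n)) = 1" by (simp add: det_kernel_lower_unipotent \<chi>_one)
    ultimately show "(if i = 0 then \<delta> else det_kernel) (low (rank_idem n j)) = (if i = j then 1 else 0)"
      using ij n delta_zero by auto
  qed (use delta_hecke det_kernel_hecke[OF sq] in auto)
  then show ?thesis using n by simp
qed

definition double_coset :: "nat \<Rightarrow> 'a mat set" where
  "double_coset r = {p * low (rank_idem n r) * p' | p p'. p \<in> P \<and> p' \<in> P}"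

lemma double_coset_mult:
  assumes p: "p \<in> P" and g: "g \<in> carrier (SL (2 * n))"
  shows "p * g \<in> double_coset r \<longleftrightarrow> g \<in> double_coset r" "g * p \<in> double_coset r \<longleftrightarrow> g \<in> double_coset r"
proof -
  let ?G = "SL (2 * n) :: 'a mat monoid" and ?l = "low (rank_idem n r)"
  have l: "?l \<in> carrier ?G" by (rule lower_unipotent_mem) simp
  have dc: "double_coset r = {a \<otimes>\<^bsub>?G\<^esub> ?l \<otimes>\<^bsub>?G\<^esub> b | a b. a \<in> P \<and> b \<in> P}"
    unfolding double_coset_def by simp
  have left: "x \<otimes>\<^bsub>?G\<^esub> h \<in> double_coset r" if x: "x \<in> P" and h: "h \<in> double_coset r" for x h
  proof -
    obtain a b where ab: "a \<in> P" "b \<in> P" "h = a \<otimes>\<^bsub>?G\<^esub> ?l \<otimes>\<^bsub>?G\<^esub> b" using h unfolding dc by blast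
    have "x \<otimes>\<^bsub>?G\<^esub> h = (x \<otimes>\<^bsub>?G\<^esub> a) \<otimes>\<^bsub>?G\<^esub> ?l \<otimes>\<^bsub>?G\<^esub> b"
      unfolding ab(3) using P_carrier[OF x] P_carrier[OF ab(1)] P_carrier[OF ab(2)] l
      by (simp only: m_assoc m_closed)
    then show ?thesis unfolding dc using P_closed(1)[OF x ab(1)] ab(2) by blast
  qed
  have right: "h \<otimes>\<^bsub>?G\<^esub> x \<in> double_coset r" if x: "x \<in> P" and h: "h \<in> double_coset r" for x h
  proof -
    obtain a b where ab: "a \<in> P" "b \<in> P" "h = a \<otimes>\<^bsub>?G\<^esub> ?l \<otimes>\<^bsub>?G\<^esub> b" using h unfolding dc by blast
    have "h \<otimes>\<^bsub>?G\<^esub> x = a \<otimes>\<^bsub>?G\<^esub> ?l \<otimes>\<^bsub>?G\<^esub> (b \<otimes>\<^bsub>?G\<^esub> x)"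
      unfolding ab(3) using P_carrier[OF x] P_carrier[OF ab(1)] P_carrier[OF ab(2)] l
      by (simp only: m_assoc m_closed)
    then show ?thesis unfolding dc using P_closed(1)[OF ab(2) x] ab(1) by blast
  qed
  have "g = inv\<^bsub>?G\<^esub> p \<otimes>\<^bsub>?G\<^esub> (p \<otimes>\<^bsub>?G\<^esub> g)" using P_carrier[OF p] g by (simp only: cancel)
  then have "p \<otimes>\<^bsub>?G\<^esub> g \<in> double_coset r \<longleftrightarrow> g \<in> double_coset r"
    using left[OF p] left[OF P_closed(3)[OF p]] by metis
  then show "p * g \<in> double_coset r \<longleftrightarrow> g \<in> double_coset r" by simp
  have "g = (g \<otimes>\<^bsub>?G\<^esub> p) \<otimes>\<^bsub>?G\<^esub> inv\<^bsub>?G\<^esub> p"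
    using P_carrier[OF p] g by (simp only: m_assoc inv_closed r_inv r_one)
  then have "g \<otimes>\<^bsub>?G\<^esub> p \<in> double_coset r \<longleftrightarrow> g \<in> double_coset r"
    using right[OF p] right[OF P_closed(3)[OF p]] by metis
  then show "g * p \<in> double_coset r \<longleftrightarrow> g \<in> double_coset r" by simp
qed

text \<open>
  The lower left blocks of elements of one double coset differ by invertible factors, so they have
  the same rank.
\<close>
lemma lower_unipotent_in_double_coset:
  assumes r: "r \<le> n" "s \<le> n"
  shows "low (rank_idem n s) \<in> double_coset r \<longleftrightarrow> r = s"
proof
  assume "r = s"
  have l: "low (rank_idem n s) \<in> carrier (SL (2 * n))" by (rule lower_unipotent_mem) simp
  have "low (rank_idem n s) = 1\<^sub>m (2 * n) * low (rank_idem n s) * 1\<^sub>m (2 * n)"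
    using l left_mult_one_mat[of "low (rank_idem n s)" "2 * n" "2 * n"]
      right_mult_one_mat[of "low (rank_idem n s)" "2 * n" "2 * n"] by (simp only: SL_simps)
  then show "low (rank_idem n s) \<in> double_coset r"
    unfolding double_coset_def \<open>r = s\<close> using P_closed(2) by auto
next
  assume "low (rank_idem n s) \<in> double_coset r"
  then obtain p p' where p: "p \<in> P" "p' \<in> P" "low (rank_idem n s) = p * low (rank_idem n r) * p'"
    by (auto simp: double_coset_def)
  obtain A B D where a: "A \<in> carrier_mat n n" "B \<in> carrier_mat n n" "D \<in> carrier_mat n n"
    "det A * det D = 1" "p = four_block_mat A B (0\<^sub>m n n) D" using p(1) by (rule Siegel_parabolicE)
  obtain A' B' D' where b: "A' \<in> carrier_mat n n" "B' \<in> carrier_mat n n" "D' \<in> carrier_mat n n"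
    "det A' * det D' = 1" "p' = four_block_mat A' B' (0\<^sub>m n n) D'" using p(2) by (rule Siegel_parabolicE)
  let ?r = "rank_idem n r :: 'a mat" and ?s = "rank_idem n s :: 'a mat"
  have "four_block_mat (1\<^sub>m n) (0\<^sub>m n n) ?s (1\<^sub>m n) =
      four_block_mat ((A + B * ?r) * A') ((A + B * ?r) * B' + B * D') (D * ?r * A') (D * ?r * B' + D * D')"
    using p(3) a b unfolding lower_unipotent_def by (simp add: mult_square_blocks[of _ n])
  from square_blocks_inj(3)[where n = n, OF _ _ _ _ _ _ _ _ this] have e: "?s = D * ?r * A'" using a b by simp
  have "s \<le> r" by (rule rank_idem_le_if_factor[OF a(3) b(1) r e[symmetric]])
  have "det D \<noteq> 0" "det A' \<noteq> 0" using a(4) b(4) by auto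
  then obtain D1 A1 where i: "D1 \<in> carrier_mat n n" "D1 * D = 1\<^sub>m n" "A1 \<in> carrier_mat n n" "A' * A1 = 1\<^sub>m n"
    using inverse_mat[OF a(3)] inverse_mat[OF b(1)] by metis
  have "D1 * ?s * A1 = (D1 * D) * ?r * (A' * A1)"
    unfolding e using a b i(1,3) by (simp add: assoc_mult_mat[of _ n n _ n _ n])
  then have "D1 * ?s * A1 = ?r" unfolding i(2,4) by simp
  then have "r \<le> s" by (rule rank_idem_le_if_factor[OF i(1,3) r(2,1)])
  then show "r = s" using \<open>s \<le> r\<close> by simp
qed

lemma dim_hecke_trivial:
  assumes triv: "\<And>p. p \<in> P \<Longrightarrow> \<omega> p = 1" shows "fs.dim hecke = n + 1"
proof -
  have "fs.dim hecke = card {..n}"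
  proof (rule dim_hecke[where x = "\<lambda>r. low (rank_idem n r)"
        and F = "\<lambda>r g. if g \<in> carrier (SL (2 * n)) \<and> g \<in> double_coset r then 1 else 0"])
    fix r
    show "(\<lambda>g. if g \<in> carrier (SL (2 * n)) \<and> g \<in> double_coset r then 1 else 0) \<in> hecke"
      using m_closed P_carrier unfolding hecke_def Ind_space_def
      by (auto simp: triv double_coset_mult)
  next
    fix i j assume "i \<in> {..n}" "j \<in> {..n}"
    then show "(if low (rank_idem n j) \<in> carrier (SL (2 * n)) \<and> low (rank_idem n j) \<in> double_coset i then 1 else 0) =
      (if i = j then 1 else 0 :: complex)"
      using lower_unipotent_mem[of "rank_idem n j :: 'a mat" n] lower_unipotent_in_double_coset by auto
  qed (use hecke_eq_zero in auto)
  then show ?thesis by simp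
qed

end

theorem theorem1p0p1:
  fixes q n :: nat
    and H :: "'a::{field,finite} mat monoid"
    and P :: "'a mat set"
    and \<omega> :: "'a mat \<Rightarrow> complex"
  assumes "primepow q" and "\<not> 2 dvd q" and "\<not> 3 dvd q"
    and "card (UNIV :: 'a set) = q"
    and "n \<ge> 1"
    and "H = SL (2 * n)"
    and "P = Siegel_parabolic n"
    and "group_character H P \<omega>"
  shows "multiplicity_free H fun_scale (Ind_space H P \<omega>) (right_translation H) \<and>
    (\<forall>D. irreducible_decomposition H fun_scale (Ind_space H P \<omega>) (right_translation H) D \<longrightarrow>
       card D =
         (if \<not> (\<forall>p\<in>P. (\<omega> p)\<^sup>2 = 1) then 1
          else if \<not> (\<forall>p\<in>P. \<omega> p = 1) then 2
          else n + 1))"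
proof -
  \<comment> \<open>The characteristic divides the number of elements of the field.\<close>
  have prime_nz: "(of_nat l :: 'a) \<noteq> 0" if "prime l" "\<not> l dvd q" for l
  proof
    assume "(of_nat l :: 'a) = 0"
    then have "CHAR('a) dvd l" by (simp add: of_nat_eq_0_iff_char_dvd)
    then have "CHAR('a) = l" using \<open>prime l\<close> CHAR_not_1'[where 'a = 'a] by (auto simp: prime_nat_iff)
    then show False using CHAR_dvd_CARD[where 'a = 'a] assms(4) that(2) by simp
  qed
  interpret siegel_character n \<omega>
    by unfold_locales (use assms prime_nz[of 2] prime_nz[of 3] in auto)
  have "card D = (if \<not> (\<forall>p\<in>P. (\<omega> p)\<^sup>2 = 1) then 1 else if \<not> (\<forall>p\<in>P. \<omega> p = 1) then 2 else n + 1)"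
    if D: "irreducible_decomposition H fun_scale (Ind_space H P \<omega>) (right_translation H) D" for D
  proof -
    have "card D = fs.dim hecke"
      using multiplicity_free_if_hecke_commutative(2)[OF conv_commute] D assms(6,7) by simp
    moreover have "fs.dim hecke = 1" if "\<not> (\<forall>p\<in>P. (\<omega> p)\<^sup>2 = 1)"
      using that dim_hecke_nonquadratic trivial_iff[of 2] assms(7) by auto
    moreover have "fs.dim hecke = 2" if "\<forall>p\<in>P. (\<omega> p)\<^sup>2 = 1" "\<not> (\<forall>p\<in>P. \<omega> p = 1)"
      using that dim_hecke_quadratic trivial_iff[of 2] trivial_iff[of 1] assms(7) by auto
    moreover have "fs.dim hecke = n + 1" if "\<forall>p\<in>P. \<omega> p = 1"
      using that dim_hecke_trivial assms(7) by auto
    ultimately show ?thesis by auto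
  qed
  then show ?thesis
    using multiplicity_free_if_hecke_commutative(1)[OF conv_commute] assms(6,7) by simp
qed

end
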